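(* If $p>\deg(\mathcal D)$, then $\mathcal X$ is $(q^u,q^m)$-Frobenius classical with respect to $\mathcal D$ (it being assumed that $\kappa_0=0$).
   Context: $\mathbb F_q$ is a finite field of characteristic $p$, $\overline{\mathbb F}_q$ its algebraic closure. $\mathcal X$ is a projective, geometrically irreducible, nonsingular algebraic curve defined over $\mathbb F_q$. $n\ge 2$, and $\phi=(f_0:\cdots:f_n):\mathcal X\to\mathbb P^n(\overline{\mathbb F}_q)$ is a nondegenerate morphism (image not contained in a hyperplane) defined over $\mathbb F_q$, with $f_i\in\mathbb F_q(\mathcal X)$. $u,m$ are coprime integers with $m>u\ge1$. $D_t^{(r)}$ is the $r$-th Hasse derivative with respect to a separating variable $t$. Put $e_P=-\min\{v_P(f_0),\ldots,v_P(f_n)\}$, $E=\sum_P e_PP$, $\mathcal D=\{\operatorname{div}(\sum_i a_if_i)+E : (a_0:\cdots:a_n)\in\mathbb P^n(\overline{\mathbb F}_q)\}$, the linear series associated to $\phi$; its degree is $\deg(\mathcal D)=\deg E$. For a separating variable $t\in\mathbb F_q(\mathcal X)$ and non-negative integers $\rho_0,\ldots,\rho_{n-2}$, let $\mathcal A_t^{\rho_0,\ldots,\rho_{n-2}}(f_0,\ldots,f_n)$ be the determinant of the $(n+1)\times(n+1)$ matrix whose rows are $(f_0^{q^m},\ldots,f_n^{q^m})$, $(f_0^{q^u},\ldots,f_n^{q^u})$, and $(D_t^{(\rho_i)}f_0,\ldots,D_t^{(\rho_i)}f_n)$ for $i=0,\ldots,n-2$. The $(q^u,q^m)$-Frobenius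 order-sequence $(\kappa_0,\ldots,\kappa_{n-2})$ of $\mathcal X$ with respect to $\mathcal D$ is the lexicographically minimal sequence $0\le\kappa_0<\cdots<\kappa_{n-2}$ with $\mathcal A_t^{\kappa_0,\ldots,\kappa_{n-2}}(f_0,\ldots,f_n)\neq0$. $\mathcal X$ is $(q^u,q^m)$-Frobenius classical with respect to $\mathcal D$ if $\kappa_i=i$ for all $i\in\{0,\ldots,n-2\}$. Standing assumption: $\kappa_0=0$. *)

theory Defs
  imports
    "HOL-Algebra.Algebraic_Closure_Type"
    "HOL-Library.Cardinality"
    "HOL-Library.Poly_Mapping"
    "Jordan_Normal_Form.Determinant"
begin

section \<open>Projective algebraic sets\<close>

text \<open>
  The coordinates \<open>X\<^sub>0, \<dots>, X\<^sub>N\<close> of projective \<open>N\<close>-space are indexed by the natural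
  numbers up to \<open>N\<close>. A polynomial in them maps exponent vectors to coefficients.
\<close>

type_synonym 'k mpoly = "(nat \<Rightarrow>\<^sub>0 nat) \<Rightarrow>\<^sub>0 'k"

definition eval_mpoly :: "('k::field \<Rightarrow> 'b::field) \<Rightarrow> (nat \<Rightarrow> 'b) \<Rightarrow> 'k mpoly \<Rightarrow> 'b" where
  "eval_mpoly h x F =
     (\<Sum>m\<in>Poly_Mapping.keys F. h (Poly_Mapping.lookup F m) *
        (\<Prod>i\<in>Poly_Mapping.keys m. x i ^ Poly_Mapping.lookup m i))"

definition form :: "nat \<Rightarrow> nat \<Rightarrow> 'k::field mpoly \<Rightarrow> bool" where
  "form N d F \<longleftrightarrow> (\<forall>m\<in>Poly_Mapping.keys F.
     Poly_Mapping.keys m \<subseteq> {..N} \<and> (\<Sum>i\<in>Poly_Mapping.keys m. Poly_Mapping.lookup m i) = d)"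

definition coeffs_in :: "'k::field set \<Rightarrow> 'k mpoly \<Rightarrow> bool" where
  "coeffs_in A F \<longleftrightarrow> (\<forall>m. Poly_Mapping.lookup F m \<in> A)"

text \<open>A point is the class of all its homogeneous coordinate vectors.\<close>

type_synonym 'k point = "(nat \<Rightarrow> 'k) set"

definition coord_vectors :: "nat \<Rightarrow> (nat \<Rightarrow> 'k::field) set" where
  "coord_vectors N = {v. (\<exists>i. v i \<noteq> 0) \<and> (\<forall>i>N. v i = 0)}"

definition proj_space :: "nat \<Rightarrow> 'k::field point set" where
  "proj_space N = coord_vectors N // {(v, w). \<exists>c. c \<noteq> 0 \<and> w = (\<lambda>i. c * v i)}"

definition vanishes_at :: "'k::field mpoly \<Rightarrow> 'k point \<Rightarrow> bool" where
  "vanishes_at F P \<longleftrightarrow> (\<forall>v\<in>P. eval_mpoly id v F = 0)"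

definition zero_set :: "nat \<Rightarrow> 'k::field mpoly set \<Rightarrow> 'k point set" where
  "zero_set N S = {P \<in> proj_space N. \<forall>F\<in>S. vanishes_at F P}"

definition zariski_closed :: "nat \<Rightarrow> 'k::field point set \<Rightarrow> bool" where
  "zariski_closed N Z \<longleftrightarrow> (\<exists>S. (\<forall>F\<in>S. \<exists>d. form N d F) \<and> Z = zero_set N S)"

definition irreducible_set :: "nat \<Rightarrow> 'k::field point set \<Rightarrow> bool" where
  "irreducible_set N C \<longleftrightarrow> C \<noteq> {} \<and>
     (\<forall>Y Z. zariski_closed N Y \<longrightarrow> zariski_closed N Z \<longrightarrow> C \<subseteq> Y \<union> Z \<longrightarrow> C \<subseteq> Y \<or> C \<subseteq> Z)"

definition defined_over :: "nat \<Rightarrow> 'k::field set \<Rightarrow> 'k point set \<Rightarrow> bool" where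
  "defined_over N A C \<longleftrightarrow>
     (\<exists>S. (\<forall>F\<in>S. coeffs_in A F \<and> (\<exists>d. form N d F)) \<and> C = zero_set N S)"

section \<open>Rational functions, local rings and nonsingular curves\<close>

text \<open>
  Rational functions on \<open>C\<close> are quotients of forms of equal degree, the denominator not in the
  homogeneous ideal of \<open>C\<close>. To have them as elements of a type, the function field is a
  field \<^typ>\<open>'b\<close>, with the embedding \<open>\<iota>\<close> of the constants and with elements \<open>x 0, \<dots>, x N\<close>
  that play the role of the homogeneous coordinates (one may think of \<open>x i = X\<^sub>i / X\<^sub>j\<close> for a fixed
  \<open>X\<^sub>j\<close> that does not vanish identically on \<open>C\<close>): a form vanishes on \<open>C\<close> iff it is zero at \<open>x\<close>. Hence
  \<open>F / G \<mapsto> F(x) / G(x)\<close> is a well-defined embedding of the field of rational functions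
  into \<^typ>\<open>'b\<close>, which is required to be onto.
\<close>

definition rational_functions ::
  "nat \<Rightarrow> ('k::field \<Rightarrow> 'b::field) \<Rightarrow> (nat \<Rightarrow> 'b) \<Rightarrow> 'k set \<Rightarrow> 'b set" where
  "rational_functions N \<iota> x A =
     {eval_mpoly \<iota> x F / eval_mpoly \<iota> x G | F G d.
        form N d F \<and> form N d G \<and> coeffs_in A F \<and> coeffs_in A G \<and> eval_mpoly \<iota> x G \<noteq> 0}"

definition function_field ::
  "nat \<Rightarrow> 'k::field point set \<Rightarrow> ('k \<Rightarrow> 'b::field) \<Rightarrow> (nat \<Rightarrow> 'b) \<Rightarrow> bool" where
  "function_field N C \<iota> x \<longleftrightarrow> field_hom \<iota> \<and>
     (\<forall>d F. form N d F \<longrightarrow> (eval_mpoly \<iota> x F = 0 \<longleftrightarrow> (\<forall>P\<in>C. vanishes_at F P))) \<and>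
     rational_functions N \<iota> x UNIV = UNIV"

definition transcendental_over :: "('c::field \<Rightarrow> 'b::field) \<Rightarrow> 'b \<Rightarrow> bool" where
  "transcendental_over h t \<longleftrightarrow> (\<forall>g. poly (map_poly h g) t = 0 \<longrightarrow> g = 0)"

text \<open>
  Transcendence degree one. Below, \<open>A(t, Y)\<close> is a non-zero polynomial in \<open>Y\<close> over the field of
  rational expressions in \<open>t\<close>, since \<open>t\<close> is transcendental.
\<close>

definition transcendence_degree_one :: "('k::field \<Rightarrow> 'b::field) \<Rightarrow> bool" where
  "transcendence_degree_one \<iota> \<longleftrightarrow> (\<exists>t. transcendental_over \<iota> t \<and>
     (\<forall>y. \<exists>A :: 'k poly poly. A \<noteq> 0 \<and>
        poly (map_poly (\<lambda>a. poly (map_poly \<iota> a) t) A) y = 0))"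

definition local_ring ::
  "nat \<Rightarrow> ('k::field \<Rightarrow> 'b::field) \<Rightarrow> (nat \<Rightarrow> 'b) \<Rightarrow> 'k point \<Rightarrow> 'b set" where
  "local_ring N \<iota> x P =
     {eval_mpoly \<iota> x F / eval_mpoly \<iota> x G | F G d.
        form N d F \<and> form N d G \<and> \<not> vanishes_at G P}"

definition max_ideal ::
  "nat \<Rightarrow> ('k::field \<Rightarrow> 'b::field) \<Rightarrow> (nat \<Rightarrow> 'b) \<Rightarrow> 'k point \<Rightarrow> 'b set" where
  "max_ideal N \<iota> x P =
     {eval_mpoly \<iota> x F / eval_mpoly \<iota> x G | F G d.
        form N d F \<and> form N d G \<and> vanishes_at F P \<and> \<not> vanishes_at G P}"

definition local_parameter ::
  "nat \<Rightarrow> ('k::field \<Rightarrow> 'b::field) \<Rightarrow> (nat \<Rightarrow> 'b) \<Rightarrow> 'k point \<Rightarrow> 'b \<Rightarrow> bool" where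
  "local_parameter N \<iota> x P s \<longleftrightarrow> max_ideal N \<iota> x P = (\<lambda>y. s * y) ` local_ring N \<iota> x P"

text \<open>
  A projective, geometrically irreducible, nonsingular curve over the finite field \<^typ>\<open>'a\<close>,
  given by its set \<open>C\<close> of points over the algebraic closure. A point is nonsingular if its local
  ring is regular; the local ring has dimension one, so this says that its maximal ideal is
  generated by one element.
\<close>

locale nonsingular_projective_curve =
  fixes N :: nat
    and C :: "'a::finite_field alg_closure point set"
    and \<iota> :: "'a alg_closure \<Rightarrow> 'b::field"
    and x :: "nat \<Rightarrow> 'b"
  assumes defined_over: "defined_over N (range to_ac) C"
    and geometrically_irreducible: "irreducible_set N C"
    and function_field: "function_field N C \<iota> x"
    and dimension_one: "transcendence_degree_one \<iota>"
    and nonsingular: "\<forall>P\<in>C. \<exists>s. local_parameter N \<iota> x P s"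

section \<open>Morphisms to projective space and their linear series\<close>

text \<open>
  The order at \<open>P\<close> of a non-zero rational function. For \<open>y = 0\<close> the order is infinite, and the
  description below has no meaning.
\<close>

definition ord_at ::
  "nat \<Rightarrow> ('k::field \<Rightarrow> 'b::field) \<Rightarrow> (nat \<Rightarrow> 'b) \<Rightarrow> 'k point \<Rightarrow> 'b \<Rightarrow> int" where
  "ord_at N \<iota> x P y = (THE k. \<exists>s w. local_parameter N \<iota> x P s \<and>
      w \<in> local_ring N \<iota> x P - max_ideal N \<iota> x P \<and> y = s powi k * w)"

text \<open>
  The value of the morphism \<open>(f 0 : \<dots> : f n)\<close> at \<open>P\<close>: multiply the \<open>f i\<close> by a common factor \<open>h\<close>
  that makes them all regular and not all zero at \<open>P\<close>, and evaluate (\<open>v i\<close> is the value of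
  \<open>h * f i\<close> iff \<open>h * f i - \<iota> (v i)\<close> lies in the maximal ideal).
\<close>

definition morphism_value ::
  "nat \<Rightarrow> ('k::field \<Rightarrow> 'b::field) \<Rightarrow> (nat \<Rightarrow> 'b) \<Rightarrow> nat \<Rightarrow> (nat \<Rightarrow> 'b) \<Rightarrow> 'k point \<Rightarrow> 'k point" where
  "morphism_value N \<iota> x n f P =
     {v \<in> coord_vectors n. \<exists>h. \<forall>i\<le>n. h * f i - \<iota> (v i) \<in> max_ideal N \<iota> x P}"

definition hyperplane :: "nat \<Rightarrow> (nat \<Rightarrow> 'k::field) \<Rightarrow> 'k point set" where
  "hyperplane n a = {Q \<in> proj_space n. \<forall>v\<in>Q. (\<Sum>i\<le>n. a i * v i) = 0}"

definition nondegenerate ::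
  "nat \<Rightarrow> 'k::field point set \<Rightarrow> ('k \<Rightarrow> 'b::field) \<Rightarrow> (nat \<Rightarrow> 'b) \<Rightarrow> nat \<Rightarrow> (nat \<Rightarrow> 'b) \<Rightarrow> bool" where
  "nondegenerate N C \<iota> x n f \<longleftrightarrow> (\<exists>i\<le>n. f i \<noteq> 0) \<and>
     \<not> (\<exists>a\<in>coord_vectors n. morphism_value N \<iota> x n f ` C \<subseteq> hyperplane n a)"

text \<open>
  The divisor \<open>E = \<Sum>\<^sub>P e\<^sub>P P\<close> and its degree. The linear series of the morphism consists of the
  divisors \<open>div (\<Sum>\<^sub>i a\<^sub>i f\<^sub>i) + E\<close>, and its degree is by definition the degree of \<open>E\<close>.
\<close>

definition base_divisor ::
  "nat \<Rightarrow> ('k::field \<Rightarrow> 'b::field) \<Rightarrow> (nat \<Rightarrow> 'b) \<Rightarrow> nat \<Rightarrow> (nat \<Rightarrow> 'b) \<Rightarrow> 'k point \<Rightarrow> int" where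
  "base_divisor N \<iota> x n f P = - Min {ord_at N \<iota> x P (f i) | i. i \<le> n \<and> f i \<noteq> 0}"

definition divisor_degree :: "'k point set \<Rightarrow> ('k point \<Rightarrow> int) \<Rightarrow> int" where
  "divisor_degree C E = (\<Sum>P\<in>{P\<in>C. E P \<noteq> 0}. E P)"

definition linear_series_degree ::
  "nat \<Rightarrow> 'k::field point set \<Rightarrow> ('k \<Rightarrow> 'b::field) \<Rightarrow> (nat \<Rightarrow> 'b) \<Rightarrow> nat \<Rightarrow> (nat \<Rightarrow> 'b) \<Rightarrow> int" where
  "linear_series_degree N C \<iota> x n f = divisor_degree C (base_divisor N \<iota> x n f)"

section \<open>Hasse derivatives and Frobenius orders\<close>

text \<open>
  \<open>t\<close> is a separating variable of the function field \<open>L\<close>, a subfield of \<^typ>\<open>'b\<close>, over \<^typ>\<open>'c\<close>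
  (embedded by \<open>h\<close>): every element of \<open>L\<close> is a root of a separable polynomial with coefficients
  in the field generated by \<open>t\<close>.
\<close>

definition separating_variable :: "('c::field \<Rightarrow> 'b::field) \<Rightarrow> 'b set \<Rightarrow> 'b \<Rightarrow> bool" where
  "separating_variable h L t \<longleftrightarrow> t \<in> L \<and> transcendental_over h t \<and>
     (\<forall>y\<in>L. \<exists>A :: 'b poly.
        (\<forall>i. \<exists>a b. b \<noteq> 0 \<and> poly.coeff A i = poly (map_poly h a) t / poly (map_poly h b) t) \<and>
        coprime A (pderiv A) \<and> poly A y = 0)"

text \<open>
  \<open>D r\<close> is the \<open>r\<close>-th Hasse derivative with respect to \<open>t\<close>. On polynomials in \<open>t\<close> it is given by the
  binomial coefficients; for a separating variable \<open>t\<close> these maps extend in exactly one way to a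
  family on the function field that satisfies the Leibniz rule.
\<close>

definition hasse_derivatives ::
  "('k::field \<Rightarrow> 'b::field) \<Rightarrow> 'b \<Rightarrow> (nat \<Rightarrow> 'b \<Rightarrow> 'b) \<Rightarrow> bool" where
  "hasse_derivatives \<iota> t D \<longleftrightarrow>
     D 0 = id \<and>
     (\<forall>r y z. D r (y + z) = D r y + D r z) \<and>
     (\<forall>r c y. D r (\<iota> c * y) = \<iota> c * D r y) \<and>
     (\<forall>r y z. D r (y * z) = (\<Sum>i\<le>r. D i y * D (r - i) z)) \<and>
     (\<forall>r k. D r (t ^ k) = of_nat (k choose r) * t ^ (k - r))"

definition frobenius_det ::
  "nat \<Rightarrow> nat \<Rightarrow> nat \<Rightarrow> nat \<Rightarrow> (nat \<Rightarrow> 'b::field \<Rightarrow> 'b) \<Rightarrow> (nat \<Rightarrow> 'b) \<Rightarrow> nat list \<Rightarrow> 'b" where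
  "frobenius_det q u m n D f \<rho> = det (mat (n + 1) (n + 1) (\<lambda>(i, j).
     if i = 0 then f j ^ (q ^ m)
     else if i = 1 then f j ^ (q ^ u)
     else D (\<rho> ! (i - 2)) (f j)))"

definition frobenius_order_sequence ::
  "nat \<Rightarrow> nat \<Rightarrow> nat \<Rightarrow> nat \<Rightarrow> (nat \<Rightarrow> 'b::field \<Rightarrow> 'b) \<Rightarrow> (nat \<Rightarrow> 'b) \<Rightarrow> nat list \<Rightarrow> bool" where
  "frobenius_order_sequence q u m n D f \<kappa> \<longleftrightarrow>
     (let admissible = (\<lambda>\<rho>. length \<rho> = n - 1 \<and> sorted_wrt (<) \<rho> \<and> frobenius_det q u m n D f \<rho> \<noteq> 0)
      in admissible \<kappa> \<and> (\<forall>\<rho>. admissible \<rho> \<longrightarrow> \<rho> = \<kappa> \<or> (\<kappa>, \<rho>) \<in> lex less_than))"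

definition frobenius_classical ::
  "nat \<Rightarrow> nat \<Rightarrow> nat \<Rightarrow> nat \<Rightarrow> (nat \<Rightarrow> 'b::field \<Rightarrow> 'b) \<Rightarrow> (nat \<Rightarrow> 'b) \<Rightarrow> bool" where
  "frobenius_classical q u m n D f \<longleftrightarrow>
     (\<exists>\<kappa>. frobenius_order_sequence q u m n D f \<kappa> \<and> (\<forall>i<n - 1. \<kappa> ! i = i))"

end

theory Submission
  imports Defs "HOL-Number_Theory.Residues"
begin

text \<open>
  Write \<open>p\<close> for the characteristic, \<open>L\<close> for the function field over the algebraically closed field \<open>k\<close>
  of constants, and \<open>\<partial>\<close> for the first Hasse derivative. The proof has three layers.

  \<^bold>\<open>Linear algebra.\<close> Hasse derivatives compose by \<open>\<partial> D\<^sub>j = (j + 1) D\<^sub>j\<^sub>+\<^sub>1\<close>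
  (\<open>hasse_composition\<close>), and \<open>\<partial>\<close> kills the two rows of \<open>q\<close>-powers. If the determinant with orders
  \<open>0, \<dots>, n - 2\<close> vanished, some row \<open>D\<^sub>j f\<close> with \<open>1 \<le> j \<le> n - 2\<close> would lie in the span \<open>V\<close> of
  the rows before it; the assumption that the first order is \<open>0\<close> excludes \<open>j = 0\<close>. Then \<open>V\<close> is stable
  under \<open>\<partial>\<close>, so it contains \<open>D\<^sub>r f\<close> for all \<open>r < p\<close>, since \<open>r + 1\<close> is invertible for \<open>r + 1 < p\<close>. As \<open>V\<close>
  is a proper subspace of \<open>L\<^sup>n\<^sup>+\<^sup>1\<close>, a non-zero vector \<open>z\<close> is orthogonal to all these rows.

  \<^bold>\<open>Local analysis.\<close> The vectors orthogonal to \<open>D\<^sub>r f\<close> for all \<open>r < p\<close> are stable under \<open>\<partial>\<close>, because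
  \<open>\<partial> D\<^sub>p\<^sub>-\<^sub>1 = p D\<^sub>p = 0\<close>. One with the fewest non-zero entries, normalized to have an entry \<open>1\<close>, has all
  entries in the kernel of \<open>\<partial>\<close>. An element of the kernel that is regular at \<open>P\<close> is a constant plus a
  function that vanishes at \<open>P\<close> to order at least \<open>p\<close> (\<open>derivation_kernel_expansion\<close>). Replacing the entries by
  these constants yields a combination \<open>g\<close> of the \<open>f\<^sub>i\<close> over \<open>k\<close>, non-zero by nondegeneracy, with
  \<open>ord\<^sub>P g + e\<^sub>P \<ge> p\<close>, while \<open>ord\<^sub>Q g + e\<^sub>Q \<ge> 0\<close> at every other point. Since the divisor of \<open>g\<close> has degree
  at most \<open>0\<close>, the degree of \<open>E\<close> is at least \<open>p\<close>, contrary to the hypothesis.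

  \<^bold>\<open>Principal divisors.\<close> That the divisor of a function \<open>F / G\<close>, with forms \<open>F\<close>, \<open>G\<close> of degree \<open>d\<close>, has
  degree at most \<open>0\<close> is shown by comparing dimensions of spaces of forms of degree \<open>l + J d\<close> as \<open>J\<close>
  grows (\<open>sum_form_zeros_le\<close>). Interpolation at the zeros of \<open>F\<close> produces about \<open>J \<cdot> deg (F)\<close> independent forms.
  Division by \<open>G\<^sup>J\<close> embeds them into a space of functions with bounded poles, whose dimension is at most
  \<open>J \<cdot> deg (G)\<close> up to an additive constant. The second bound rests on the fact that a function without poles is constant; its
  proof uses a valuation ring of \<open>L\<close> and its centre on the projective curve.

  Throughout, transcendence degree one enters through one lemma, \<open>ex_poly_value_dvd\<close>: for \<open>y \<noteq> 0\<close> and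
  any \<open>z\<close>, some non-zero polynomial in \<open>z\<close> over \<open>k\<close> is divisible by \<open>y\<close> in \<open>k[y, z]\<close>.
\<close>

section \<open>Fields of transcendence degree one\<close>

lemma (in vector_space) exists_linear_relation:
  assumes "finite I" "finite T" "v ` I \<subseteq> span T" "card T < card I"
  shows "\<exists>c. (\<exists>i\<in>I. c i \<noteq> 0) \<and> (\<Sum>i\<in>I. scale (c i) (v i)) = 0"
proof (cases "inj_on v I")
  case False
  then obtain i j where ij: "i \<in> I" "j \<in> I" "i \<noteq> j" "v i = v j"
    unfolding inj_on_def by blast
  let ?c = "\<lambda>l. if l = i then 1 else if l = j then -1 else 0"
  have "(\<Sum>l\<in>I. scale (?c l) (v l)) = (\<Sum>l\<in>{i, j}. scale (?c l) (v l))"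
    using ij assms(1) by (intro sum.mono_neutral_right) auto
  also have "\<dots> = 0" using ij by simp
  finally show ?thesis using ij by (intro exI[of _ ?c]) auto
next
  case True
  have "dependent (v ` I)"
    using independent_span_bound[OF assms(2) _ assms(3)] card_image[OF True] assms(4) by auto
  then obtain u w where u: "w \<in> v ` I" "u w \<noteq> 0" "(\<Sum>w\<in>v ` I. scale (u w) w) = 0"
    using dependent_finite[of "v ` I"] assms(1) by auto
  have "(\<Sum>i\<in>I. scale (u (v i)) (v i)) = 0"
    using u(3) by (simp add: sum.reindex[OF True])
  with u show ?thesis by (intro exI[of _ "\<lambda>i. u (v i)"]) auto
qed

lemma poly_map_poly_altdef:
  fixes h :: "'c::zero \<Rightarrow> 'd::comm_semiring_1"
  assumes "h 0 = 0"
  shows "poly (map_poly h A) y = (\<Sum>i\<le>degree A. h (coeff A i) * y ^ i)"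
proof -
  have "poly (map_poly h A) y = (\<Sum>i\<le>degree (map_poly h A). h (coeff A i) * y ^ i)"
    using assms by (simp add: poly_altdef coeff_map_poly)
  also have "\<dots> = (\<Sum>i\<le>degree A. h (coeff A i) * y ^ i)"
    using map_poly_degree_leq[of h A] assms
    by (intro sum.mono_neutral_left) (auto simp: coeff_map_poly[symmetric] coeff_eq_0)
  finally show ?thesis .
qed

locale constant_field = field_hom \<iota> for \<iota> :: "'k::field \<Rightarrow> 'b::field"
begin

sublocale kvs: vector_space "\<lambda>c y. \<iota> c * y"
  by unfold_locales (simp_all add: algebra_simps hom_distribs)

lemma poly_map_poly_pCons: "poly (map_poly \<iota> (pCons a p)) y = \<iota> a + y * poly (map_poly \<iota> p) y"
  by (simp add: map_poly_pCons)

lemma poly_map_poly_add: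
  "poly (map_poly \<iota> (p + q)) y = poly (map_poly \<iota> p) y + poly (map_poly \<iota> q) y"
proof -
  have "map_poly \<iota> (p + q) = map_poly \<iota> p + map_poly \<iota> q"
    by (rule poly_eqI) (simp add: coeff_map_poly hom_distribs)
  then show ?thesis by simp
qed

lemma poly_map_poly_smult: "poly (map_poly \<iota> (smult c p)) y = \<iota> c * poly (map_poly \<iota> p) y"
proof -
  have "map_poly \<iota> (smult c p) = smult (\<iota> c) (map_poly \<iota> p)"
    by (rule poly_eqI) (simp add: coeff_map_poly hom_distribs)
  then show ?thesis by simp
qed

lemma poly_map_poly_mult:
  "poly (map_poly \<iota> (p * q)) y = poly (map_poly \<iota> p) y * poly (map_poly \<iota> q) y"
  by (induction p) (simp_all add: poly_map_poly_pCons poly_map_poly_add poly_map_poly_smult algebra_simps)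

definition subalgebra :: "'b set \<Rightarrow> bool" where
  "subalgebra R \<longleftrightarrow> range \<iota> \<subseteq> R \<and> (\<forall>y\<in>R. \<forall>z\<in>R. y + z \<in> R \<and> y * z \<in> R)"

lemma subalgebraD:
  assumes "subalgebra R"
  shows "\<iota> c \<in> R" "y \<in> R \<Longrightarrow> z \<in> R \<Longrightarrow> y + z \<in> R" "y \<in> R \<Longrightarrow> z \<in> R \<Longrightarrow> y * z \<in> R"
    "0 \<in> R" "1 \<in> R" "y \<in> R \<Longrightarrow> - y \<in> R" "y \<in> R \<Longrightarrow> z \<in> R \<Longrightarrow> y - z \<in> R"
proof -
  show *: "\<iota> c \<in> R" "y \<in> R \<Longrightarrow> z \<in> R \<Longrightarrow> y + z \<in> R" "y \<in> R \<Longrightarrow> z \<in> R \<Longrightarrow> y * z \<in> R" for c y z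
    using assms by (auto simp: subalgebra_def)
  show "0 \<in> R" "1 \<in> R" using *(1)[of 0] *(1)[of 1] by auto
  show m: "- y \<in> R" if "y \<in> R" for y using *(3)[OF *(1)[of "-1"] that] by (simp add: hom_distribs)
  show "y - z \<in> R" if "y \<in> R" "z \<in> R" using *(2)[OF that(1) m[OF that(2)]] by simp
qed

lemma subalgebra_power: "subalgebra R \<Longrightarrow> y \<in> R \<Longrightarrow> y ^ n \<in> R"
  by (induction n) (auto intro: subalgebraD)

lemma subalgebra_sum: "subalgebra R \<Longrightarrow> (\<And>i. i \<in> I \<Longrightarrow> g i \<in> R) \<Longrightarrow> sum g I \<in> R"
  by (induction I rule: infinite_finite_induct) (auto intro: subalgebraD)

lemma subalgebra_prod: "subalgebra R \<Longrightarrow> (\<And>i. i \<in> I \<Longrightarrow> g i \<in> R) \<Longrightarrow> prod g I \<in> R"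
  by (induction I rule: infinite_finite_induct) (auto intro: subalgebraD)

lemma subalgebra_poly: "subalgebra R \<Longrightarrow> y \<in> R \<Longrightarrow> poly (map_poly \<iota> p) y \<in> R"
  by (auto simp: poly_map_poly_altdef intro!: subalgebra_sum subalgebraD subalgebra_power)

lemma subspace_mult_preimage: "kvs.subspace V \<Longrightarrow> kvs.subspace {g. h * g \<in> V}"
  unfolding kvs.subspace_def by (simp add: distrib_left mult.left_commute[of h])

text \<open>
  If \<open>y\<close> and \<open>z\<close> are algebraic over \<open>k(t)\<close> of degrees at most \<open>d\<close> and \<open>e\<close>, these elements span, over \<open>k\<close>,
  the part of degree at most \<open>r\<close> in \<open>t\<close> of a \<open>k[t]\<close>-module that contains \<open>k[y, z]\<close> up to denominators in \<open>k[t]\<close>.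
\<close>

definition mono_gens :: "'b \<Rightarrow> 'b \<Rightarrow> nat \<Rightarrow> 'b \<Rightarrow> nat \<Rightarrow> nat \<Rightarrow> 'b set" where
  "mono_gens t y d z e r = (\<lambda>(a, i, j). t ^ a * (y ^ i * z ^ j)) ` ({..r} \<times> {..<d} \<times> {..<e})"

lemma mono_gens_swap: "mono_gens t y d z e r = mono_gens t z e y d r"
proof -
  have "mono_gens t y d z e r \<subseteq> mono_gens t z e y d r" for y d z e
    by (force simp: mono_gens_def mult.commute)
  then show ?thesis by blast
qed

lemma card_mono_gens: "finite (mono_gens t y d z e r)" "card (mono_gens t y d z e r) \<le> (r + 1) * (d * e)"
  unfolding mono_gens_def
  by (auto intro!: order.trans[OF card_image_le] simp: card_cartesian_product)

lemma span_mono_gens_mult_poly: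
  assumes "degree p \<le> c" "g \<in> kvs.span (mono_gens t y d z e r)"
  shows "poly (map_poly \<iota> p) t * g \<in> kvs.span (mono_gens t y d z e (r + c))"
  using assms(2)
proof (induction g rule: kvs.span_induct)
  case base
  show ?case by (intro subspace_mult_preimage kvs.subspace_span)
next
  case (step g)
  then obtain a i j where g: "g = t ^ a * (y ^ i * z ^ j)" "a \<le> r" "i < d" "j < e"
    by (auto simp: mono_gens_def)
  have "poly (map_poly \<iota> p) t * g = (\<Sum>b\<le>degree p. \<iota> (coeff p b) * (t ^ (a + b) * (y ^ i * z ^ j)))"
    by (simp add: poly_map_poly_altdef g sum_distrib_right sum_distrib_left power_add mult_ac)
  also have "\<dots> \<in> kvs.span (mono_gens t y d z e (r + c))"
    using g assms(1)
  proof (intro kvs.span_sum kvs.span_scale kvs.span_base)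
    fix b assume "b \<in> {..degree p}"
    then have "(a + b, i, j) \<in> {..r + c} \<times> {..<d} \<times> {..<e}" using g assms(1) by auto
    then show "t ^ (a + b) * (y ^ i * z ^ j) \<in> mono_gens t y d z e (r + c)"
      unfolding mono_gens_def by (rule rev_image_eqI) simp
  qed
  finally show ?case .
qed

text \<open>
  Multiplication by \<open>y\<close> leaves the module only through the power \<open>y\<^sup>d\<close>, which the algebraic relation
  rewrites once its leading coefficient is multiplied in; this raises the degree in \<open>t\<close> by a bounded amount.
\<close>

lemma span_mono_gens_mult_algebraic:
  assumes rel: "poly (map_poly \<iota> (A d)) t * y ^ d = (\<Sum>i<d. poly (map_poly \<iota> (A i)) t * y ^ i)"
    and c: "\<And>i. i \<le> d \<Longrightarrow> degree (A i) \<le> c"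
    and g: "g \<in> kvs.span (mono_gens t y d z e r)"
  shows "poly (map_poly \<iota> (A d)) t * y * g \<in> kvs.span (mono_gens t y d z e (r + c))"
  using g
proof (induction g rule: kvs.span_induct)
  case base
  show ?case by (intro subspace_mult_preimage kvs.subspace_span)
next
  case (step g)
  then obtain a i j where g: "g = t ^ a * (y ^ i * z ^ j)" "a \<le> r" "i < d" "j < e"
    by (auto simp: mono_gens_def)
  have gen: "t ^ a * (y ^ i' * z ^ j) \<in> kvs.span (mono_gens t y d z e r)" if "i' < d" for i'
    using g that by (intro kvs.span_base) (force simp: mono_gens_def)
  show ?case
  proof (cases "Suc i < d")
    case True
    have "poly (map_poly \<iota> (A d)) t * y * g = poly (map_poly \<iota> (A d)) t * (t ^ a * (y ^ Suc i * z ^ j))"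
      by (simp add: g)
    also have "\<dots> \<in> kvs.span (mono_gens t y d z e (r + c))"
      by (intro span_mono_gens_mult_poly c gen True) simp
    finally show ?thesis .
  next
    case False
    then have d: "d = Suc i" using g by simp
    have "poly (map_poly \<iota> (A d)) t * y * g = poly (map_poly \<iota> (A d)) t * y ^ d * (t ^ a * z ^ j)"
      by (simp add: g d)
    also have "\<dots> = (\<Sum>i<d. poly (map_poly \<iota> (A i)) t * (t ^ a * (y ^ i * z ^ j)))"
      unfolding rel by (simp add: sum_distrib_right sum_distrib_left mult_ac)
    also have "\<dots> \<in> kvs.span (mono_gens t y d z e (r + c))"
      by (intro kvs.span_sum span_mono_gens_mult_poly c gen) auto
    finally show ?thesis .
  qed
qed

text \<open>
  Each further factor \<open>h\<close> costs \<open>c\<close> steps of the filtration, so that monomials of degree \<open>l\<close> land in a piece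
  whose dimension is linear in \<open>l\<close>.
\<close>

lemma filtered_power:
  fixes h g :: 'b
  assumes "\<And>r g. g \<in> M r \<Longrightarrow> h * g \<in> M (r + c)" "g \<in> M r"
  shows "h ^ n * g \<in> M (r + n * c :: nat)"
proof (induction n)
  case (Suc n)
  have "h * (h ^ n * g) \<in> M (r + n * c + c)" by (rule assms(1)[OF Suc])
  also have "r + n * c + c = r + Suc n * c" by simp
  finally show ?case by (simp only: power_Suc mult.assoc)
qed (use assms in simp)

end

locale one_dimensional = constant_field \<iota> for \<iota> :: "'k::field \<Rightarrow> 'b::field" +
  assumes dimension_one: "transcendence_degree_one \<iota>"
begin

lemma algebraic_relation:
  assumes t: "transcendental_over \<iota> t"
    and A: "A \<noteq> 0" "poly (map_poly (\<lambda>a. poly (map_poly \<iota> a) t) A) y = 0"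
  shows "\<exists>d B. d > 0 \<and> poly (map_poly \<iota> (B d)) t \<noteq> 0 \<and>
    poly (map_poly \<iota> (B d)) t * y ^ d = (\<Sum>i<d. poly (map_poly \<iota> (B i)) t * y ^ i)"
proof -
  let ?e = "\<lambda>p. poly (map_poly \<iota> p) t"
  let ?d = "degree A"
  define B where "B i = (if i = ?d then coeff A i else - coeff A i)" for i
  have ne: "?e (B ?d) \<noteq> 0" using t A(1) by (auto simp: transcendental_over_def B_def)
  have m: "?e (- p) = - ?e p" for p by (simp add: poly_map_poly_altdef sum_negf hom_distribs)
  have "0 = (\<Sum>i\<le>?d. ?e (coeff A i) * y ^ i)"
    using A(2) by (simp add: poly_map_poly_altdef[where h = ?e])
  also have "\<dots> = (\<Sum>i<?d. ?e (coeff A i) * y ^ i) + ?e (B ?d) * y ^ ?d"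
    by (simp add: B_def lessThan_Suc_atMost[symmetric])
  finally have rel: "?e (B ?d) * y ^ ?d = (\<Sum>i<?d. ?e (B i) * y ^ i)"
    by (simp add: B_def m sum_negf eq_neg_iff_add_eq_0 add.commute)
  moreover have "?d > 0" using ne rel by (cases "?d = 0") auto
  ultimately show ?thesis using ne by (intro exI[of _ ?d] exI[of _ B] conjI)
qed

text \<open>
  The \<open>(l + 1)\<^sup>2\<close> monomials \<open>y\<^sup>i z\<^sup>j\<close> with \<open>i, j \<le> l\<close> lie, up to a common denominator, in a space whose
  dimension grows linearly in \<open>l\<close>, so they satisfy a linear relation over \<open>k\<close>. After division by the lowest power
  of \<open>y\<close> that occurs, the part free of \<open>y\<close> is a non-zero polynomial in \<open>z\<close>, and the rest is divisible by \<open>y\<close>.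
  Stating the cofactor to lie in every subalgebra that contains \<open>y\<close> and \<open>z\<close> makes the lemma usable in local rings
  and in valuation rings alike.
\<close>

lemma ex_poly_value_dvd:
  assumes y: "y \<noteq> 0"
  shows "\<exists>B. B \<noteq> 0 \<and> (\<forall>R. subalgebra R \<longrightarrow> y \<in> R \<longrightarrow> z \<in> R \<longrightarrow>
    (\<exists>w\<in>R. poly (map_poly \<iota> B) z = y * w))"
proof -
  obtain t where t: "transcendental_over \<iota> t"
    and alg: "\<And>y. \<exists>A. A \<noteq> 0 \<and> poly (map_poly (\<lambda>a. poly (map_poly \<iota> a) t) A) y = 0"
    using dimension_one unfolding transcendence_degree_one_def by blast
  let ?e = "\<lambda>p. poly (map_poly \<iota> p) t"
  have relation: "\<exists>d B. d > 0 \<and> ?e (B d) \<noteq> 0 \<and> ?e (B d) * y ^ d = (\<Sum>i<d. ?e (B i) * y ^ i)" for y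
    using alg[of y] by (elim exE conjE) (rule algebraic_relation[OF t])
  obtain d A where A: "d > 0" "?e (A d) \<noteq> 0" "?e (A d) * y ^ d = (\<Sum>i<d. ?e (A i) * y ^ i)"
    using relation[of y] by (elim exE conjE) (rule that)
  obtain e A' where A': "e > 0" "?e (A' e) \<noteq> 0" "?e (A' e) * z ^ e = (\<Sum>i<e. ?e (A' i) * z ^ i)"
    using relation[of z] by (elim exE conjE) (rule that)
  define c where "c = Max ((\<lambda>i. degree (A i)) ` {..d} \<union> (\<lambda>i. degree (A' i)) ` {..e})"
  have c: "i \<le> d \<Longrightarrow> degree (A i) \<le> c" "j \<le> e \<Longrightarrow> degree (A' j) \<le> c" for i j
    unfolding c_def by (auto intro!: Max_ge)
  define \<alpha> \<beta> where "\<alpha> = ?e (A d)" and "\<beta> = ?e (A' e)"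
  define M where "M r = kvs.span (mono_gens t y d z e r)" for r
  have M1: "\<alpha> * g \<in> M (r + c)" "\<beta> * g \<in> M (r + c)" if "g \<in> M r" for g r
    using that unfolding M_def \<alpha>_def \<beta>_def by (auto intro: span_mono_gens_mult_poly c)
  have M2: "\<alpha> * y * g \<in> M (r + c)" if "g \<in> M r" for g r
    using span_mono_gens_mult_algebraic[where A = A and c = c, OF A(3)] c that
    by (auto simp: M_def \<alpha>_def)
  have M3: "\<beta> * z * g \<in> M (r + c)" if "g \<in> M r" for g r
    using span_mono_gens_mult_algebraic[where A = A' and c = c, OF A'(3)] c that
    by (auto simp: M_def \<beta>_def mono_gens_swap[of t y d z e])
  \<comment> \<open>With this \<open>l\<close>, the bound \<open>(2 l c + 1) d e\<close> on the dimension is at most \<open>l\<^sup>2 + l\<close>, less than \<open>(l + 1)\<^sup>2\<close>.\<close>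
  define l where "l = (2 * c + 1) * (d * e)"
  define v where "v = (\<lambda>(i, j). \<alpha> ^ l * \<beta> ^ l * (y ^ i * z ^ j))"
  have one: "1 \<in> M 0"
    unfolding M_def using A(1) A'(1) by (intro kvs.span_base) (force simp: mono_gens_def)
  have v: "v ` ({..l} \<times> {..l}) \<subseteq> M (2 * l * c)"
  proof (rule image_subsetI)
    fix ij assume "ij \<in> {..l} \<times> {..l}"
    then obtain i j where ij: "ij = (i, j)" "i \<le> l" "j \<le> l" by auto
    have "(\<alpha> * y) ^ i * (\<alpha> ^ (l - i) * ((\<beta> * z) ^ j * (\<beta> ^ (l - j) * 1))) \<in>
        M (((0 + (l - j) * c) + j * c) + (l - i) * c + i * c)"
      by (intro filtered_power[where M = M] M1 M2 M3 one)
    also have "((0 + (l - j) * c) + j * c) + (l - i) * c + i * c = 2 * l * c"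
      using ij by (simp add: add_mult_distrib[symmetric])
    also have "(\<alpha> * y) ^ i * (\<alpha> ^ (l - i) * ((\<beta> * z) ^ j * (\<beta> ^ (l - j) * 1))) =
        \<alpha> ^ (i + (l - i)) * \<beta> ^ (j + (l - j)) * (y ^ i * z ^ j)"
      unfolding power_add by (simp add: algebra_simps)
    also have "\<dots> = v (i, j)" using ij by (simp add: v_def)
    finally show "v ij \<in> M (2 * l * c)" by (simp add: ij)
  qed
  have "card (mono_gens t y d z e (2 * l * c)) \<le> (2 * l * c + 1) * (d * e)"
    by (rule card_mono_gens)
  also have "\<dots> \<le> l * l + l"
    unfolding l_def by (simp add: algebra_simps)
  also have "\<dots> < card ({..l} \<times> {..l})" by (simp add: card_cartesian_product)
  finally have "card (mono_gens t y d z e (2 * l * c)) < card ({..l} \<times> {..l})" .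
  then obtain b where b: "\<exists>ij\<in>{..l} \<times> {..l}. b ij \<noteq> 0"
    "(\<Sum>ij\<in>{..l} \<times> {..l}. \<iota> (b ij) * v ij) = 0"
    using kvs.exists_linear_relation[OF _ card_mono_gens(1), of "{..l} \<times> {..l}" v t y d z e "2 * l * c"] v
    unfolding M_def by blast
  have "(\<Sum>ij\<in>{..l} \<times> {..l}. \<iota> (b ij) * v ij) =
      \<alpha> ^ l * \<beta> ^ l * (\<Sum>i\<le>l. \<Sum>j\<le>l. \<iota> (b (i, j)) * (y ^ i * z ^ j))"
    by (simp add: v_def sum.cartesian_product sum_distrib_left algebra_simps case_prod_unfold)
  then have rel: "(\<Sum>i\<le>l. \<Sum>j\<le>l. \<iota> (b (i, j)) * (y ^ i * z ^ j)) = 0"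
    using b(2) A(2) A'(2) by (auto simp: \<alpha>_def \<beta>_def)
  define P where "P i \<longleftrightarrow> i \<le> l \<and> (\<exists>j\<le>l. b (i, j) \<noteq> 0)" for i
  define i0 where "i0 = (LEAST i. P i)"
  have "\<exists>i. P i" using b(1) by (force simp: P_def)
  then have i0: "P i0" unfolding i0_def by (rule LeastI_ex)
  have less: "b (i, j) = 0" if "i < i0" "j \<le> l" for i j
  proof -
    have "\<not> P i" using not_less_Least that(1) unfolding i0_def by blast
    then show ?thesis using that i0 by (auto simp: P_def)
  qed
  define B where "B = (\<Sum>j\<le>l. monom (b (i0, j)) j)"
  have coeffB: "coeff B j = (if j \<le> l then b (i0, j) else 0)" for j
    by (simp add: B_def coeff_sum)
  have B0: "B \<noteq> 0"
  proof
    assume "B = 0"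
    then have "b (i0, j) = 0" if "j \<le> l" for j using coeffB[of j] that by simp
    with i0 show False by (auto simp: P_def)
  qed
  have B: "poly (map_poly \<iota> B) z = (\<Sum>j\<le>l. \<iota> (b (i0, j)) * z ^ j)"
  proof -
    have "degree B \<le> l" by (intro degree_le) (simp add: coeffB)
    then have "(\<Sum>j\<le>degree B. \<iota> (coeff B j) * z ^ j) = (\<Sum>j\<le>l. \<iota> (coeff B j) * z ^ j)"
      by (intro sum.mono_neutral_left) (auto simp: coeff_eq_0)
    then show ?thesis by (simp add: poly_map_poly_altdef coeffB)
  qed
  define w where "w = - (\<Sum>i\<in>{i0<..l}. \<Sum>j\<le>l. \<iota> (b (i, j)) * (y ^ (i - Suc i0) * z ^ j))"
  have "0 = (\<Sum>i\<in>{i0..l}. \<Sum>j\<le>l. \<iota> (b (i, j)) * (y ^ i * z ^ j))"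
    unfolding rel[symmetric] by (intro sum.mono_neutral_right) (auto simp: less)
  also have "{i0..l} = insert i0 {i0<..l}" using i0 by (auto simp: P_def)
  also have "(\<Sum>i\<in>\<dots>. \<Sum>j\<le>l. \<iota> (b (i, j)) * (y ^ i * z ^ j)) =
      y ^ i0 * poly (map_poly \<iota> B) z + (\<Sum>i\<in>{i0<..l}. \<Sum>j\<le>l. \<iota> (b (i, j)) * (y ^ i * z ^ j))"
    by (simp add: B sum_distrib_left algebra_simps)
  also have "(\<Sum>i\<in>{i0<..l}. \<Sum>j\<le>l. \<iota> (b (i, j)) * (y ^ i * z ^ j)) = - (y ^ i0 * (y * w))"
  proof -
    have "y ^ i = y ^ i0 * (y * y ^ (i - Suc i0))" if "i0 < i" for i
      using that by (metis power_add power_Suc add_Suc_right add_Suc le_add_diff_inverse Suc_leI)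
    then show ?thesis
      unfolding w_def by (simp add: sum_distrib_left algebra_simps)
  qed
  finally have "y ^ i0 * poly (map_poly \<iota> B) z = y ^ i0 * (y * w)" by simp
  then have "poly (map_poly \<iota> B) z = y * w" using y by simp
  moreover have "w \<in> R" if "subalgebra R" "y \<in> R" "z \<in> R" for R
    unfolding w_def using that by (intro subalgebraD(6) subalgebra_sum subalgebraD(1,3) subalgebra_power) auto
  ultimately show ?thesis using B0 by blast
qed

end

section \<open>Forms and points of projective space\<close>

definition monomial_value :: "(nat \<Rightarrow> 'b::comm_ring_1) \<Rightarrow> (nat \<Rightarrow>\<^sub>0 nat) \<Rightarrow> 'b" where
  "monomial_value x m = (\<Prod>i\<in>Poly_Mapping.keys m. x i ^ Poly_Mapping.lookup m i)"

lemma monomial_value_superset: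
  assumes "finite S" "Poly_Mapping.keys m \<subseteq> S"
  shows "monomial_value x m = (\<Prod>i\<in>S. x i ^ Poly_Mapping.lookup m i)"
  unfolding monomial_value_def
  by (intro prod.mono_neutral_left assms) (auto simp: in_keys_iff)

lemma monomial_value_add: "monomial_value x (m + m') = monomial_value x m * monomial_value x m'"
proof -
  let ?S = "Poly_Mapping.keys m \<union> Poly_Mapping.keys m'"
  have "Poly_Mapping.keys (m + m') \<subseteq> ?S" by (rule keys_add)
  then show ?thesis
    by (simp add: monomial_value_superset[where S = ?S] lookup_add power_add prod.distrib)
qed

lemma eval_mpoly_altdef:
  "eval_mpoly h x F = (\<Sum>m\<in>Poly_Mapping.keys F. h (Poly_Mapping.lookup F m) * monomial_value x m)"
  by (simp add: eval_mpoly_def monomial_value_def)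

context field_hom
begin

lemma eval_mpoly_add: "eval_mpoly hom x (F + G) = eval_mpoly hom x F + eval_mpoly hom x G"
  unfolding eval_mpoly_altdef
  by (rule setsum_keys_plus_distrib) (simp_all add: hom_distribs distrib_right)

lemma eval_mpoly_zero [simp]: "eval_mpoly hom x 0 = 0"
  by (simp add: eval_mpoly_def)

lemma eval_mpoly_sum: "eval_mpoly hom x (sum F S) = (\<Sum>s\<in>S. eval_mpoly hom x (F s))"
  by (induction S rule: infinite_finite_induct) (simp_all add: eval_mpoly_add)

lemma eval_mpoly_single: "eval_mpoly hom x (Poly_Mapping.single m c) = hom c * monomial_value x m"
  by (simp add: eval_mpoly_altdef)

end

lemma poly_mapping_eq_sum_singles:
  "F = (\<Sum>m\<in>Poly_Mapping.keys F. Poly_Mapping.single m (Poly_Mapping.lookup F m))"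
proof (rule poly_mapping_eqI)
  fix m
  show "Poly_Mapping.lookup F m =
      Poly_Mapping.lookup (\<Sum>m\<in>Poly_Mapping.keys F. Poly_Mapping.single m (Poly_Mapping.lookup F m)) m"
    by (auto simp: lookup_sum lookup_single when_def in_keys_iff)
qed

context field_hom
begin

lemma eval_mpoly_mult: "eval_mpoly hom x (F * G) = eval_mpoly hom x F * eval_mpoly hom x G"
proof -
  let ?s = "\<lambda>F m. Poly_Mapping.single m (Poly_Mapping.lookup F m)"
  have "F * G = (\<Sum>m\<in>Poly_Mapping.keys F. ?s F m) * (\<Sum>m\<in>Poly_Mapping.keys G. ?s G m)"
    using poly_mapping_eq_sum_singles by metis
  then have "F * G = (\<Sum>m\<in>Poly_Mapping.keys F. \<Sum>m'\<in>Poly_Mapping.keys G. ?s F m * ?s G m')"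
    by (simp add: sum_product)
  then have "eval_mpoly hom x (F * G) =
      (\<Sum>m\<in>Poly_Mapping.keys F. \<Sum>m'\<in>Poly_Mapping.keys G.
        hom (Poly_Mapping.lookup F m) * monomial_value x m * (hom (Poly_Mapping.lookup G m') * monomial_value x m'))"
    by (simp add: mult_single eval_mpoly_sum eval_mpoly_single monomial_value_add hom_distribs mult_ac)
  then show ?thesis by (simp add: eval_mpoly_altdef sum_product)
qed

lemma eval_mpoly_homogeneous:
  assumes "form N d F"
  shows "eval_mpoly hom (\<lambda>i. c * x i) F = c ^ d * eval_mpoly hom x F"
proof -
  have "monomial_value (\<lambda>i. c * x i) m = c ^ d * monomial_value x m" if "m \<in> Poly_Mapping.keys F" for m
    using assms that
    by (auto simp: form_def monomial_value_def power_mult_distrib prod.distrib power_sum[symmetric])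
  then show ?thesis by (simp add: eval_mpoly_altdef sum_distrib_left mult_ac)
qed

end

lemma field_hom_id: "field_hom (id :: 'k::field \<Rightarrow> 'k)"
  by unfold_locales simp_all

lemma form_add: "form N d F \<Longrightarrow> form N d G \<Longrightarrow> form N d (F + G)"
  using keys_add[of F G] by (auto simp: form_def)

lemma form_mult: "form N d F \<Longrightarrow> form N e G \<Longrightarrow> form N (d + e) (F * G)"
proof -
  have deg: "(\<Sum>i\<in>Poly_Mapping.keys m. Poly_Mapping.lookup m i) = (\<Sum>i\<le>N. Poly_Mapping.lookup m i)"
    if "Poly_Mapping.keys m \<subseteq> {..N}" for m :: "nat \<Rightarrow>\<^sub>0 nat"
    using that by (intro sum.mono_neutral_left) (auto simp: in_keys_iff)
  assume F: "form N d F" and G: "form N e G"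
  show ?thesis
    unfolding form_def
  proof
    fix m assume "m \<in> Poly_Mapping.keys (F * G)"
    then obtain a b where m: "m = a + b" "a \<in> Poly_Mapping.keys F" "b \<in> Poly_Mapping.keys G"
      using keys_mult[of F G] by blast
    then have ab: "Poly_Mapping.keys a \<subseteq> {..N}" "Poly_Mapping.keys b \<subseteq> {..N}"
      "(\<Sum>i\<le>N. Poly_Mapping.lookup a i) = d" "(\<Sum>i\<le>N. Poly_Mapping.lookup b i) = e"
      using F G by (auto simp: form_def deg[symmetric])
    then have mN: "Poly_Mapping.keys m \<subseteq> {..N}" using keys_add[of a b] m by blast
    have "(\<Sum>i\<in>Poly_Mapping.keys m. Poly_Mapping.lookup m i) = d + e"
      unfolding deg[OF mN] using ab by (simp add: m lookup_add sum.distrib)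
    with mN show "Poly_Mapping.keys m \<subseteq> {..N} \<and> (\<Sum>i\<in>Poly_Mapping.keys m. Poly_Mapping.lookup m i) = d + e" ..
  qed
qed

lemma form_const: "form N 0 (Poly_Mapping.single 0 c)"
  by (auto simp: form_def)

lemma form_var: "i \<le> N \<Longrightarrow> form N 1 (Poly_Mapping.single (Poly_Mapping.single i 1) 1)"
  by (auto simp: form_def)

lemma monomial_value_0 [simp]: "monomial_value x 0 = 1"
  by (simp add: monomial_value_def)

lemma monomial_value_var [simp]: "monomial_value x (Poly_Mapping.single i (Suc 0)) = x i"
  by (simp add: monomial_value_def)

lemma proj_spaceE:
  assumes "P \<in> proj_space N"
  obtains v where "v \<in> coord_vectors N" "P = {w. \<exists>c. c \<noteq> 0 \<and> w = (\<lambda>i. c * v i)}"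
  using assms unfolding proj_space_def quotient_def Image_def by auto

lemma proj_spaceI:
  "v \<in> coord_vectors N \<Longrightarrow> {w. \<exists>c. c \<noteq> 0 \<and> w = (\<lambda>i. c * v i)} \<in> proj_space N"
  unfolding proj_space_def quotient_def Image_def by auto

definition coords :: "'k::field point \<Rightarrow> nat \<Rightarrow> 'k" where
  "coords P = (SOME v. v \<in> P)"

definition chart :: "'k::field point \<Rightarrow> nat" where
  "chart P = (SOME i. coords P i \<noteq> 0)"

lemma
  assumes "P \<in> proj_space N"
  shows coords_in: "coords P \<in> P"
    and coords_coord_vector: "coords P \<in> coord_vectors N"
    and point_eq_multiples: "P = {w. \<exists>c. c \<noteq> 0 \<and> w = (\<lambda>i. c * coords P i)}"
    and chart_nonzero: "coords P (chart P) \<noteq> 0"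
    and chart_le: "chart P \<le> N"
proof -
  from assms obtain v where v: "v \<in> coord_vectors N" "P = {w. \<exists>c. c \<noteq> 0 \<and> w = (\<lambda>i. c * v i)}"
    by (rule proj_spaceE)
  have "v \<in> P" unfolding v(2) by (auto intro!: exI[of _ 1])
  then show in_P: "coords P \<in> P" unfolding coords_def by (metis someI)
  then obtain c where c: "c \<noteq> 0" "coords P = (\<lambda>i. c * v i)" using v by auto
  then show cv: "coords P \<in> coord_vectors N" using v by (auto simp: coord_vectors_def)
  show "P = {w. \<exists>c. c \<noteq> 0 \<and> w = (\<lambda>i. c * coords P i)}"
  proof (intro subset_antisym subsetI CollectI)
    fix w assume "w \<in> P"
    then obtain a where "a \<noteq> 0" "w = (\<lambda>i. a * v i)" using v(2) by blast
    then show "\<exists>c. c \<noteq> 0 \<and> w = (\<lambda>i. c * coords P i)"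
      using c by (intro exI[of _ "a / c"]) simp
  next
    fix w assume "w \<in> {w. \<exists>c. c \<noteq> 0 \<and> w = (\<lambda>i. c * coords P i)}"
    then obtain a where "a \<noteq> 0" "w = (\<lambda>i. a * coords P i)" by blast
    then have "a * c \<noteq> 0" "w = (\<lambda>i. (a * c) * v i)" using c by (simp_all add: mult.assoc)
    then show "w \<in> P" unfolding v(2) by blast
  qed
  show ne: "coords P (chart P) \<noteq> 0"
  proof -
    have "\<exists>i. coords P i \<noteq> 0" using cv by (simp add: coord_vectors_def)
    from someI_ex[OF this] show ?thesis by (simp add: chart_def)
  qed
  show "chart P \<le> N" using ne cv by (auto simp: coord_vectors_def intro: leI)
qed

lemma point_eqI:
  fixes P Q :: "'c::field point"
  assumes "P \<in> proj_space N" "Q \<in> proj_space N" "c \<noteq> 0" "coords P = (\<lambda>i. c * coords Q i)"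
  shows "P = Q"
proof -
  have sub: "P \<subseteq> Q" if PQ: "P \<in> proj_space N" "Q \<in> proj_space N" "c \<noteq> 0" "coords P = (\<lambda>i. c * coords Q i)"
    for P Q :: "'c point" and c
  proof
    fix w assume "w \<in> P"
    then obtain e where "e \<noteq> 0" "w = (\<lambda>i. e * coords P i)" using point_eq_multiples[OF PQ(1)] by blast
    then have "e * c \<noteq> 0" "w = (\<lambda>i. (e * c) * coords Q i)" using PQ by (simp_all add: mult.assoc)
    then show "w \<in> Q" by (subst point_eq_multiples[OF PQ(2)]) blast
  qed
  have "coords Q = (\<lambda>i. (1 / c) * coords P i)" using assms by simp
  then show ?thesis using sub[OF assms] sub[OF assms(2,1), of "1 / c"] assms(3) by auto
qed

lemma vanishes_at_iff:
  assumes "P \<in> proj_space N" "form N d F"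
  shows "vanishes_at F P \<longleftrightarrow> eval_mpoly id (coords P) F = 0"
proof -
  have "eval_mpoly id w F = 0" if "eval_mpoly id (coords P) F = 0" "w \<in> P" for w
  proof -
    from that(2) obtain c where "w = (\<lambda>i. c * coords P i)"
      using point_eq_multiples[OF assms(1)] by auto
    then show ?thesis
      using field_hom.eval_mpoly_homogeneous[OF field_hom_id assms(2)] that(1) by simp
  qed
  then show ?thesis using coords_in[OF assms(1)] by (auto simp: vanishes_at_def)
qed

section \<open>Local rings\<close>

text \<open>
  What the geometry uses of the curve, over any algebraically closed field: the point set is closed and
  non-empty, has the given function field of transcendence degree one, and its points are nonsingular.
\<close>

locale smooth_curve = one_dimensional \<iota>
  for \<iota> :: "'k::alg_closed_field \<Rightarrow> 'b::field" +
  fixes N :: nat and C :: "'k point set" and x :: "nat \<Rightarrow> 'b"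
  assumes closed: "zariski_closed N C"
    and nonempty: "C \<noteq> {}"
    and function_field: "function_field N C \<iota> x"
    and smooth: "\<forall>P\<in>C. \<exists>s. local_parameter N \<iota> x P s"
begin

lemma in_proj_space: "P \<in> C \<Longrightarrow> P \<in> proj_space N"
  using closed by (auto simp: zariski_closed_def zero_set_def)

text \<open>
  A form is only ever used through two values, at the generic point and at the coordinate vector of \<open>P\<close>.
  Recording both together turns computations in the local ring into computations with pairs.
\<close>

definition form_values :: "'k point \<Rightarrow> nat \<Rightarrow> ('b \<times> 'k) set" where
  "form_values P d = {(eval_mpoly \<iota> x F, eval_mpoly id (coords P) F) | F. form N d F}"

lemma form_values_add:
  assumes "(a, \<alpha>) \<in> form_values P d" "(b, \<beta>) \<in> form_values P d"
  shows "(a + b, \<alpha> + \<beta>) \<in> form_values P d"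
proof -
  from assms obtain F G where "form N d F" "a = eval_mpoly \<iota> x F" "\<alpha> = eval_mpoly id (coords P) F"
    "form N d G" "b = eval_mpoly \<iota> x G" "\<beta> = eval_mpoly id (coords P) G"
    unfolding form_values_def by blast
  then show ?thesis unfolding form_values_def
    by (intro CollectI exI[of _ "F + G"])
      (simp add: form_add eval_mpoly_add field_hom.eval_mpoly_add[OF field_hom_id])
qed

lemma form_values_mult:
  assumes "(a, \<alpha>) \<in> form_values P d" "(b, \<beta>) \<in> form_values P e"
  shows "(a * b, \<alpha> * \<beta>) \<in> form_values P (d + e)"
proof -
  from assms obtain F G where "form N d F" "a = eval_mpoly \<iota> x F" "\<alpha> = eval_mpoly id (coords P) F"
    "form N e G" "b = eval_mpoly \<iota> x G" "\<beta> = eval_mpoly id (coords P) G"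
    unfolding form_values_def by blast
  then show ?thesis unfolding form_values_def
    by (intro CollectI exI[of _ "F * G"])
      (simp add: form_mult eval_mpoly_mult field_hom.eval_mpoly_mult[OF field_hom_id])
qed

lemma form_values_const: "(\<iota> c, c) \<in> form_values P 0"
  unfolding form_values_def using form_const[of N c]
  by (force simp: eval_mpoly_single field_hom.eval_mpoly_single[OF field_hom_id])

lemma form_values_var: "i \<le> N \<Longrightarrow> (x i, coords P i) \<in> form_values P 1"
  unfolding form_values_def using form_var[of i N]
  by (force simp: eval_mpoly_single field_hom.eval_mpoly_single[OF field_hom_id])

lemma form_values_scale: "(a, \<alpha>) \<in> form_values P d \<Longrightarrow> (\<iota> c * a, c * \<alpha>) \<in> form_values P d"
  using form_values_mult[OF form_values_const, of a \<alpha> P d c] by simp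

lemma form_values_diff:
  assumes "(a, \<alpha>) \<in> form_values P d" "(b, \<beta>) \<in> form_values P d"
  shows "(a - b, \<alpha> - \<beta>) \<in> form_values P d"
  using form_values_add[OF assms(1) form_values_scale[OF assms(2), of "-1"]] by (simp add: hom_distribs)

lemma form_values_power: "(a, \<alpha>) \<in> form_values P d \<Longrightarrow> (a ^ n, \<alpha> ^ n) \<in> form_values P (n * d)"
proof (induction n)
  case 0
  then show ?case using form_values_const[of 1 P] by simp
next
  case (Suc n)
  then show ?case using form_values_mult by simp
qed

text \<open>
  A form that is zero at the generic point vanishes on the whole curve.
\<close>

lemma form_values_nonzero:
  assumes "P \<in> C" "(a, \<alpha>) \<in> form_values P d" "\<alpha> \<noteq> 0"
  shows "a \<noteq> 0"
proof -
  from assms(2) obtain F where F: "form N d F" "a = eval_mpoly \<iota> x F" "\<alpha> = eval_mpoly id (coords P) F"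
    unfolding form_values_def by blast
  have "\<not> vanishes_at F P" using vanishes_at_iff[OF in_proj_space[OF assms(1)] F(1)] F(3) assms(3) by simp
  moreover have "eval_mpoly \<iota> x F = 0 \<longleftrightarrow> (\<forall>P\<in>C. vanishes_at F P)"
    using function_field F(1) by (simp add: function_field_def)
  ultimately show ?thesis using F(2) assms(1) by auto
qed

lemma form_values_unique:
  "P \<in> C \<Longrightarrow> (a, \<alpha>) \<in> form_values P d \<Longrightarrow> (a, \<beta>) \<in> form_values P d \<Longrightarrow> \<alpha> = \<beta>"
  using form_values_diff form_values_nonzero by (metis cancel_comm_monoid_add_class.diff_cancel right_minus_eq)

abbreviation regular :: "'k point \<Rightarrow> 'b set" where
  "regular P \<equiv> local_ring N \<iota> x P"

abbreviation vanishing :: "'k point \<Rightarrow> 'b set" where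
  "vanishing P \<equiv> max_ideal N \<iota> x P"

lemma regular_iff:
  assumes "P \<in> C"
  shows "y \<in> regular P \<longleftrightarrow>
    (\<exists>d a b \<alpha> \<beta>. (a, \<alpha>) \<in> form_values P d \<and> (b, \<beta>) \<in> form_values P d \<and> \<beta> \<noteq> 0 \<and> y = a / b)"
  using vanishes_at_iff[OF in_proj_space[OF assms]]
  by (auto simp: local_ring_def form_values_def) blast+

lemma vanishing_iff:
  assumes "P \<in> C"
  shows "y \<in> vanishing P \<longleftrightarrow>
    (\<exists>d a b \<beta>. (a, 0) \<in> form_values P d \<and> (b, \<beta>) \<in> form_values P d \<and> \<beta> \<noteq> 0 \<and> y = a / b)"
  using vanishes_at_iff[OF in_proj_space[OF assms]]
  by (auto simp: max_ideal_def form_values_def) (metis (no_types, lifting))+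

lemma vanishing_subset_regular: "P \<in> C \<Longrightarrow> vanishing P \<subseteq> regular P"
  using regular_iff vanishing_iff by blast

lemma regular_subalgebra:
  assumes P: "P \<in> C"
  shows "subalgebra (regular P)"
  unfolding subalgebra_def
proof (intro conjI ballI subsetI)
  fix y assume "y \<in> range \<iota>"
  then obtain c where "y = \<iota> c / \<iota> 1" by auto
  then show "y \<in> regular P"
    unfolding regular_iff[OF P] using form_values_const by (metis one_neq_zero)
next
  fix y z assume "y \<in> regular P" "z \<in> regular P"
  then obtain d a b \<alpha> \<beta> d' a' b' \<alpha>' \<beta>' where
    y: "(a, \<alpha>) \<in> form_values P d" "(b, \<beta>) \<in> form_values P d" "\<beta> \<noteq> 0" "y = a / b" and
    z: "(a', \<alpha>') \<in> form_values P d'" "(b', \<beta>') \<in> form_values P d'" "\<beta>' \<noteq> 0" "z = a' / b'"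
    unfolding regular_iff[OF P] by blast
  have ne: "b \<noteq> 0" "b' \<noteq> 0" using form_values_nonzero[OF P] y z by blast+
  have "y + z = (a * b' + b * a') / (b * b')" using y z ne by (simp add: field_simps)
  moreover have "(a * b' + b * a', \<alpha> * \<beta>' + \<beta> * \<alpha>') \<in> form_values P (d + d')"
    using y z by (intro form_values_add form_values_mult)
  moreover have "(b * b', \<beta> * \<beta>') \<in> form_values P (d + d')" using y z by (intro form_values_mult)
  ultimately show "y + z \<in> regular P"
    unfolding regular_iff[OF P] using y z by (metis mult_eq_0_iff)
  have "y * z = (a * a') / (b * b')" using y z by simp
  moreover have "(a * a', \<alpha> * \<alpha>') \<in> form_values P (d + d')" using y z by (intro form_values_mult)
  ultimately show "y * z \<in> regular P"
    unfolding regular_iff[OF P] using \<open>(b * b', \<beta> * \<beta>') \<in> _\<close> y z by (metis mult_eq_0_iff)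
qed

lemma vanishing_mult:
  assumes P: "P \<in> C" and "y \<in> regular P" "z \<in> vanishing P"
  shows "y * z \<in> vanishing P"
proof -
  from assms obtain d a b \<alpha> \<beta> d' a' b' \<beta>' where
    y: "(a, \<alpha>) \<in> form_values P d" "(b, \<beta>) \<in> form_values P d" "\<beta> \<noteq> 0" "y = a / b" and
    z: "(a', 0) \<in> form_values P d'" "(b', \<beta>') \<in> form_values P d'" "\<beta>' \<noteq> 0" "z = a' / b'"
    unfolding regular_iff[OF P] vanishing_iff[OF P] by blast
  have "y * z = (a * a') / (b * b')" using y z by simp
  moreover have "(a * a', 0) \<in> form_values P (d + d')" using form_values_mult[OF y(1) z(1)] by simp
  moreover have "(b * b', \<beta> * \<beta>') \<in> form_values P (d + d')" using y z by (intro form_values_mult)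
  ultimately show ?thesis unfolding vanishing_iff[OF P] using y z by (metis mult_eq_0_iff)
qed

lemma one_not_vanishing:
  assumes P: "P \<in> C" shows "1 \<notin> vanishing P"
proof
  assume "1 \<in> vanishing P"
  then obtain d a b \<beta> where
    y: "(a, 0) \<in> form_values P d" "(b, \<beta>) \<in> form_values P d" "\<beta> \<noteq> 0" "1 = a / b"
    unfolding vanishing_iff[OF P] by blast
  then have "a = b" by (metis divide_eq_1_iff)
  then show False using form_values_unique[OF P] y by blast
qed

lemma inverse_regular:
  assumes P: "P \<in> C" and y: "y \<in> regular P" "y \<notin> vanishing P"
  shows "y \<noteq> 0" "1 / y \<in> regular P"
proof -
  from y obtain d a b \<alpha> \<beta> where
    y': "(a, \<alpha>) \<in> form_values P d" "(b, \<beta>) \<in> form_values P d" "\<beta> \<noteq> 0" "y = a / b"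
    unfolding regular_iff[OF P] by blast
  have "\<alpha> \<noteq> 0" using y y' vanishing_iff[OF P] by blast
  then have "a \<noteq> 0" "b \<noteq> 0" using form_values_nonzero[OF P] y' by blast+
  then show "y \<noteq> 0" using y' by simp
  have "1 / y = b / a" using y' by simp
  then show "1 / y \<in> regular P" unfolding regular_iff[OF P] using y' \<open>\<alpha> \<noteq> 0\<close> by blast
qed

lemma regular_value:
  assumes P: "P \<in> C" and y: "y \<in> regular P"
  shows "\<exists>c. y - \<iota> c \<in> vanishing P"
proof -
  from y obtain d a b \<alpha> \<beta> where
    y: "(a, \<alpha>) \<in> form_values P d" "(b, \<beta>) \<in> form_values P d" "\<beta> \<noteq> 0" "y = a / b"
    unfolding regular_iff[OF P] by blast
  have "b \<noteq> 0" using form_values_nonzero[OF P] y by blast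
  then have "y - \<iota> (\<alpha> / \<beta>) = (a - \<iota> (\<alpha> / \<beta>) * b) / b" using y by (simp add: field_simps)
  moreover have "(a - \<iota> (\<alpha> / \<beta>) * b, \<alpha> - \<alpha> / \<beta> * \<beta>) \<in> form_values P d"
    by (intro form_values_diff form_values_scale y)
  ultimately have "y - \<iota> (\<alpha> / \<beta>) \<in> vanishing P"
    unfolding vanishing_iff[OF P] using y by auto
  then show ?thesis ..
qed

text \<open>
  The coordinate \<open>chart P\<close> does not vanish at \<open>P\<close>, so its power dehomogenizes forms at \<open>P\<close>.
\<close>

lemma form_quotient_regular:
  assumes P: "P \<in> C" and a: "(a, \<alpha>) \<in> form_values P d"
  shows "a / x (chart P) ^ d \<in> regular P" "a / x (chart P) ^ d \<in> vanishing P \<longleftrightarrow> \<alpha> = 0"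
    "x (chart P) \<noteq> 0"
proof -
  note ne = chart_nonzero[OF in_proj_space[OF P]]
  have X: "(x (chart P), coords P (chart P)) \<in> form_values P 1"
    by (intro form_values_var chart_le in_proj_space P)
  from form_values_nonzero[OF P this ne] show x0: "x (chart P) \<noteq> 0" .
  from X have "(x (chart P) ^ d, coords P (chart P) ^ d) \<in> form_values P d"
    using form_values_power[OF X, of d] by simp
  note Xd = this
  show "a / x (chart P) ^ d \<in> regular P"
    unfolding regular_iff[OF P] using a Xd ne by (metis power_not_zero)
  have "a / x (chart P) ^ d \<in> vanishing P" if "\<alpha> = 0"
    unfolding vanishing_iff[OF P] using a Xd ne that by (metis power_not_zero)
  moreover have "a / x (chart P) ^ d \<notin> vanishing P" if "\<alpha> \<noteq> 0"
  proof
    assume "a / x (chart P) ^ d \<in> vanishing P"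
    moreover have "x (chart P) ^ d / a \<in> regular P"
      unfolding regular_iff[OF P] using a Xd that by blast
    ultimately have "x (chart P) ^ d / a * (a / x (chart P) ^ d) \<in> vanishing P"
      by (rule vanishing_mult[OF P, rotated])
    moreover have "a \<noteq> 0" using form_values_nonzero[OF P a that] .
    ultimately show False using one_not_vanishing[OF P] x0 by simp
  qed
  ultimately show "a / x (chart P) ^ d \<in> vanishing P \<longleftrightarrow> \<alpha> = 0" by blast
qed

lemma quotient_of_forms:
  obtains d F G where "form N d F" "form N d G" "eval_mpoly \<iota> x G \<noteq> 0"
    "y = eval_mpoly \<iota> x F / eval_mpoly \<iota> x G"
proof -
  have "y \<in> rational_functions N \<iota> x UNIV" using function_field by (simp add: function_field_def)
  then show ?thesis using that by (auto simp: rational_functions_def)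
qed

lemma quotient_of_regular:
  assumes P: "P \<in> C"
  obtains a b where "a \<in> regular P" "b \<in> regular P" "b \<noteq> 0" "y = a / b"
proof -
  obtain d F G where FG: "form N d F" "form N d G" "eval_mpoly \<iota> x G \<noteq> 0"
    "y = eval_mpoly \<iota> x F / eval_mpoly \<iota> x G"
    by (rule quotient_of_forms)
  then have "(eval_mpoly \<iota> x F, eval_mpoly id (coords P) F) \<in> form_values P d"
    "(eval_mpoly \<iota> x G, eval_mpoly id (coords P) G) \<in> form_values P d"
    by (auto simp: form_values_def)
  from form_quotient_regular[OF P this(1)] form_quotient_regular[OF P this(2)] FG show ?thesis
    by (intro that[of "eval_mpoly \<iota> x F / x (chart P) ^ d" "eval_mpoly \<iota> x G / x (chart P) ^ d"]) auto
qed

end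

section \<open>Local rings are discrete valuation rings\<close>

context constant_field
begin

definition ideal_of :: "'b set \<Rightarrow> 'b set \<Rightarrow> bool" where
  "ideal_of R I \<longleftrightarrow> I \<subseteq> R \<and> 0 \<in> I \<and> (\<forall>y\<in>I. \<forall>z\<in>I. y + z \<in> I) \<and> (\<forall>r\<in>R. \<forall>y\<in>I. r * y \<in> I)"

lemma ideal_ofD:
  assumes "ideal_of R I"
  shows "y \<in> I \<Longrightarrow> y \<in> R" "0 \<in> I" "y \<in> I \<Longrightarrow> z \<in> I \<Longrightarrow> y + z \<in> I" "r \<in> R \<Longrightarrow> y \<in> I \<Longrightarrow> r * y \<in> I"
  using assms by (auto simp: ideal_of_def)

lemma ideal_of_diff:
  assumes "subalgebra R" "ideal_of R I" "y \<in> I" "z \<in> I"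
  shows "y - z \<in> I"
  using ideal_ofD(3)[OF assms(2,3) ideal_ofD(4)[OF assms(2) subalgebraD(1)[OF assms(1), of "-1"] assms(4)]]
  by (simp add: hom_distribs)

lemma ideal_cong_mult:
  assumes "subalgebra R" "ideal_of R I" "y \<in> R" "y' \<in> R" "z \<in> R" "z' \<in> R" "y - y' \<in> I" "z - z' \<in> I"
  shows "y * z - y' * z' \<in> I"
proof -
  have "y * z - y' * z' = y * (z - z') + z' * (y - y')" by (simp add: algebra_simps)
  then show ?thesis using assms by (auto intro: ideal_ofD)
qed

lemma ideal_cong_power:
  assumes "subalgebra R" "ideal_of R I" "y \<in> R" "y' \<in> R" "y - y' \<in> I"
  shows "y ^ n - y' ^ n \<in> I"
proof (induction n)
  case (Suc n)
  then show ?case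
    using ideal_cong_mult[OF assms(1,2,3,4) _ _ assms(5) Suc] assms by (simp add: subalgebra_power)
qed (use assms in \<open>simp add: ideal_ofD\<close>)

lemma ideal_cong_prod:
  assumes "subalgebra R" "ideal_of R I"
    and "\<And>i. i \<in> S \<Longrightarrow> g i \<in> R" "\<And>i. i \<in> S \<Longrightarrow> h i \<in> R" "\<And>i. i \<in> S \<Longrightarrow> g i - h i \<in> I"
  shows "prod g S - prod h S \<in> I"
  using assms(3-5)
proof (induction S rule: infinite_finite_induct)
  case (insert i S)
  then show ?case
    by (auto intro!: ideal_cong_mult[OF assms(1,2)] subalgebra_prod[OF assms(1)])
qed (use assms in \<open>auto simp: ideal_ofD\<close>)

lemma ideal_cong_sum:
  assumes "ideal_of R I" "\<And>i. i \<in> S \<Longrightarrow> g i - h i \<in> I"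
  shows "sum g S - sum h S \<in> I"
proof -
  have "(\<Sum>i\<in>S. g i - h i) \<in> I"
    using assms by (induction S rule: infinite_finite_induct) (auto intro: ideal_ofD)
  then show ?thesis by (simp add: sum_subtractf)
qed

lemma ideal_poly_cong:
  assumes "subalgebra R" "ideal_of R I" "y \<in> R" "y - \<iota> c \<in> I"
  shows "poly (map_poly \<iota> B) y - \<iota> (poly B c) \<in> I"
proof -
  have "(\<Sum>i\<le>degree B. \<iota> (coeff B i) * y ^ i) - (\<Sum>i\<le>degree B. \<iota> (coeff B i) * \<iota> c ^ i) \<in> I"
  proof (rule ideal_cong_sum[OF assms(2)])
    fix i
    have "\<iota> (coeff B i) * (y ^ i - \<iota> c ^ i) \<in> I"
      using assms by (intro ideal_ofD(4)[OF assms(2)] ideal_cong_power) (auto simp: subalgebraD)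
    then show "\<iota> (coeff B i) * y ^ i - \<iota> (coeff B i) * \<iota> c ^ i \<in> I" by (simp add: right_diff_distrib)
  qed
  then show ?thesis by (simp add: poly_map_poly_altdef poly_altdef[of B] hom_distribs)
qed

lemma ideal_eval_cong:
  assumes "subalgebra R" "ideal_of R I" "form N d F"
    and "\<And>i. i \<le> N \<Longrightarrow> y i \<in> R" "\<And>i. i \<le> N \<Longrightarrow> y i - \<iota> (c i) \<in> I"
  shows "eval_mpoly \<iota> y F - \<iota> (eval_mpoly id c F) \<in> I"
proof -
  have "(\<Sum>m\<in>Poly_Mapping.keys F. \<iota> (Poly_Mapping.lookup F m) * monomial_value y m) -
      (\<Sum>m\<in>Poly_Mapping.keys F. \<iota> (Poly_Mapping.lookup F m) * monomial_value (\<lambda>i. \<iota> (c i)) m) \<in> I"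
  proof (rule ideal_cong_sum[OF assms(2)])
    fix m assume "m \<in> Poly_Mapping.keys F"
    then have N: "i \<le> N" if "i \<in> Poly_Mapping.keys m" for i using assms(3) that by (auto simp: form_def)
    have "monomial_value y m - monomial_value (\<lambda>i. \<iota> (c i)) m \<in> I"
      unfolding monomial_value_def
      using assms N by (intro ideal_cong_prod ideal_cong_power) (auto simp: subalgebraD subalgebra_power)
    from ideal_ofD(4)[OF assms(2) subalgebraD(1)[OF assms(1)] this]
    show "\<iota> (Poly_Mapping.lookup F m) * monomial_value y m -
        \<iota> (Poly_Mapping.lookup F m) * monomial_value (\<lambda>i. \<iota> (c i)) m \<in> I"
      by (simp add: right_diff_distrib)
  qed
  moreover have "monomial_value (\<lambda>i. \<iota> (c i)) m = \<iota> (monomial_value c m)" for m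
    by (simp add: monomial_value_def hom_distribs)
  ultimately show ?thesis by (simp add: eval_mpoly_altdef hom_distribs)
qed

end

context smooth_curve
begin

lemma vanishing_ideal: "P \<in> C \<Longrightarrow> ideal_of (regular P) (vanishing P)"
proof -
  assume P: "P \<in> C"
  obtain s where s: "local_parameter N \<iota> x P s" using smooth P by blast
  have V: "vanishing P = (\<lambda>y. s * y) ` regular P" using s by (simp add: local_parameter_def)
  note R = regular_subalgebra[OF P]
  have "0 \<in> vanishing P" unfolding V using subalgebraD(4)[OF R] by force
  moreover have "y + z \<in> vanishing P" if yz: "y \<in> vanishing P" "z \<in> vanishing P" for y z
  proof -
    from yz obtain y' z' where yz': "y = s * y'" "z = s * z'" "y' \<in> regular P" "z' \<in> regular P"
      unfolding V by blast
    then have "y + z = s * (y' + z')" by (simp add: distrib_left)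
    then show ?thesis unfolding V using subalgebraD(2)[OF R yz'(3,4)] by blast
  qed
  ultimately show ?thesis
    unfolding ideal_of_def using vanishing_subset_regular[OF P] vanishing_mult[OF P] by blast
qed

definition unit_at :: "'k point \<Rightarrow> 'b set" where
  "unit_at P = regular P - vanishing P"

lemma unit_atD: "y \<in> unit_at P \<Longrightarrow> y \<in> regular P" "y \<in> unit_at P \<Longrightarrow> y \<notin> vanishing P"
  by (auto simp: unit_at_def)

lemma unit_at_mult:
  assumes P: "P \<in> C" and "y \<in> unit_at P" "z \<in> unit_at P"
  shows "y * z \<in> unit_at P"
proof -
  have "1 / y \<in> regular P" "y \<noteq> 0" using inverse_regular[OF P] assms unit_atD by blast+
  then have "y * z \<notin> vanishing P"
    using vanishing_mult[OF P, of "1 / y" "y * z"] assms(3) unit_atD by auto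
  then show ?thesis
    unfolding unit_at_def using assms subalgebraD(3)[OF regular_subalgebra[OF P]] by (auto simp: unit_at_def)
qed

lemma unit_at_nonzero: "P \<in> C \<Longrightarrow> y \<in> unit_at P \<Longrightarrow> y \<noteq> 0"
  using inverse_regular unit_atD by blast

lemma unit_at_inverse:
  assumes P: "P \<in> C" and y: "y \<in> unit_at P"
  shows "inverse y \<in> unit_at P"
proof -
  have "1 / y \<in> regular P" "y \<noteq> 0" using inverse_regular[OF P] y unit_atD by blast+
  moreover have "1 / y \<notin> vanishing P"
    using vanishing_mult[OF P unit_atD(1)[OF y], of "1 / y"] one_not_vanishing[OF P] \<open>y \<noteq> 0\<close> by auto
  ultimately show ?thesis by (simp add: unit_at_def inverse_eq_divide)
qed

lemma unit_at_const:
  assumes P: "P \<in> C" and c: "c \<noteq> 0"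
  shows "\<iota> c \<in> unit_at P"
proof -
  note R = regular_subalgebra[OF P]
  have "\<iota> (inverse c) * \<iota> c = 1" using c by (simp add: hom_distribs)
  then have "\<iota> c \<notin> vanishing P"
    using vanishing_mult[OF P subalgebraD(1)[OF R], of "\<iota> c" "inverse c"] one_not_vanishing[OF P] by auto
  then show ?thesis using subalgebraD(1)[OF R] by (simp add: unit_at_def)
qed

lemma unit_at_power: "P \<in> C \<Longrightarrow> y \<in> unit_at P \<Longrightarrow> y ^ n \<in> unit_at P"
  using unit_at_const[of P 1] by (induction n) (auto intro: unit_at_mult)

lemma unit_at_powi: "P \<in> C \<Longrightarrow> y \<in> unit_at P \<Longrightarrow> y powi k \<in> unit_at P"
  by (auto simp: power_int_def unit_at_power unit_at_inverse)

lemma not_all_constant: "\<exists>y. y \<notin> range \<iota>"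
proof -
  obtain t where t: "transcendental_over \<iota> t"
    using dimension_one by (auto simp: transcendence_degree_one_def)
  have "t \<noteq> \<iota> c" for c
  proof
    assume "t = \<iota> c"
    then have "poly (map_poly \<iota> [:- c, 1:]) t = 0" by (simp add: poly_map_poly_altdef hom_distribs)
    then show False using t by (auto simp: transcendental_over_def)
  qed
  then show ?thesis by blast
qed

lemma local_parameterD:
  assumes P: "P \<in> C" and s: "local_parameter N \<iota> x P s"
  shows "s \<in> vanishing P" "s \<noteq> 0" "y \<in> vanishing P \<Longrightarrow> \<exists>z\<in>regular P. y = s * z"
proof -
  note V = s[unfolded local_parameter_def]
  show "s \<in> vanishing P"
    unfolding V using subalgebraD(5)[OF regular_subalgebra[OF P]] by force
  show "\<exists>z\<in>regular P. y = s * z" if "y \<in> vanishing P" for y using that unfolding V by blast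
  show "s \<noteq> 0"
  proof
    assume "s = 0"
    then have "vanishing P \<subseteq> {0}" unfolding V by auto
    then have "regular P \<subseteq> range \<iota>" using regular_value[OF P] by fastforce
    moreover have "y \<in> range \<iota>" if "regular P \<subseteq> range \<iota>" for y
    proof -
      obtain a b where "a \<in> regular P" "b \<in> regular P" "b \<noteq> 0" "y = a / b" by (rule quotient_of_regular[OF P])
      with that obtain c d where "y = \<iota> c / \<iota> d" by blast
      then have "y = \<iota> (c / d)" by (simp add: hom_distribs)
      then show ?thesis by blast
    qed
    ultimately show False using not_all_constant by blast
  qed
qed

text \<open>
  The point is that no \<open>y \<noteq> 0\<close> is divisible by all powers of the local parameter \<open>s\<close>. Some non-zero
  polynomial \<open>B(s)\<close> over \<open>k\<close> is a multiple of \<open>y\<close>; and \<open>B(s)\<close> is \<open>s\<^sup>k\<close> times a unit, where \<open>k\<close> is the order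
  of \<open>B\<close> at \<open>0\<close>, so \<open>s\<^sup>k\<^sup>+\<^sup>1\<close> does not divide \<open>y\<close>.
\<close>

lemma regular_decomposition:
  assumes P: "P \<in> C" and s: "local_parameter N \<iota> x P s" and y: "y \<in> regular P" "y \<noteq> 0"
  shows "\<exists>j. \<exists>u\<in>unit_at P. y = s ^ j * u"
proof (rule ccontr)
  assume no: "\<not> ?thesis"
  note sD = local_parameterD[OF P s]
  note R = regular_subalgebra[OF P]
  have sR: "s \<in> regular P" using sD(1) vanishing_subset_regular[OF P] by blast
  have div: "\<exists>z\<in>regular P. y = s ^ j * z" for j
  proof (induction j)
    case (Suc j)
    then obtain z where z: "z \<in> regular P" "y = s ^ j * z" by blast
    then have "z \<in> vanishing P" using no by (auto simp: unit_at_def)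
    then obtain z' where "z' \<in> regular P" "z = s * z'" using sD(3) by blast
    then show ?case using z by auto
  qed (use y in auto)
  obtain B where B: "B \<noteq> 0" "\<And>R. subalgebra R \<Longrightarrow> y \<in> R \<Longrightarrow> s \<in> R \<Longrightarrow>
      (\<exists>w\<in>R. poly (map_poly \<iota> B) s = y * w)"
    using ex_poly_value_dvd[OF y(2), of s] by blast
  obtain w where w: "w \<in> regular P" "poly (map_poly \<iota> B) s = y * w" using B(2)[OF R y(1) sR] by blast
  obtain B' where B': "B = [:- 0, 1:] ^ order 0 B * B'" "\<not> [:- 0, 1:] dvd B'"
    using order_decomp[OF B(1), of 0] by blast
  define k where "k = order 0 B"
  have "poly B' 0 \<noteq> 0" using B'(2) by (simp add: poly_eq_0_iff_dvd)
  have "poly (map_poly \<iota> B') s - \<iota> (poly B' 0) \<in> vanishing P"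
    using ideal_poly_cong[OF R vanishing_ideal[OF P] sR, of 0 B'] sD(1) by simp
  then have B'unit: "poly (map_poly \<iota> B') s \<notin> vanishing P"
    using ideal_of_diff[OF R vanishing_ideal[OF P], of "poly (map_poly \<iota> B') s" "poly (map_poly \<iota> B') s - \<iota> (poly B' 0)"]
      unit_at_const[OF P \<open>poly B' 0 \<noteq> 0\<close>] by (auto simp: unit_at_def)
  have "poly (map_poly \<iota> B) s = s ^ k * poly (map_poly \<iota> B') s"
  proof -
    have "poly (map_poly \<iota> ([:0, 1:] ^ n * q)) s = s ^ n * poly (map_poly \<iota> q) s" for n q
    proof (induction n)
      case (Suc n)
      have "[:0, 1:] ^ Suc n * q = pCons 0 ([:0, 1:] ^ n * q)" by simp
      then show ?case using Suc by (simp add: map_poly_pCons)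
    qed simp
    from this[of k B'] show ?thesis using B'(1) by (simp add: k_def)
  qed
  moreover obtain z where "z \<in> regular P" "y = s ^ Suc k * z" using div by blast
  ultimately have "poly (map_poly \<iota> B') s = (z * w) * s" using w(2) sD(2) by (simp add: mult_ac)
  moreover have "(z * w) * s \<in> vanishing P"
    using \<open>z \<in> _\<close> w(1) by (intro vanishing_mult[OF P] sD subalgebraD(3)[OF R])
  ultimately show False using B'unit by simp
qed

lemma decomposition:
  assumes P: "P \<in> C" and s: "local_parameter N \<iota> x P s" and y: "y \<noteq> 0"
  shows "\<exists>k. \<exists>u\<in>unit_at P. y = s powi k * u"
proof -
  obtain a b where ab: "a \<in> regular P" "b \<in> regular P" "b \<noteq> 0" "y = a / b" by (rule quotient_of_regular[OF P])
  have "a \<noteq> 0" using y ab by auto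
  obtain i u where i: "u \<in> unit_at P" "a = s ^ i * u" using regular_decomposition[OF P s ab(1) \<open>a \<noteq> 0\<close>] by blast
  obtain j w where j: "w \<in> unit_at P" "b = s ^ j * w" using regular_decomposition[OF P s ab(2,3)] by blast
  have "y = s powi (int i - int j) * (u * inverse w)"
    using ab(4) i j local_parameterD(2)[OF P s]
    by (simp add: power_int_diff field_simps)
  moreover have "u * inverse w \<in> unit_at P" by (intro unit_at_mult unit_at_inverse P i j)
  ultimately show ?thesis by blast
qed

lemma power_unit_unique:
  assumes P: "P \<in> C" and s: "local_parameter N \<iota> x P s" and u: "u \<in> unit_at P" "w \<in> unit_at P"
    and eq: "s powi k * u = s powi l * w"
  shows "k \<le> l"
proof (rule ccontr)
  assume "\<not> k \<le> l"
  then obtain n where n: "k = l + int (Suc n)" by (metis not_le zless_iff_Suc_zadd)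
  have s0: "s \<noteq> 0" using local_parameterD[OF P s] by blast
  have "s powi k = s powi l * s ^ Suc n"
    using s0 unfolding n by (simp add: power_int_add power_int_of_nat del: of_nat_Suc)
  then have "w = (s ^ n * u) * s" using eq s0 by (simp add: mult_ac)
  moreover have "(s ^ n * u) * s \<in> vanishing P"
    using u(1) local_parameterD(1)[OF P s] vanishing_subset_regular[OF P] regular_subalgebra[OF P]
    by (intro vanishing_mult[OF P] subalgebraD(3) subalgebra_power) (auto simp: unit_at_def)
  ultimately show False using u(2) by (simp add: unit_at_def)
qed

abbreviation ord :: "'k point \<Rightarrow> 'b \<Rightarrow> int" where
  "ord P y \<equiv> ord_at N \<iota> x P y"

text \<open>
  Two local parameters differ by a unit, so the order is independent of the one chosen.
\<close>

lemma ord_eqI: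
  assumes P: "P \<in> C" and s: "local_parameter N \<iota> x P s" and u: "u \<in> unit_at P" and y: "y = s powi k * u"
  shows "ord P y = k"
  unfolding ord_at_def
proof (rule the_equality)
  show "\<exists>s w. local_parameter N \<iota> x P s \<and> w \<in> regular P - vanishing P \<and> y = s powi k * w"
    using s u y by (auto simp: unit_at_def)
  fix l assume "\<exists>s w. local_parameter N \<iota> x P s \<and> w \<in> regular P - vanishing P \<and> y = s powi l * w"
  then obtain s' w where s': "local_parameter N \<iota> x P s'" "w \<in> unit_at P" "y = s' powi l * w"
    unfolding unit_at_def by blast
  obtain a b where a: "a \<in> regular P" "s' = s * a" and b: "b \<in> regular P" "s = s' * b"
    using local_parameterD(3)[OF P s local_parameterD(1)[OF P s'(1)]]
      local_parameterD(3)[OF P s'(1) local_parameterD(1)[OF P s]] by blast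
  have "b * a = 1" using a(2) b(2) local_parameterD(2)[OF P s] by (metis mult.assoc mult.commute mult_cancel_left1)
  then have "a \<notin> vanishing P" using vanishing_mult[OF P b(1)] one_not_vanishing[OF P] by metis
  then have "a \<in> unit_at P" using a by (simp add: unit_at_def)
  then have "a powi l * w \<in> unit_at P" by (intro unit_at_mult unit_at_powi P s')
  moreover have "s powi k * u = s powi l * (a powi l * w)"
    using y s'(3) by (simp add: a(2) power_int_mult_distrib mult.assoc)
  ultimately show "l = k" using power_unit_unique[OF P s] u by (metis order.antisym)
qed

lemma ex_ord_decomposition:
  assumes P: "P \<in> C" and s: "local_parameter N \<iota> x P s" and y: "y \<noteq> 0"
  obtains u where "u \<in> unit_at P" "y = s powi ord P y * u"
proof -
  obtain k u where u: "u \<in> unit_at P" "y = s powi k * u" using decomposition[OF assms] by blast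
  from ord_eqI[OF P s this] have "ord P y = k" .
  with u show ?thesis using that by simp
qed

lemma ord_mult:
  assumes P: "P \<in> C" and y: "y \<noteq> 0" "z \<noteq> 0"
  shows "ord P (y * z) = ord P y + ord P z"
proof -
  obtain s where s: "local_parameter N \<iota> x P s" using smooth P by blast
  obtain u where u: "u \<in> unit_at P" "y = s powi ord P y * u" by (rule ex_ord_decomposition[OF P s y(1)])
  obtain w where w: "w \<in> unit_at P" "z = s powi ord P z * w" by (rule ex_ord_decomposition[OF P s y(2)])
  have "y * z = (s powi ord P y * u) * (s powi ord P z * w)" using u(2) w(2) by simp
  also have "\<dots> = s powi (ord P y + ord P z) * (u * w)"
    using local_parameterD(2)[OF P s] by (simp add: power_int_add)
  finally have "y * z = s powi (ord P y + ord P z) * (u * w)" .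
  then show ?thesis by (rule ord_eqI[OF P s unit_at_mult[OF P u(1) w(1)]])
qed

lemma ord_unit: "P \<in> C \<Longrightarrow> u \<in> unit_at P \<Longrightarrow> ord P u = 0"
  using smooth ord_eqI[of P _ u u 0] by auto

lemma ord_const: "P \<in> C \<Longrightarrow> c \<noteq> 0 \<Longrightarrow> ord P (\<iota> c) = 0"
  by (intro ord_unit unit_at_const)

lemma ord_one: "P \<in> C \<Longrightarrow> ord P 1 = 0"
  using ord_const[of P 1] by simp

lemma ord_divide:
  assumes P: "P \<in> C" and y: "y \<noteq> 0" "z \<noteq> 0"
  shows "ord P (y / z) = ord P y - ord P z"
  using ord_mult[OF P, of "y / z" z] y by simp

lemma ord_power: "P \<in> C \<Longrightarrow> y \<noteq> 0 \<Longrightarrow> ord P (y ^ n) = int n * ord P y"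
  by (induction n) (simp_all add: ord_one ord_mult algebra_simps)

lemma ord_parameter: "P \<in> C \<Longrightarrow> local_parameter N \<iota> x P s \<Longrightarrow> ord P s = 1"
  using ord_eqI[of P s 1 s 1] unit_at_const[of P 1] by simp

lemma vanishing_iff_ord:
  assumes P: "P \<in> C" and y: "y \<noteq> 0"
  shows "y \<in> regular P \<longleftrightarrow> ord P y \<ge> 0" "y \<in> vanishing P \<longleftrightarrow> ord P y \<ge> 1"
proof -
  obtain s where s: "local_parameter N \<iota> x P s" using smooth P by blast
  note sD = local_parameterD[OF P s]
  note R = regular_subalgebra[OF P]
  have sR: "s \<in> regular P" using sD(1) vanishing_subset_regular[OF P] by blast
  obtain u where u: "u \<in> unit_at P" "y = s powi ord P y * u" by (rule ex_ord_decomposition[OF P s y])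
  have 1: "y \<in> regular P" if "ord P y \<ge> 0"
  proof -
    have "s powi ord P y = s ^ nat (ord P y)" using that by (simp add: power_int_def)
    then show ?thesis using u sR by (metis subalgebraD(3)[OF R] subalgebra_power[OF R] unit_atD(1))
  qed
  have 2: "ord P y \<ge> 0" if yR: "y \<in> regular P"
  proof -
    obtain j w where w: "w \<in> unit_at P" "y = s ^ j * w" using regular_decomposition[OF P s yR y] by blast
    then have "ord P y = int j" by (intro ord_eqI[OF P s w(1)]) simp
    then show ?thesis by simp
  qed
  show reg: "y \<in> regular P \<longleftrightarrow> ord P y \<ge> 0" using 1 2 by blast
  have "ord P y = 0" if "y \<in> unit_at P" by (rule ord_unit[OF P that])
  moreover have "y \<in> unit_at P" if "ord P y = 0" using u that by simp
  ultimately show "y \<in> vanishing P \<longleftrightarrow> ord P y \<ge> 1"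
    using reg vanishing_subset_regular[OF P] unfolding unit_at_def by force
qed

text \<open>
  The order of \<open>0\<close> is infinite, whereas \<open>ord P 0\<close> is an arbitrary integer; bounds on orders are
  therefore stated by membership in these subgroups.
\<close>

definition ord_ge :: "'k point \<Rightarrow> int \<Rightarrow> 'b set" where
  "ord_ge P k = {y. y = 0 \<or> k \<le> ord P y}"

lemma regular_eq_ord_ge:
  assumes P: "P \<in> C"
  shows "regular P = ord_ge P 0"
proof (rule Set.set_eqI)
  show "y \<in> regular P \<longleftrightarrow> y \<in> ord_ge P 0" for y
    using vanishing_iff_ord(1)[OF P, of y] subalgebraD(4)[OF regular_subalgebra[OF P]]
    by (cases "y = 0") (auto simp: ord_ge_def)
qed

lemma vanishing_eq_ord_ge:
  assumes P: "P \<in> C"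
  shows "vanishing P = ord_ge P 1"
proof (rule Set.set_eqI)
  show "y \<in> vanishing P \<longleftrightarrow> y \<in> ord_ge P 1" for y
    using vanishing_iff_ord(2)[OF P, of y] ideal_ofD(2)[OF vanishing_ideal[OF P]]
    by (cases "y = 0") (auto simp: ord_ge_def)
qed

lemma zero_ord_ge [simp]: "0 \<in> ord_ge P k"
  by (simp add: ord_ge_def)

lemma ord_ge_mono: "y \<in> ord_ge P k \<Longrightarrow> l \<le> k \<Longrightarrow> y \<in> ord_ge P l"
  by (auto simp: ord_ge_def)

lemma ord_ge_mult: "P \<in> C \<Longrightarrow> y \<in> ord_ge P k \<Longrightarrow> z \<in> ord_ge P l \<Longrightarrow> y * z \<in> ord_ge P (k + l)"
  using ord_mult[of P y z] by (cases "y = 0 \<or> z = 0") (auto simp: ord_ge_def)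

lemma ord_ge_const: "P \<in> C \<Longrightarrow> \<iota> c \<in> ord_ge P 0"
  using ord_const[of P c] by (cases "c = 0") (auto simp: ord_ge_def)

lemma ord_ge_scale: "P \<in> C \<Longrightarrow> y \<in> ord_ge P k \<Longrightarrow> \<iota> c * y \<in> ord_ge P k"
  using ord_ge_mult[OF _ ord_ge_const, of P y k c] by simp

lemma ord_ge_add:
  assumes P: "P \<in> C" and "y \<in> ord_ge P k" "z \<in> ord_ge P k"
  shows "y + z \<in> ord_ge P k"
proof -
  obtain s where s: "local_parameter N \<iota> x P s" using smooth P by blast
  have s0: "s \<noteq> 0" using local_parameterD[OF P s] by blast
  have ords: "ord P (s powi l) = l" for l
    using unit_at_const[OF P, of 1] by (intro ord_eqI[OF P s, where u = 1]) auto
  have *: "y * s powi - k \<in> regular P" if "y \<in> ord_ge P k" for y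
    unfolding regular_eq_ord_ge[OF P] using ord_ge_mult[OF P that, of "s powi - k" "-k"] ords s0
    by (simp add: ord_ge_def)
  have "y * s powi - k + z * s powi - k \<in> ord_ge P 0"
    using *[OF assms(2)] *[OF assms(3)] subalgebraD(2)[OF regular_subalgebra[OF P]]
    unfolding regular_eq_ord_ge[OF P, symmetric] by blast
  from ord_ge_mult[OF P this, of "s powi k" k]
  have "(y * s powi - k + z * s powi - k) * s powi k \<in> ord_ge P k" using ords by (simp add: ord_ge_def)
  moreover have "s powi - k * s powi k = 1" using s0 by (simp add: power_int_minus)
  then have "(y * s powi - k + z * s powi - k) * s powi k = y + z" by (simp add: distrib_right mult.assoc)
  ultimately show ?thesis by simp
qed

lemma ord_ge_uminus: "P \<in> C \<Longrightarrow> y \<in> ord_ge P k \<Longrightarrow> - y \<in> ord_ge P k"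
  using ord_ge_scale[of P y k "-1"] by (simp add: hom_distribs)

lemma ord_ge_diff: "P \<in> C \<Longrightarrow> y \<in> ord_ge P k \<Longrightarrow> z \<in> ord_ge P k \<Longrightarrow> y - z \<in> ord_ge P k"
  using ord_ge_add[of P y k "- z"] ord_ge_uminus[of P z k] by simp

lemma ord_ge_sum: "P \<in> C \<Longrightarrow> (\<And>i. i \<in> I \<Longrightarrow> g i \<in> ord_ge P k) \<Longrightarrow> sum g I \<in> ord_ge P k"
  by (induction I rule: infinite_finite_induct) (auto intro: ord_ge_add)

lemma ord_ge_ord: "y \<in> ord_ge P (ord P y)"
  by (simp add: ord_ge_def)

text \<open>
  The residue field is \<open>k\<close>, so the quotient \<open>y / z\<close> is congruent to a constant.
\<close>

lemma ord_ge_leading_term: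
  assumes P: "P \<in> C" and y: "y \<in> ord_ge P k" and z: "z \<noteq> 0" "ord P z = k"
  shows "\<exists>c. y - \<iota> c * z \<in> ord_ge P (k + 1)"
proof -
  have "y / z \<in> regular P"
    unfolding regular_eq_ord_ge[OF P] using y z ord_divide[OF P, of y z] by (cases "y = 0") (auto simp: ord_ge_def)
  then obtain c where "y / z - \<iota> c \<in> ord_ge P 1"
    using regular_value[OF P] vanishing_eq_ord_ge[OF P] by blast
  from ord_ge_mult[OF P this, of z k] have "(y / z - \<iota> c) * z \<in> ord_ge P (k + 1)"
    using z by (simp add: ord_ge_def add.commute)
  moreover have "(y / z - \<iota> c) * z = y - \<iota> c * z" using z by (simp add: left_diff_distrib)
  ultimately show ?thesis by auto
qed

end

section \<open>Functions without poles are constant\<close>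

context constant_field
begin

text \<open>
  Over an algebraically closed field \<open>B\<close> is a product of linear factors, one of which lies in the
  prime ideal.
\<close>

lemma root_cong_prime_ideal:
  assumes closed: "\<And>p :: 'k poly. degree p > 0 \<Longrightarrow> \<exists>c. poly p c = 0"
    and R: "subalgebra R"
    and prime: "\<And>y z. y \<in> R \<Longrightarrow> z \<in> R \<Longrightarrow> y * z \<in> I \<Longrightarrow> y \<in> I \<or> z \<in> I"
    and units: "\<And>c. c \<noteq> 0 \<Longrightarrow> \<iota> c \<notin> I"
    and B: "B \<noteq> 0" and z: "z \<in> R" and root: "poly (map_poly \<iota> B) z \<in> I"
  shows "\<exists>c. z - \<iota> c \<in> I"
  using B root
proof (induction "degree B" arbitrary: B)
  case 0
  then obtain c where "B = [:c:]" using degree_eq_zeroE by metis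
  then show ?case using 0 units[of c] by (simp add: map_poly_pCons)
next
  case (Suc n)
  then obtain c where "poly B c = 0" using closed[of B] by auto
  then obtain B' where B': "B = [:- c, 1:] * B'" by (auto simp: poly_eq_0_iff_dvd elim: dvdE)
  then have "B' \<noteq> 0" using Suc by auto
  have "degree B = Suc (degree B')" unfolding B' using \<open>B' \<noteq> 0\<close> by (subst degree_mult_eq) auto
  then have deg: "n = degree B'" using Suc by simp
  have "poly (map_poly \<iota> B) z = (z - \<iota> c) * poly (map_poly \<iota> B') z"
    unfolding B' poly_map_poly_mult by (simp add: poly_map_poly_pCons hom_distribs)
  then have "z - \<iota> c \<in> I \<or> poly (map_poly \<iota> B') z \<in> I"
    using Suc.prems(2) prime[of "z - \<iota> c" "poly (map_poly \<iota> B') z"] z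
    by (auto simp: subalgebraD[OF R] subalgebra_poly[OF R])
  then show ?case using Suc.hyps(1)[OF deg \<open>B' \<noteq> 0\<close>] by blast
qed

definition adjoin :: "'b set \<Rightarrow> 'b \<Rightarrow> 'b set" where
  "adjoin R y = {poly q y | q. \<forall>i. coeff q i \<in> R}"

lemma adjoin_subalgebra:
  assumes R: "subalgebra R"
  shows "subalgebra (adjoin R y)" "R \<subseteq> adjoin R y" "y \<in> adjoin R y"
proof -
  note D = subalgebraD[OF R]
  show sub: "R \<subseteq> adjoin R y"
  proof
    fix b assume b: "b \<in> R"
    have "\<forall>i. coeff [:b:] i \<in> R" using b D(4) by (auto simp: coeff_pCons split: nat.split)
    moreover have "b = poly [:b:] y" by simp
    ultimately show "b \<in> adjoin R y" unfolding adjoin_def by blast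
  qed
  have "\<forall>i. coeff [:0, 1:] i \<in> R" using D(4,5) by (auto simp: coeff_pCons split: nat.split)
  moreover have "y = poly [:0, 1:] y" by simp
  ultimately show "y \<in> adjoin R y" unfolding adjoin_def by blast
  show "subalgebra (adjoin R y)"
    unfolding subalgebra_def
  proof (intro conjI ballI)
    show "range \<iota> \<subseteq> adjoin R y" using R sub by (auto simp: subalgebra_def)
    fix a b assume "a \<in> adjoin R y" "b \<in> adjoin R y"
    then obtain p q where pq: "a = poly p y" "b = poly q y" "\<And>i. coeff p i \<in> R" "\<And>i. coeff q i \<in> R"
      by (auto simp: adjoin_def)
    have "\<forall>i. coeff (p + q) i \<in> R" using pq D(2) by simp
    moreover have "a + b = poly (p + q) y" by (simp add: pq)
    ultimately show "a + b \<in> adjoin R y" unfolding adjoin_def by blast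
    have "\<forall>i. coeff (p * q) i \<in> R" using pq D(3) by (auto simp: coeff_mult intro!: subalgebra_sum[OF R])
    moreover have "a * b = poly (p * q) y" by (simp add: pq)
    ultimately show "a * b \<in> adjoin R y" unfolding adjoin_def by blast
  qed
qed

lemma adjoin_sum_powers:
  assumes R: "subalgebra R" and r: "r \<in> adjoin R y"
  shows "\<exists>n b. (\<forall>i. b i \<in> R) \<and> r = (\<Sum>i\<le>n. b i * y ^ i)"
proof -
  from r obtain q where "r = poly q y" "\<forall>i. coeff q i \<in> R" by (auto simp: adjoin_def)
  then show ?thesis
    by (intro exI[of _ "degree q"] exI[of _ "coeff q"]) (simp add: poly_altdef)
qed

end

text \<open>
  A subalgebra that is maximal among those that contain \<open>1 / r\<close> but not \<open>r\<close> is a valuation ring, and \<open>1 / r\<close>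
  lies in its maximal ideal. This is Chevalley's construction of a place at which \<open>r\<close> has a pole.
\<close>

locale maximal_avoiding =
  constant_field \<iota> for \<iota> :: "'k::field \<Rightarrow> 'b::field" +
  fixes r :: 'b and V :: "'b set"
  assumes nonzero: "r \<noteq> 0"
    and V: "subalgebra V" and inv_in: "1 / r \<in> V" and not_in: "r \<notin> V"
    and maximal: "\<And>W. subalgebra W \<Longrightarrow> V \<subseteq> W \<Longrightarrow> r \<notin> W \<Longrightarrow> W = V"

context maximal_avoiding
begin

lemmas VD = subalgebraD[OF V]

text \<open>
  By maximality, adjoining a further element makes \<open>r\<close> available.
\<close>

lemma r_in_adjoin: "y \<notin> V \<Longrightarrow> \<exists>n b. (\<forall>i. b i \<in> V) \<and> r = (\<Sum>i\<le>n. b i * y ^ i)"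
  using maximal[OF adjoin_subalgebra(1,2)[OF V], of y] adjoin_subalgebra(3)[OF V, of y]
    adjoin_sum_powers[OF V] by blast

text \<open>
  \<open>1 / r\<close> lies in the Jacobson radical. If the inverse of \<open>a = 1 - b / r\<close> were missing, \<open>r\<close> would be a
  polynomial in it; multiplication by a power \<open>a\<^sup>n\<close>, which is \<open>1 - c / r\<close> with \<open>c\<close> in \<open>V\<close>, gives that \<open>r - c\<close> lies in \<open>V\<close>.
\<close>

lemma jacobson:
  assumes b: "b \<in> V"
  shows "1 - b / r \<noteq> 0" "1 / (1 - b / r) \<in> V"
proof -
  define a where "a = 1 - b / r"
  show a0: "1 - b / r \<noteq> 0" using b not_in nonzero by auto
  have aV: "a \<in> V" using VD(7)[OF VD(5) VD(3)[OF b inv_in]] by (simp add: a_def)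
  have pow: "\<exists>c\<in>V. a ^ k = 1 - c / r" for k
  proof (induction k)
    case 0
    then show ?case using VD(4) by (intro bexI[of _ 0]) auto
  next
    case (Suc k)
    then obtain c where c: "c \<in> V" "a ^ k = 1 - c / r" by blast
    have "a ^ Suc k = a - c * a / r" by (simp add: c(2) right_diff_distrib mult.commute)
    also have "\<dots> = 1 - b / r - c * a / r" using a_def by simp
    finally have "a ^ Suc k = 1 - (b + c * a) / r" by (simp add: add_divide_distrib)
    moreover have "b + c * a \<in> V" using VD b c aV by blast
    ultimately show ?case by blast
  qed
  show "1 / (1 - b / r) \<in> V"
  proof (rule ccontr)
    assume "1 / (1 - b / r) \<notin> V"
    then obtain n d where d: "\<And>i. d i \<in> V" "r = (\<Sum>i\<le>n. d i * (1 / a) ^ i)"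
      using r_in_adjoin[of "1 / a"] unfolding a_def by blast
    have "r * a ^ n = (\<Sum>i\<le>n. d i * a ^ (n - i))"
      unfolding d(2) sum_distrib_right
      using a0 by (intro sum.cong) (auto simp: a_def[symmetric] power_divide power_diff)
    moreover have "\<dots> \<in> V" using d VD aV by (auto intro!: subalgebra_sum[OF V] VD(3) subalgebra_power[OF V])
    moreover obtain c where c: "c \<in> V" "a ^ n = 1 - c / r" using pow by blast
    ultimately have "r - c \<in> V" using nonzero by (simp add: right_diff_distrib)
    then have "r - c + c \<in> V" using c VD(2) by blast
    then show False using not_in by simp
  qed
qed

text \<open>
  Dividing the relation for \<open>1 / y\<close> by \<open>r\<close> and by the unit \<open>1 - c\<^sub>0 / r\<close> expresses \<open>1\<close> by positive powers of
  \<open>1 / y\<close>. Hence \<open>y\<^sup>n\<close> is a combination of lower powers of \<open>y\<close>, and can be eliminated from the relation for \<open>y\<close>.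
\<close>

lemma reduce_powers:
  assumes y: "y \<noteq> 0" and b: "\<And>i. b i \<in> V" "r = (\<Sum>i\<le>n. b i * y ^ i)"
    and c: "\<And>i. c i \<in> V" "r = (\<Sum>i\<le>m. c i * (1 / y) ^ i)" and mn: "m \<le> n"
  shows "\<exists>b'. (\<forall>i. b' i \<in> V) \<and> r = (\<Sum>i<n. b' i * y ^ i)"
proof -
  define c' where "c' i = (if i \<le> m then c i else 0)" for i
  have c'V: "c' i \<in> V" for i using c VD(4) by (simp add: c'_def)
  have "r = (\<Sum>i\<le>n. c' i * (1 / y) ^ i)"
    unfolding c(2) using mn by (intro sum.mono_neutral_cong_left) (auto simp: c'_def)
  then have rc: "r = c' 0 + (\<Sum>i<n. c' (Suc i) * (1 / y) ^ Suc i)"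
    by (simp add: lessThan_Suc_atMost[symmetric] sum.lessThan_Suc_shift del: sum.lessThan_Suc)
  define e where "e = 1 - c' 0 / r"
  note e = jacobson[OF c'V[of 0], folded e_def]
  define g where "g i = (1 / e) * ((1 / r) * c' i)" for i
  have gV: "g i \<in> V" for i unfolding g_def by (intro VD(3) e inv_in c'V)
  have "e * r = (\<Sum>i<n. c' (Suc i) * (1 / y) ^ Suc i)" using rc nonzero by (simp add: e_def left_diff_distrib)
  also have "\<dots> = e * r * (\<Sum>i<n. g (Suc i) * (1 / y) ^ Suc i)"
    using e nonzero by (simp add: g_def sum_distrib_left field_simps)
  finally have "1 = (\<Sum>i<n. g (Suc i) * (1 / y) ^ Suc i)" using e nonzero by simp
  then have "y ^ n = y ^ n * (\<Sum>i<n. g (Suc i) * (1 / y) ^ Suc i)" by simp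
  also have "\<dots> = (\<Sum>i<n. g (Suc i) * y ^ (n - Suc i))"
    unfolding sum_distrib_left
  proof (rule sum.cong)
    fix i assume "i \<in> {..<n}"
    then have "y ^ (n - Suc i) = y ^ n / y ^ Suc i" using y by (intro power_diff) auto
    then show "y ^ n * (g (Suc i) * (1 / y) ^ Suc i) = g (Suc i) * y ^ (n - Suc i)"
      by (simp add: power_divide del: power_Suc)
  qed simp
  also have "\<dots> = (\<Sum>i<n. (\<lambda>i. g (n - i) * y ^ i) (n - Suc i))"
    by (intro sum.cong) (auto simp: Suc_diff_Suc)
  also have "\<dots> = (\<Sum>i<n. g (n - i) * y ^ i)" by (rule sum.nat_diff_reindex)
  finally have yn: "y ^ n = (\<Sum>i<n. g (n - i) * y ^ i)" .
  have "r = (\<Sum>i<n. b i * y ^ i) + b n * y ^ n"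
    by (subst b(2)) (simp add: lessThan_Suc_atMost[symmetric])
  also have "\<dots> = (\<Sum>i<n. (b i + b n * g (n - i)) * y ^ i)"
    unfolding yn by (simp add: sum_distrib_left sum.distrib distrib_right mult.assoc)
  finally show ?thesis using b gV VD by (intro exI[of _ "\<lambda>i. b i + b n * g (n - i)"]) auto
qed

text \<open>
  If neither \<open>y\<close> nor \<open>1 / y\<close> belonged to \<open>V\<close>, then \<open>r\<close> would be a polynomial in each of them; of two such
  expressions of least degree, the one of larger degree could be shortened.
\<close>

lemma valuation_ring:
  assumes y: "y \<noteq> 0"
  shows "y \<in> V \<or> 1 / y \<in> V"
proof (rule ccontr)
  assume no: "\<not> ?thesis"
  define rep where "rep y n \<longleftrightarrow> (\<exists>b. (\<forall>i. b i \<in> V) \<and> r = (\<Sum>i\<le>n. b i * y ^ i))" for y n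
  define L where "L y = (LEAST n. rep y n)" for y
  have ex: "rep y (L y)" if "y \<notin> V" for y
    unfolding L_def by (rule LeastI_ex) (use r_in_adjoin[OF that] in \<open>auto simp: rep_def\<close>)
  have False if yz: "y \<noteq> 0" "y \<notin> V" "1 / y \<notin> V" and le: "L (1 / y) \<le> L y" for y
  proof -
    obtain b where b: "\<And>i. b i \<in> V" "r = (\<Sum>i\<le>L y. b i * y ^ i)" using ex[OF yz(2)] unfolding rep_def by blast
    obtain c where c: "\<And>i. c i \<in> V" "r = (\<Sum>i\<le>L (1 / y). c i * (1 / y) ^ i)"
      using ex[OF yz(3)] unfolding rep_def by blast
    obtain b' where b': "\<And>i. b' i \<in> V" "r = (\<Sum>i<L y. b' i * y ^ i)"
      using reduce_powers[OF yz(1) b c le] by blast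
    show False
    proof (cases "L y")
      case 0
      then show False using b not_in by simp
    next
      case (Suc n)
      then have "rep y n" using b' by (auto simp: rep_def lessThan_Suc_atMost)
      then have "L y \<le> n" unfolding L_def by (rule Least_le)
      then show False using Suc by simp
    qed
  qed
  from this[of y] this[of "1 / y"] y no show False by (cases "L (1 / y) \<le> L y") auto
qed

definition nonunits :: "'b set" where
  "nonunits = {y \<in> V. y = 0 \<or> 1 / y \<notin> V}"

lemma nonunits_mult:
  assumes "v \<in> V" "y \<in> nonunits"
  shows "v * y \<in> nonunits"
proof (cases "v * y = 0")
  case False
  have "1 / (v * y) \<notin> V"
  proof
    assume "1 / (v * y) \<in> V"
    then have "v * (1 / (v * y)) \<in> V" using assms VD by blast
    then show False using False assms by (auto simp: nonunits_def)
  qed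
  then show ?thesis using assms VD by (auto simp: nonunits_def)
next
  case True
  show ?thesis unfolding True using VD(4) by (simp add: nonunits_def)
qed

lemma nonunits_ideal: "ideal_of V nonunits"
proof -
  have "y + z \<in> nonunits" if yz: "y \<in> nonunits" "z \<in> nonunits" for y z
  proof (cases "y = 0 \<or> z = 0")
    case False
    have *: "y + z \<in> nonunits" if "y / z \<in> V" "z \<in> nonunits" "z \<noteq> 0" for y z
      using nonunits_mult[OF VD(2)[OF VD(5) that(1)] that(2)] that(3) by (simp add: distrib_right add.commute)
    from False have "y / z \<in> V \<or> z / y \<in> V" using valuation_ring[of "y / z"] by simp
    then show ?thesis using *[of y z] *[of z y] yz False by (auto simp: add.commute)
  qed (use yz in auto)
  then show ?thesis using nonunits_mult VD(4) by (auto simp: ideal_of_def nonunits_def)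
qed

lemma nonunits_prime:
  assumes "y \<in> V" "z \<in> V" "y * z \<in> nonunits"
  shows "y \<in> nonunits \<or> z \<in> nonunits"
proof (rule ccontr)
  assume "\<not> ?thesis"
  then have yz: "y \<noteq> 0" "z \<noteq> 0" "1 / y \<in> V" "1 / z \<in> V" using assms by (auto simp: nonunits_def)
  then have "1 / y * (1 / z) \<in> V" using VD by blast
  then show False using assms(3) yz by (simp add: nonunits_def)
qed

lemma const_not_nonunit: "c \<noteq> 0 \<Longrightarrow> \<iota> c \<notin> nonunits"
  using VD(1)[of "1 / c"] by (auto simp: nonunits_def hom_distribs)

lemma inv_nonunit: "1 / r \<in> nonunits"
  using inv_in not_in by (simp add: nonunits_def)

text \<open>
  In transcendence degree one the residue field of the place is \<open>k\<close>: some non-zero polynomial over \<open>k\<close> takes at \<open>z\<close>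
  a multiple of the non-unit \<open>1 / r\<close>.
\<close>

lemma residue:
  assumes dim: "one_dimensional \<iota>" and z: "z \<in> V"
    and closed: "\<And>p :: 'k poly. degree p > 0 \<Longrightarrow> \<exists>c. poly p c = 0"
  shows "\<exists>c. z - \<iota> c \<in> nonunits"
proof -
  have "1 / r \<noteq> 0" using nonzero by simp
  from one_dimensional.ex_poly_value_dvd[OF dim this, of z]
  obtain B w where B: "B \<noteq> 0" "w \<in> V" "poly (map_poly \<iota> B) z = 1 / r * w"
    using V inv_in z by blast
  have "poly (map_poly \<iota> B) z \<in> nonunits"
    using nonunits_mult[OF B(2) inv_nonunit] B(3) by (simp add: mult.commute)
  with root_cong_prime_ideal[OF closed V nonunits_prime const_not_nonunit B(1) z] show ?thesis by blast
qed

lemma ex_dominating: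
  assumes "finite S" "S \<noteq> {}" "0 \<notin> S"
  shows "\<exists>a\<in>S. \<forall>b\<in>S. b / a \<in> V"
  using assms
proof (induction S rule: finite_ne_induct)
  case (singleton a)
  then show ?case using VD(5) by simp
next
  case (insert c S)
  then obtain a where a: "a \<in> S" "\<And>b. b \<in> S \<Longrightarrow> b / a \<in> V" by auto
  have ac: "a \<noteq> 0" "c \<noteq> 0" using a insert by auto
  consider "c / a \<in> V" | "a / c \<in> V" using valuation_ring[of "c / a"] ac by auto
  then show ?case
  proof cases
    case 1
    then show ?thesis using a by auto
  next
    case 2
    have "b / c \<in> V" if "b \<in> S" for b
      using VD(3)[OF a(2)[OF that] 2] ac by simp
    then show ?thesis using VD(5) ac by auto
  qed
qed

end

lemma (in one_dimensional) ex_maximal_avoiding: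
  fixes r :: 'b
  assumes closed: "\<And>p :: 'k poly. degree p > 0 \<Longrightarrow> \<exists>c. poly p c = 0" and r: "r \<notin> range \<iota>"
  shows "\<exists>V. maximal_avoiding \<iota> r V"
proof -
  have r0: "r \<noteq> 0" using r by (metis hom_zero rangeI)
  define w where "w = 1 / r"
  define A where "A = {V. subalgebra V \<and> w \<in> V \<and> r \<notin> V}"
  define B0 where "B0 = range (\<lambda>p. poly (map_poly \<iota> p) w)"
  have "B0 \<in> A"
    unfolding A_def
  proof (intro CollectI conjI)
    show "subalgebra B0"
      unfolding subalgebra_def B0_def
    proof (intro conjI subsetI ballI)
      fix y assume "y \<in> range \<iota>"
      then obtain c where "y = poly (map_poly \<iota> [:c:]) w" by (auto simp: poly_map_poly_pCons)
      then show "y \<in> range (\<lambda>p. poly (map_poly \<iota> p) w)" by blast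
    next
      fix y z assume "y \<in> range (\<lambda>p. poly (map_poly \<iota> p) w)" "z \<in> range (\<lambda>p. poly (map_poly \<iota> p) w)"
      then obtain p q where "y = poly (map_poly \<iota> p) w" "z = poly (map_poly \<iota> q) w" by blast
      then have "y + z = poly (map_poly \<iota> (p + q)) w" "y * z = poly (map_poly \<iota> (p * q)) w"
        by (simp_all add: poly_map_poly_add poly_map_poly_mult)
      then show "y + z \<in> range (\<lambda>p. poly (map_poly \<iota> p) w)" "y * z \<in> range (\<lambda>p. poly (map_poly \<iota> p) w)"
        by blast+
    qed
    show "w \<in> B0" unfolding B0_def by (rule image_eqI[of _ _ "[:0, 1:]"]) (simp_all add: poly_map_poly_pCons)
    show "r \<notin> B0"
    proof
      assume "r \<in> B0"
      then obtain p where p: "r = poly (map_poly \<iota> p) w" by (auto simp: B0_def)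
      have "poly (map_poly \<iota> (pCons (-1) p)) w = 0"
        using p r0 by (simp add: poly_map_poly_pCons w_def hom_distribs)
      moreover have "pCons (-1) p \<noteq> 0" by simp
      ultimately have "\<exists>c. w - \<iota> c \<in> {0}"
        by (intro root_cong_prime_ideal[OF closed, of UNIV]) (auto simp: subalgebra_def)
      then obtain c where "w = \<iota> c" by auto
      have "r = 1 / w" by (simp add: w_def)
      also have "\<dots> = \<iota> (1 / c)" using \<open>w = \<iota> c\<close> by (simp add: hom_distribs)
      finally have "r = \<iota> (1 / c)" .
      then show False using r by blast
    qed
  qed
  moreover have "\<Union>\<C> \<in> A" if ch: "\<C> \<noteq> {}" "subset.chain A \<C>" for \<C>
  proof -
    have cA: "\<And>V. V \<in> \<C> \<Longrightarrow> V \<in> A" using ch(2) by (auto simp: subset.chain_def)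
    have tot: "\<And>V W. V \<in> \<C> \<Longrightarrow> W \<in> \<C> \<Longrightarrow> V \<subseteq> W \<or> W \<subseteq> V"
      using ch(2) by (auto simp: subset_chain_def)
    have "subalgebra (\<Union>\<C>)"
      unfolding subalgebra_def
    proof (intro conjI ballI)
      obtain V where "V \<in> \<C>" using ch(1) by blast
      then have "range \<iota> \<subseteq> V" using cA by (auto simp: A_def subalgebra_def)
      then show "range \<iota> \<subseteq> \<Union>\<C>" using \<open>V \<in> \<C>\<close> by blast
      fix y z assume "y \<in> \<Union>\<C>" "z \<in> \<Union>\<C>"
      then obtain V1 V2 where V12: "V1 \<in> \<C>" "y \<in> V1" "V2 \<in> \<C>" "z \<in> V2" by blast
      obtain V where V: "V \<in> \<C>" "y \<in> V" "z \<in> V" using tot[OF V12(1,3)] V12 by blast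
      then have "subalgebra V" using cA by (auto simp: A_def)
      then show "y + z \<in> \<Union>\<C>" "y * z \<in> \<Union>\<C>" using V subalgebraD(2,3)[of V y z] by blast+
    qed
    moreover have "w \<in> \<Union>\<C>" using ch(1) cA by (auto simp: A_def)
    moreover have "r \<notin> \<Union>\<C>" using cA by (auto simp: A_def)
    ultimately show ?thesis by (simp add: A_def)
  qed
  ultimately obtain V where V: "V \<in> A" "\<And>W. W \<in> A \<Longrightarrow> V \<subseteq> W \<Longrightarrow> W = V"
    using subset_Zorn_nonempty[of A] by (metis empty_iff)
  have "maximal_avoiding \<iota> r V"
  proof (intro maximal_avoiding.intro maximal_avoiding_axioms.intro)
    show "constant_field \<iota>" ..
    show "subalgebra V" "1 / r \<in> V" "r \<notin> V" using V(1) by (auto simp: A_def w_def)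
    show "W = V" if "subalgebra W" "V \<subseteq> W" "r \<notin> W" for W
      using that V by (auto simp: A_def)
  qed fact
  then show ?thesis ..
qed

context smooth_curve
begin

text \<open>
  This is where projectivity enters. A non-constant \<open>r\<close> lies outside some valuation ring \<open>V\<close>. Divide the
  homogeneous coordinates of the generic point by the dominating one; the residues of the quotients are the
  coordinates of a point \<open>P\<close>, the centre of \<open>V\<close>. Equations of the curve reduce to equations at \<open>P\<close>, so \<open>P\<close>
  lies on the curve, and a function regular at \<open>P\<close> lies in \<open>V\<close>.
\<close>

lemma constant_if_regular_everywhere:
  assumes r: "\<And>P. P \<in> C \<Longrightarrow> r \<in> regular P"
  shows "r \<in> range \<iota>"
proof (rule ccontr)
  assume nc: "r \<notin> range \<iota>"
  note closedk = alg_closed_imp_poly_has_root[where 'a = 'k]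
  obtain V where "maximal_avoiding \<iota> r V" using ex_maximal_avoiding[OF closedk nc] by blast
  then interpret mx: maximal_avoiding \<iota> r V .
  note I = mx.nonunits_ideal
  define S where "S = {x i | i. i \<le> N \<and> x i \<noteq> 0}"
  obtain P0 where P0: "P0 \<in> C" using nonempty by blast
  have "x (chart P0) \<in> S"
    using form_quotient_regular(3)[OF P0 form_values_const] chart_le[OF in_proj_space[OF P0]] by (auto simp: S_def)
  moreover have "finite S" unfolding S_def by auto
  moreover have "0 \<notin> S" by (auto simp: S_def)
  ultimately obtain a where a: "a \<in> S" "\<And>b. b \<in> S \<Longrightarrow> b / a \<in> V"
    using mx.ex_dominating[of S] by blast
  then obtain j where j: "j \<le> N" "a = x j" "a \<noteq> 0" by (auto simp: S_def)
  have yV: "x i / a \<in> V" if "i \<le> N" for i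
    using a(2)[of "x i"] that mx.VD(4) by (cases "x i = 0") (auto simp: S_def)
  have "\<exists>c. x i / a - \<iota> c \<in> mx.nonunits" if "i \<le> N" for i
    using mx.residue[OF _ yV[OF that] closedk] one_dimensional_axioms by blast
  then obtain c where c: "\<And>i. i \<le> N \<Longrightarrow> x i / a - \<iota> (c i) \<in> mx.nonunits" by metis
  define v where "v i = (if i \<le> N then c i else 0)" for i
  have v: "x i / a - \<iota> (v i) \<in> mx.nonunits" if "i \<le> N" for i using c that by (simp add: v_def)
  have "v j \<noteq> 0"
  proof
    assume "v j = 0"
    then have "\<iota> 1 \<in> mx.nonunits" using v[OF j(1)] j by simp
    then show False using mx.const_not_nonunit[of 1] by simp
  qed
  moreover have "v i = 0" if "i > N" for i using that by (simp add: v_def)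
  ultimately have v_cv: "v \<in> coord_vectors N" unfolding coord_vectors_def by blast
  have scale: "eval_mpoly \<iota> (\<lambda>i. x i / a) F = eval_mpoly \<iota> x F / a ^ d" if "form N d F" for d F
    using eval_mpoly_homogeneous[OF that, of "1 / a" x] by (simp add: power_divide)
  have cong: "eval_mpoly \<iota> x F / a ^ d - \<iota> (eval_mpoly id v F) \<in> mx.nonunits" if "form N d F" for d F
    unfolding scale[OF that, symmetric] by (rule ideal_eval_cong[OF mx.V I that yV v])
  have form_V: "eval_mpoly \<iota> x F / a ^ d \<in> V" if "form N d F" for d F
    using mx.VD(2)[OF ideal_ofD(1)[OF I cong[OF that]] mx.VD(1)[of "eval_mpoly id v F"]] by simp
  define P where "P = {w. \<exists>c. c \<noteq> 0 \<and> w = (\<lambda>i. c * v i)}"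
  have van: "vanishes_at F P \<longleftrightarrow> eval_mpoly id v F = 0" if "form N d F" for d F
  proof
    have "v \<in> P" by (auto simp: P_def intro!: exI[of _ 1])
    then show "vanishes_at F P \<Longrightarrow> eval_mpoly id v F = 0" by (simp add: vanishes_at_def)
    show "eval_mpoly id v F = 0 \<Longrightarrow> vanishes_at F P"
      by (auto simp: vanishes_at_def P_def field_hom.eval_mpoly_homogeneous[OF field_hom_id that])
  qed
  obtain T where S: "\<And>F. F \<in> T \<Longrightarrow> \<exists>d. form N d F" "C = zero_set N T"
    using closed by (auto simp: zariski_closed_def)
  have "vanishes_at F P" if FT: "F \<in> T" for F
  proof -
    obtain d where d: "form N d F" using S(1)[OF FT] by blast
    have "eval_mpoly \<iota> x F = 0 \<longleftrightarrow> (\<forall>P\<in>C. vanishes_at F P)"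
      using function_field d by (simp add: function_field_def)
    then have "eval_mpoly \<iota> x F = 0" using FT unfolding S(2) zero_set_def by simp
    with cong[OF d] have "\<iota> (- eval_mpoly id v F) \<in> mx.nonunits" by (simp add: hom_distribs)
    then have "eval_mpoly id v F = 0" using mx.const_not_nonunit[of "- eval_mpoly id v F"] by auto
    then show ?thesis using van[OF d] by simp
  qed
  then have "P \<in> C" unfolding S(2) zero_set_def using proj_spaceI[OF v_cv] by (simp add: P_def)
  from r[OF this] obtain d F G where FG: "form N d F" "form N d G" "\<not> vanishes_at G P"
    "r = eval_mpoly \<iota> x F / eval_mpoly \<iota> x G"
    by (auto simp: local_ring_def)
  define g where "g = eval_mpoly \<iota> x G / a ^ d"
  have "g \<notin> mx.nonunits"
  proof
    assume "g \<in> mx.nonunits"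
    moreover have "g - \<iota> (eval_mpoly id v G) \<in> mx.nonunits" using cong[OF FG(2)] by (simp add: g_def)
    ultimately have "g - (g - \<iota> (eval_mpoly id v G)) \<in> mx.nonunits" by (rule ideal_of_diff[OF mx.V I])
    then show False using mx.const_not_nonunit[of "eval_mpoly id v G"] van[OF FG(2)] FG(3) by simp
  qed
  then have "1 / g \<in> V" using form_V[OF FG(2)] by (auto simp: mx.nonunits_def g_def)
  then have "eval_mpoly \<iota> x F / a ^ d * (1 / g) \<in> V" using form_V[OF FG(1)] mx.VD(3) by blast
  also have "eval_mpoly \<iota> x F / a ^ d * (1 / g) = r" using j(3) by (simp add: FG(4) g_def)
  finally show False using mx.not_in by simp
qed

text \<open>
  For each ratio \<open>x\<^sub>i / x\<^sub>j\<close> there is a non-zero polynomial whose value at the ratio is divisible by \<open>y\<close>.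
  At a zero of \<open>y\<close> in the \<open>j\<close>-th chart the affine coordinates are therefore roots of fixed polynomials.
\<close>

lemma finite_zeros:
  assumes y: "y \<noteq> 0"
  shows "finite {P \<in> C. 0 < ord P y}"
proof -
  have "\<exists>B. B \<noteq> 0 \<and> (\<forall>R. subalgebra R \<longrightarrow> y \<in> R \<longrightarrow> z \<in> R \<longrightarrow> (\<exists>w\<in>R. poly (map_poly \<iota> B) z = y * w))" for z
    by (rule ex_poly_value_dvd[OF y])
  then obtain B where B: "\<And>z. B z \<noteq> 0"
    "\<And>z R. subalgebra R \<Longrightarrow> y \<in> R \<Longrightarrow> z \<in> R \<Longrightarrow> \<exists>w\<in>R. poly (map_poly \<iota> (B z)) z = y * w"
    by metis
  define ratio where "ratio P i = coords P i / coords P (chart P)" for P :: "'k point" and i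
  define T where "T = (SIGMA j:{..N}. PiE {..N} (\<lambda>i. {c. poly (B (x i / x j)) c = 0}))"
  have "finite T"
    unfolding T_def by (intro finite_SigmaI finite_PiE ballI poly_roots_finite B) auto
  moreover have "(\<lambda>P. (chart P, restrict (ratio P) {..N})) ` {P \<in> C. 0 < ord P y} \<subseteq> T"
  proof (rule image_subsetI)
    fix P assume "P \<in> {P \<in> C. 0 < ord P y}"
    then have P: "P \<in> C" and "0 < ord P y" by auto
    then have yv: "y \<in> vanishing P" using vanishing_iff_ord(2)[OF P y] by simp
    note R = regular_subalgebra[OF P] and I = vanishing_ideal[OF P]
    note PP = in_proj_space[OF P]
    have "poly (B (x i / x (chart P))) (ratio P i) = 0" if i: "i \<le> N" for i
    proof -
      define z where "z = x i / x (chart P)"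
      have X: "(x i, coords P i) \<in> form_values P 1" "(x (chart P), coords P (chart P)) \<in> form_values P 1"
        using form_values_var i chart_le[OF PP] by auto
      have "(x i - \<iota> (ratio P i) * x (chart P), coords P i - ratio P i * coords P (chart P)) \<in> form_values P 1"
        by (intro form_values_diff form_values_scale X)
      moreover have "coords P i - ratio P i * coords P (chart P) = 0"
        using chart_nonzero[OF PP] by (simp add: ratio_def)
      ultimately have "(x i - \<iota> (ratio P i) * x (chart P)) / x (chart P) ^ 1 \<in> vanishing P"
        using form_quotient_regular(2)[OF P] by blast
      then have zc: "z - \<iota> (ratio P i) \<in> vanishing P"
        using form_quotient_regular(3)[OF P X(1)] by (simp add: z_def diff_divide_distrib)
      have zR: "z \<in> regular P" using form_quotient_regular(1)[OF P X(1)] by (simp add: z_def)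
      obtain w where "w \<in> regular P" "poly (map_poly \<iota> (B z)) z = y * w"
        using B(2)[OF R _ zR] yv vanishing_subset_regular[OF P] by blast
      then have "poly (map_poly \<iota> (B z)) z \<in> vanishing P"
        using vanishing_mult[OF P _ yv] by (simp add: mult.commute)
      moreover have "poly (map_poly \<iota> (B z)) z - \<iota> (poly (B z) (ratio P i)) \<in> vanishing P"
        by (rule ideal_poly_cong[OF R I zR zc])
      ultimately have "\<iota> (poly (B z) (ratio P i)) \<in> vanishing P"
        using ideal_of_diff[OF R I] by fastforce
      then show ?thesis using unit_at_const[OF P, of "poly (B z) (ratio P i)"] unfolding z_def unit_at_def by blast
    qed
    then show "(chart P, restrict (ratio P) {..N}) \<in> T"
      using chart_le[OF PP] by (auto simp: T_def)
  qed
  moreover have "inj_on (\<lambda>P. (chart P, restrict (ratio P) {..N})) {P \<in> C. 0 < ord P y}"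
  proof (rule inj_onI)
    fix P Q assume "P \<in> {P \<in> C. 0 < ord P y}" "Q \<in> {P \<in> C. 0 < ord P y}"
      and eq: "(chart P, restrict (ratio P) {..N}) = (chart Q, restrict (ratio Q) {..N})"
    then have PQ: "P \<in> proj_space N" "Q \<in> proj_space N" using in_proj_space by auto
    note ne = chart_nonzero[OF PQ(1)] chart_nonzero[OF PQ(2)]
    have r: "ratio P i = ratio Q i" if "i \<le> N" for i using eq that by (metis atMost_iff prod.inject restrict_apply')
    have eq: "coords P i = coords P (chart P) / coords Q (chart Q) * coords Q i" for i
    proof (cases "i \<le> N")
      case True
      from r[OF True] show ?thesis using ne by (simp add: ratio_def field_simps)
    next
      case False
      then show ?thesis
        using coords_coord_vector[OF PQ(1)] coords_coord_vector[OF PQ(2)] by (simp add: coord_vectors_def)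
    qed
    have "coords P (chart P) / coords Q (chart Q) \<noteq> 0" using ne by simp
    then show "P = Q" by (rule point_eqI[OF PQ]) (rule ext, rule eq)
  qed
  ultimately show ?thesis using inj_on_finite by blast
qed

lemma finite_ord_nonzero:
  assumes y: "y \<noteq> 0"
  shows "finite {P \<in> C. ord P y \<noteq> 0}"
proof -
  have "{P \<in> C. ord P y \<noteq> 0} \<subseteq> {P \<in> C. 0 < ord P y} \<union> {P \<in> C. 0 < ord P (1 / y)}"
    using ord_divide[of _ 1 y] ord_one y by auto
  then show ?thesis using finite_zeros[of y] finite_zeros[of "1 / y"] y
    by (meson finite_UnI finite_subset divide_eq_0_iff one_neq_zero)
qed

end

context smooth_curve
begin

section \<open>Spaces of functions with bounded poles\<close>

definition pole_bounded :: "('k point \<Rightarrow> nat) \<Rightarrow> 'b set" where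
  "pole_bounded D = {y. \<forall>P\<in>C. y \<in> ord_ge P (- int (D P))}"

text \<open>
  Lowering the permitted pole order at one point by one lowers the dimension by at most one, as
  functions of the same order at the point are congruent up to a constant factor. Functions without poles are constant.
\<close>

lemma pole_bounded_dimension:
  assumes "finite S" "S \<subseteq> C" "\<And>P. P \<in> C \<Longrightarrow> P \<notin> S \<Longrightarrow> D P = 0"
  shows "\<exists>T. finite T \<and> card T \<le> sum D S + 1 \<and> pole_bounded D \<subseteq> kvs.span T"
  using assms(3)
proof (induction "sum D S" arbitrary: D)
  case 0
  then have D0: "D P = 0" if "P \<in> C" for P using that assms(1) by (cases "P \<in> S") auto
  have "y \<in> kvs.span {1}" if "y \<in> pole_bounded D" for y
  proof -
    have "y \<in> regular P" if "P \<in> C" for P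
      using \<open>y \<in> pole_bounded D\<close> that D0[OF that] regular_eq_ord_ge[OF that] by (auto simp: pole_bounded_def)
    then obtain c where "y = \<iota> c" using constant_if_regular_everywhere by blast
    then show ?thesis using kvs.span_scale[OF kvs.span_base, of 1 "{1}" c] by simp
  qed
  then show ?case using 0 by (intro exI[of _ "{1}"]) auto
next
  case (Suc n)
  have "\<exists>P\<in>S. D P \<noteq> 0"
  proof (rule ccontr)
    assume "\<not> ?thesis"
    then have "sum D S = 0" by simp
    then show False using Suc by simp
  qed
  then obtain P0 where P0: "P0 \<in> S" "D P0 > 0" by blast
  then have P0C: "P0 \<in> C" using assms by blast
  define D' where "D' = D(P0 := D P0 - 1)"
  have "sum D' (S - {P0}) = sum D (S - {P0})" by (intro sum.cong) (auto simp: D'_def)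
  then have "sum D S = Suc (sum D' S)"
    using P0 assms(1) by (simp add: D'_def sum.remove[of S P0])
  then have "n = sum D' S" using Suc by simp
  moreover have "D' P = 0" if "P \<in> C" "P \<notin> S" for P
    using Suc.prems[OF that] P0(1) that(2) by (auto simp: D'_def)
  ultimately obtain T where T: "finite T" "card T \<le> sum D' S + 1" "pole_bounded D' \<subseteq> kvs.span T"
    using Suc.hyps(1)[of D'] by blast
  have step: "y \<in> pole_bounded D'" if "y \<in> pole_bounded D" "y \<in> ord_ge P0 (- int (D P0) + 1)" for y
    using that P0 by (auto simp: pole_bounded_def D'_def algebra_simps of_nat_diff)
  show ?case
  proof (cases "\<exists>y0\<in>pole_bounded D. y0 \<notin> ord_ge P0 (- int (D P0) + 1)")
    case False
    then have "pole_bounded D \<subseteq> kvs.span T" using step T by blast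
    then show ?thesis using T \<open>sum D S = _\<close> by (intro exI[of _ T]) auto
  next
    case True
    then obtain y0 where y0: "y0 \<in> pole_bounded D" "y0 \<notin> ord_ge P0 (- int (D P0) + 1)" by blast
    have "y0 \<in> ord_ge P0 (- int (D P0))" using y0 P0C by (auto simp: pole_bounded_def)
    then have o: "y0 \<noteq> 0" "ord P0 y0 = - int (D P0)" using y0(2) by (auto simp: ord_ge_def)
    have "y \<in> kvs.span (insert y0 T)" if y: "y \<in> pole_bounded D" for y
    proof -
      have "y \<in> ord_ge P0 (- int (D P0))" using y P0C by (auto simp: pole_bounded_def)
      from ord_ge_leading_term[OF P0C this o]
      obtain c where c: "y - \<iota> c * y0 \<in> ord_ge P0 (- int (D P0) + 1)" by blast
      have "y - \<iota> c * y0 \<in> pole_bounded D"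
        using y y0 by (auto simp: pole_bounded_def intro: ord_ge_diff ord_ge_scale)
      then have "y - \<iota> c * y0 \<in> kvs.span T" using step[OF _ c] T by blast
      then show ?thesis by (auto simp: kvs.span_breakdown_eq)
    qed
    moreover have "card (insert y0 T) \<le> sum D S + 1"
      using T \<open>sum D S = _\<close> by (simp add: card_insert_if)
    ultimately show ?thesis using T(1) by (intro exI[of _ "insert y0 T"]) auto
  qed
qed

section \<open>Forms and their zeros\<close>

definition forms :: "nat \<Rightarrow> 'b set" where
  "forms d = {eval_mpoly \<iota> x F | F. form N d F}"

text \<open>
  The order at \<open>P\<close> of a degree one form that does not vanish at \<open>P\<close>. Forms are elements of the function field
  only relative to the chosen coordinates of the generic point, so the order of vanishing at \<open>P\<close> of a form of degree \<open>d\<close> is the excess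
  of its order over \<open>d * twist P\<close>.
\<close>

definition twist :: "'k point \<Rightarrow> int" where
  "twist P = ord P (x (chart P))"

lemma formsE: "e \<in> forms d \<Longrightarrow> \<exists>\<alpha>. (e, \<alpha>) \<in> form_values P d"
  by (auto simp: forms_def form_values_def)

lemma form_values_forms: "(e, \<alpha>) \<in> form_values P d \<Longrightarrow> e \<in> forms d"
  by (auto simp: forms_def form_values_def)

lemma forms_mult: "e \<in> forms d \<Longrightarrow> g \<in> forms l \<Longrightarrow> e * g \<in> forms (d + l)"
  using form_values_mult formsE form_values_forms by metis

lemma forms_add: "e \<in> forms d \<Longrightarrow> g \<in> forms d \<Longrightarrow> e + g \<in> forms d"
  using form_values_add formsE form_values_forms by metis

lemma forms_scale: "e \<in> forms d \<Longrightarrow> \<iota> c * e \<in> forms d"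
  using form_values_scale formsE form_values_forms by metis

lemma forms_zero: "0 \<in> forms d"
  unfolding forms_def by (auto simp: form_def intro!: exI[of _ 0])

lemma forms_sum: "(\<And>i. i \<in> I \<Longrightarrow> g i \<in> forms d) \<Longrightarrow> sum g I \<in> forms d"
  by (induction I rule: infinite_finite_induct) (auto intro: forms_add forms_zero)

lemma forms_power: "e \<in> forms d \<Longrightarrow> e ^ n \<in> forms (n * d)"
  using form_values_power formsE form_values_forms by metis

lemma forms_var: "i \<le> N \<Longrightarrow> x i \<in> forms 1"
  using form_values_var form_values_forms by metis

lemma form_order:
  assumes P: "P \<in> C" and e: "(e, \<alpha>) \<in> form_values P d"
  shows "e \<in> ord_ge P (int d * twist P)" "\<alpha> = 0 \<Longrightarrow> e \<in> ord_ge P (1 + int d * twist P)"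
    "\<alpha> \<noteq> 0 \<Longrightarrow> e \<noteq> 0 \<and> ord P e = int d * twist P"
proof -
  note q = form_quotient_regular[OF P e]
  have x0: "x (chart P) ^ d \<noteq> 0" using q(3) by simp
  have o: "ord P (x (chart P) ^ d) = int d * twist P" using ord_power[OF P q(3)] by (simp add: twist_def)
  then have X: "x (chart P) ^ d \<in> ord_ge P (int d * twist P)" by (simp add: ord_ge_def)
  have eq: "e / x (chart P) ^ d * x (chart P) ^ d = e" using x0 by simp
  show "e \<in> ord_ge P (int d * twist P)"
    using ord_ge_mult[OF P q(1)[unfolded regular_eq_ord_ge[OF P]] X] by (simp only: eq add_0)
  show "e \<in> ord_ge P (1 + int d * twist P)" if "\<alpha> = 0"
  proof -
    have "e / x (chart P) ^ d \<in> ord_ge P 1" using q(2) that vanishing_eq_ord_ge[OF P] by simp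
    from ord_ge_mult[OF P this X] show ?thesis by (simp only: eq)
  qed
  show "e \<noteq> 0 \<and> ord P e = int d * twist P" if "\<alpha> \<noteq> 0"
  proof -
    have u: "e / x (chart P) ^ d \<in> unit_at P" using q that by (simp add: unit_at_def)
    have "e \<noteq> 0" by (rule form_values_nonzero[OF P e that])
    then show ?thesis using ord_unit[OF P u] ord_divide[OF P _ x0, of e] o by simp
  qed
qed

lemma forms_order: "P \<in> C \<Longrightarrow> e \<in> forms d \<Longrightarrow> e \<in> ord_ge P (int d * twist P)"
  using formsE form_order(1) by blast

lemma form_nonzero_at: "P \<in> C \<Longrightarrow> x (chart P) \<in> forms 1 \<and> x (chart P) \<noteq> 0"
  using forms_var chart_le[OF in_proj_space] form_quotient_regular(3)[OF _ form_values_const] by blast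

lemma finite_twist_nonzero: "finite {P \<in> C. twist P \<noteq> 0}"
proof -
  have "{P \<in> C. twist P \<noteq> 0} \<subseteq> (\<Union>i\<in>{i. i \<le> N \<and> x i \<noteq> 0}. {P \<in> C. ord P (x i) \<noteq> 0})"
    using form_nonzero_at chart_le[OF in_proj_space] by (auto simp: twist_def)
  moreover have "finite \<dots>" by (auto intro!: finite_ord_nonzero)
  ultimately show ?thesis by (rule finite_subset)
qed

definition form_zeros :: "nat \<Rightarrow> 'b \<Rightarrow> 'k point \<Rightarrow> nat" where
  "form_zeros d e P = nat (ord P e - int d * twist P)"

lemma int_form_zeros:
  "P \<in> C \<Longrightarrow> e \<in> forms d \<Longrightarrow> e \<noteq> 0 \<Longrightarrow> int (form_zeros d e P) = ord P e - int d * twist P"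
  using forms_order[of P e d] by (simp add: form_zeros_def ord_ge_def)

lemma finite_form_zeros:
  assumes "e \<noteq> 0"
  shows "finite {P \<in> C. form_zeros d e P \<noteq> 0}"
proof -
  have "{P \<in> C. form_zeros d e P \<noteq> 0} \<subseteq> {P \<in> C. ord P e \<noteq> 0} \<union> {P \<in> C. twist P \<noteq> 0}"
    by (auto simp: form_zeros_def)
  then show ?thesis using finite_ord_nonzero[OF assms] finite_twist_nonzero by (meson finite_UnI finite_subset)
qed

section \<open>Interpolation by forms\<close>

text \<open>
  Distinct points have non-proportional coordinate vectors; a suitable \<open>2 \<times> 2\<close> minor, with one row left
  variable, is linear, zero at \<open>Q\<close> and not at \<open>P\<close>.
\<close>

lemma ex_separating_form:
  assumes P: "P \<in> C" and Q: "Q \<in> C" and "P \<noteq> Q"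
  shows "\<exists>L\<in>forms 1. L \<noteq> 0 \<and> ord P L = twist P \<and> L \<in> ord_ge Q (1 + twist Q)"
proof -
  note PP = in_proj_space[OF P] in_proj_space[OF Q]
  let ?v = "coords P" and ?w = "coords Q" and ?j = "chart Q"
  note wj = chart_nonzero[OF PP(2)]
  have "\<exists>i. ?v i * ?w ?j \<noteq> ?v ?j * ?w i"
  proof (rule ccontr)
    assume "\<not> ?thesis"
    then have eq: "?v i = ?v ?j / ?w ?j * ?w i" for i using wj by (simp add: field_simps)
    have "?v ?j \<noteq> 0"
    proof
      assume "?v ?j = 0"
      with eq[of "chart P"] chart_nonzero[OF PP(1)] show False by simp
    qed
    then have "?v ?j / ?w ?j \<noteq> 0" using wj by simp
    then have "P = Q" by (rule point_eqI[OF PP]) (rule ext, rule eq)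
    then show False using assms by blast
  qed
  then obtain i where i: "?v i * ?w ?j \<noteq> ?v ?j * ?w i" by blast
  have iN: "i \<le> N"
  proof (rule ccontr)
    assume "\<not> i \<le> N"
    then have "?v i = 0" "?w i = 0"
      using coords_coord_vector[OF PP(1)] coords_coord_vector[OF PP(2)] by (auto simp: coord_vectors_def)
    then show False using i by simp
  qed
  define L where "L = \<iota> (?w ?j) * x i - \<iota> (?w i) * x ?j"
  have LP: "(L, ?w ?j * coords R i - ?w i * coords R ?j) \<in> form_values R 1" for R
    unfolding L_def by (intro form_values_diff form_values_scale form_values_var iN chart_le[OF PP(2)])
  have "?w ?j * ?v i - ?w i * ?v ?j \<noteq> 0" using i by (simp add: mult.commute)
  from form_order(3)[OF P LP this] have "L \<noteq> 0" "ord P L = twist P" by simp_all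
  moreover have "L \<in> ord_ge Q (1 + twist Q)"
    using form_order(2)[OF Q LP] by (simp add: mult.commute)
  ultimately show ?thesis using form_values_forms[OF LP] by blast
qed

text \<open>
  The numerator of a local parameter.
\<close>

lemma ex_form_of_order_one:
  assumes P: "P \<in> C"
  shows "\<exists>d. \<exists>A\<in>forms d. A \<noteq> 0 \<and> ord P A = 1 + int d * twist P"
proof -
  obtain s where s: "local_parameter N \<iota> x P s" using smooth P by blast
  have s0: "s \<noteq> 0" "s \<in> vanishing P" using local_parameterD[OF P s] by blast+
  then obtain d a b \<beta> where ab: "(a, 0) \<in> form_values P d" "(b, \<beta>) \<in> form_values P d" "\<beta> \<noteq> 0" "s = a / b"
    unfolding vanishing_iff[OF P] by blast
  have b: "b \<noteq> 0" "ord P b = int d * twist P" using form_order(3)[OF P ab(2,3)] by auto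
  have "a \<noteq> 0" using s0 ab by auto
  then have "ord P a = 1 + int d * twist P"
    using ord_divide[OF P \<open>a \<noteq> 0\<close> b(1)] ord_parameter[OF P s] ab(4) b(2) by simp
  then show ?thesis using \<open>a \<noteq> 0\<close> form_values_forms[OF ab(1)] by blast
qed

text \<open>
  Prescribed order \<open>a\<close> at \<open>P\<close> comes from a power of a form of order one; high orders at the other points
  come from powers of separating forms.
\<close>

lemma ex_interpolating_form:
  assumes P: "P \<in> C" and S: "finite S" "S \<subseteq> C" "P \<notin> S"
  shows "\<exists>d. \<exists>A\<in>forms d. A \<noteq> 0 \<and> ord P A = int a + int d * twist P \<and>
    (\<forall>Q\<in>S. A \<in> ord_ge Q (int (m Q) + int d * twist Q))"
  using S
proof (induction S rule: finite_induct)
  case empty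
  obtain d A where A: "A \<in> forms d" "A \<noteq> 0" "ord P A = 1 + int d * twist P"
    using ex_form_of_order_one[OF P] by blast
  then have "ord P (A ^ a) = int a + int (a * d) * twist P"
    using ord_power[OF P A(2)] by (simp add: algebra_simps)
  then show ?case using A forms_power[OF A(1), of a] by (intro exI[of _ "a * d"] bexI[of _ "A ^ a"]) auto
next
  case (insert Q S)
  then have Q: "Q \<in> C" "P \<noteq> Q" by auto
  obtain d A where A: "A \<in> forms d" "A \<noteq> 0" "ord P A = int a + int d * twist P"
    "\<And>Q. Q \<in> S \<Longrightarrow> A \<in> ord_ge Q (int (m Q) + int d * twist Q)"
    using insert by auto
  obtain L where L: "L \<in> forms 1" "L \<noteq> 0" "ord P L = twist P" "L \<in> ord_ge Q (1 + twist Q)"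
    using ex_separating_form[OF P Q] by blast
  let ?n = "m Q"
  have Ln: "L ^ ?n \<in> forms ?n" using forms_power[OF L(1), of ?n] by simp
  have "A * L ^ ?n \<in> forms (d + ?n)" by (intro forms_mult A Ln)
  moreover have "A * L ^ ?n \<noteq> 0" using A L by simp
  moreover have "ord P (A * L ^ ?n) = int a + int (d + ?n) * twist P"
    using ord_mult[OF P A(2), of "L ^ ?n"] ord_power[OF P L(2)] A(3) L(2,3) by (simp add: algebra_simps)
  moreover have "A * L ^ ?n \<in> ord_ge R (int (m R) + int (d + ?n) * twist R)" if R: "R \<in> insert Q S" for R
  proof (cases "R = Q")
    case True
    have "L ^ ?n \<in> ord_ge Q (int ?n * (1 + twist Q))"
      using L ord_power[OF Q(1) L(2), of ?n] by (auto simp: ord_ge_def intro: mult_left_mono)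
    from ord_ge_mult[OF Q(1) forms_order[OF Q(1) A(1)] this] show ?thesis
      by (simp add: True algebra_simps)
  next
    case False
    then have R: "R \<in> S" "R \<in> C" using that insert by auto
    from ord_ge_mult[OF R(2) A(4)[OF R(1)] forms_order[OF R(2) Ln]] show ?thesis
      by (simp add: algebra_simps)
  qed
  ultimately show ?case by blast
qed

text \<open>
  The degree is raised by a linear form that does not vanish at \<open>P\<close>.
\<close>

lemma eventually_ex_interpolating_form:
  assumes P: "P \<in> C" and S: "finite S" "S \<subseteq> C"
  shows "\<forall>\<^sub>F l in sequentially. \<exists>H\<in>forms l. H \<noteq> 0 \<and> ord P H = int a + int l * twist P \<and>
    (\<forall>Q\<in>S - {P}. H \<in> ord_ge Q (int (m Q) + int l * twist Q))"
proof -
  obtain d A where A: "A \<in> forms d" "A \<noteq> 0" "ord P A = int a + int d * twist P"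
    "\<And>Q. Q \<in> S - {P} \<Longrightarrow> A \<in> ord_ge Q (int (m Q) + int d * twist Q)"
    using ex_interpolating_form[OF P, of "S - {P}" a m] S by blast
  define g where "g = x (chart P)"
  have g: "g \<in> forms 1" "g \<noteq> 0" "ord P g = twist P"
    using form_nonzero_at[OF P] by (simp_all add: g_def twist_def)
  show ?thesis
  proof (rule eventually_sequentiallyI[of d])
    fix l assume l: "d \<le> l"
    have Xn: "g ^ (l - d) \<in> forms (l - d)" using forms_power[OF g(1), of "l - d"] by simp
    have "A * g ^ (l - d) \<in> forms (d + (l - d))" by (intro forms_mult A Xn)
    then have "A * g ^ (l - d) \<in> forms l" using l by simp
    moreover have "A * g ^ (l - d) \<noteq> 0" using A g by simp
    moreover have "ord P (A * g ^ (l - d)) = int a + int l * twist P"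
      using ord_mult[OF P A(2), of "g ^ (l - d)"] ord_power[OF P g(2)] A(3) g(2,3) l
      by (simp add: algebra_simps of_nat_diff)
    moreover have "A * g ^ (l - d) \<in> ord_ge Q (int (m Q) + int l * twist Q)" if Q: "Q \<in> S - {P}" for Q
    proof -
      have "Q \<in> C" using Q S by blast
      from ord_ge_mult[OF this A(4)[OF Q] forms_order[OF this Xn]] show ?thesis
        using l by (simp add: algebra_simps of_nat_diff)
    qed
    ultimately show "\<exists>H\<in>forms l. H \<noteq> 0 \<and> ord P H = int a + int l * twist P \<and>
      (\<forall>Q\<in>S - {P}. H \<in> ord_ge Q (int (m Q) + int l * twist Q))" by blast
  qed
qed

section \<open>The degree of a principal divisor\<close>

text \<open>
  At a point \<open>P\<close>, the terms that belong to other points vanish to order \<open>z P\<close>, and those that belong to \<open>P\<close>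
  have distinct orders below \<open>z P\<close>. So the first non-zero coefficient at \<open>P\<close> would determine the order of the sum.
\<close>

lemma leading_coefficients_zero:
  assumes S: "finite S" "S \<subseteq> C" and I: "I = (SIGMA P:S. {..<z P})"
    and H: "\<And>P a. (P, a) \<in> I \<Longrightarrow> H (P, a) \<noteq> 0 \<and> ord P (H (P, a)) = int a + k P \<and>
      (\<forall>Q\<in>S - {P}. H (P, a) \<in> ord_ge Q (int (z Q) + k Q))"
    and sum: "\<And>P. P \<in> S \<Longrightarrow> (\<Sum>i\<in>I. \<iota> (c i) * H i) \<in> ord_ge P (int (z P) + k P)"
    and i: "i \<in> I"
  shows "c i = 0"
proof (rule ccontr)
  assume ci: "c i \<noteq> 0"
  obtain P b where Pb: "i = (P, b)" "P \<in> S" "b < z P" using i I by auto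
  have P: "P \<in> C" using Pb S by blast
  define a where "a = (LEAST a. a < z P \<and> c (P, a) \<noteq> 0)"
  have a: "a < z P \<and> c (P, a) \<noteq> 0" unfolding a_def by (rule LeastI[of _ b]) (use Pb ci in simp)
  have less: "c (P, a') = 0" if "a' < a" for a'
    using not_less_Least[of a' "\<lambda>a. a < z P \<and> c (P, a) \<noteq> 0"] that a unfolding a_def by force
  have Pa: "(P, a) \<in> I" using a Pb I by auto
  have fin: "finite I" using I S by auto
  have "(\<Sum>i\<in>I - {(P, a)}. \<iota> (c i) * H i) \<in> ord_ge P (int a + 1 + k P)"
  proof (rule ord_ge_sum[OF P])
    fix j assume j: "j \<in> I - {(P, a)}"
    obtain Q a' where Q: "j = (Q, a')" by (cases j)
    show "\<iota> (c j) * H j \<in> ord_ge P (int a + 1 + k P)"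
    proof (cases "Q = P")
      case True
      show ?thesis
      proof (cases "a' < a")
        case True
        then show ?thesis using less Q \<open>Q = P\<close> by simp
      next
        case False
        then have "a < a'" using j Q \<open>Q = P\<close> by auto
        then show ?thesis
          using H[of P a'] j Q \<open>Q = P\<close> by (intro ord_ge_scale[OF P]) (auto simp: ord_ge_def)
      qed
    next
      case False
      then have "H j \<in> ord_ge P (int (z P) + k P)" using H[of Q a'] j Q Pb by auto
      then have "H j \<in> ord_ge P (int a + 1 + k P)" using a by (elim ord_ge_mono) auto
      then show ?thesis by (rule ord_ge_scale[OF P])
    qed
  qed
  moreover have "(\<Sum>i\<in>I. \<iota> (c i) * H i) \<in> ord_ge P (int a + 1 + k P)"
    using a by (intro ord_ge_mono[OF sum[OF Pb(2)]]) auto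
  ultimately have "(\<Sum>i\<in>I. \<iota> (c i) * H i) - (\<Sum>i\<in>I - {(P, a)}. \<iota> (c i) * H i) \<in> ord_ge P (int a + 1 + k P)"
    by (intro ord_ge_diff[OF P])
  then have "\<iota> (c (P, a)) * H (P, a) \<in> ord_ge P (int a + 1 + k P)"
    by (simp add: sum.remove[OF fin Pa])
  moreover have "ord P (\<iota> (c (P, a)) * H (P, a)) = int a + k P"
    using ord_mult[OF P, of "\<iota> (c (P, a))" "H (P, a)"] ord_const[OF P, of "c (P, a)"] H[OF Pa] a by simp
  ultimately show False using H[OF Pa] a by (simp add: ord_ge_def)
qed

text \<open>
  Let \<open>H l i\<close> be forms of degree \<open>l\<close> that interpolate at the zeros of \<open>F\<close>, indexed by pairs of a zero and an
  order below its multiplicity. They are independent modulo multiples of \<open>F\<close>, so the products of \<open>F\<^sup>j\<close> with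
  \<open>H (l + (J - 1 - j) d) i\<close>, for \<open>j < J\<close>, are independent forms of one degree \<open>l + (J - 1) d\<close>, and their number is
  \<open>J\<close> times that of the zeros of \<open>F\<close>. After division by \<open>G\<^sup>J\<^sup>-\<^sup>1\<close> and a fixed form \<open>M\<close> of degree \<open>l\<close> they have
  their poles bounded by \<open>J - 1\<close> times the zeros of \<open>G\<close> plus those of \<open>M\<close>. For large \<open>J\<close> the dimension bound gives the claim.
\<close>

lemma sum_form_zeros_le:
  assumes F: "F \<in> forms d" "F \<noteq> 0" and G: "G \<in> forms d" "G \<noteq> 0"
    and S: "finite S" "S \<subseteq> C" "\<And>P. P \<in> C \<Longrightarrow> P \<notin> S \<Longrightarrow> form_zeros d G P = 0 \<and> twist P = 0"
  shows "(\<Sum>P\<in>S. form_zeros d F P) \<le> (\<Sum>P\<in>S. form_zeros d G P)"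
proof -
  define z where "z = form_zeros d F"
  define zG where "zG = form_zeros d G"
  define I where "I = (SIGMA P:S. {..<z P})"
  have finI: "finite I" using S by (simp add: I_def)
  have cardI: "card I = sum z S" using S by (simp add: I_def)
  define good where "good l i H \<longleftrightarrow> H \<in> forms l \<and> H \<noteq> 0 \<and>
      ord (fst i) H = int (snd i) + int l * twist (fst i) \<and>
      (\<forall>Q\<in>S - {fst i}. H \<in> ord_ge Q (int (z Q) + int l * twist Q))" for l and i :: "'k point \<times> nat" and H
  have "\<forall>\<^sub>F l in sequentially. \<forall>i\<in>I. \<exists>H. good l i H"
  proof (intro eventually_ball_finite finI ballI)
    fix i assume "i \<in> I"
    then have "fst i \<in> C" using S by (auto simp: I_def)
    from eventually_ex_interpolating_form[OF this S(1,2), of "snd i" z]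
    show "\<forall>\<^sub>F l in sequentially. \<exists>H. good l i H"
      by (rule eventually_mono) (auto simp: good_def)
  qed
  then obtain l0 where l0: "\<And>l i. l0 \<le> l \<Longrightarrow> i \<in> I \<Longrightarrow> \<exists>H. good l i H"
    unfolding eventually_sequentially by blast
  define H where "H l i = (SOME H. good l i H)" for l i
  have "good l i (H l i)" if "l0 \<le> l" "i \<in> I" for l i
    unfolding H_def by (rule someI_ex[OF l0[OF that]])
  note H = this[unfolded good_def]
  define v where "v J j i = F ^ j * H (l0 + (J - 1 - j) * d) i" for J j i
  have v_forms: "v J j i \<in> forms (l0 + (J - 1) * d)" if "j < J" "i \<in> I" for J j i
  proof -
    have "v J j i \<in> forms (j * d + (l0 + (J - 1 - j) * d))"
      unfolding v_def using H that by (intro forms_mult forms_power F) auto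
    also have "j * d + (l0 + (J - 1 - j) * d) = l0 + (J - 1) * d"
      using that by (simp add: add_mult_distrib[symmetric] add.left_commute)
    finally show ?thesis .
  qed
  have indep: "\<forall>j<J. \<forall>i\<in>I. c j i = 0" if "(\<Sum>j<J. \<Sum>i\<in>I. \<iota> (c j i) * v J j i) = 0" for J c
    using that
  proof (induction J arbitrary: c)
    case (Suc J)
    define R where "R = (\<Sum>j<J. \<Sum>i\<in>I. \<iota> (c (Suc j) i) * v J j i)"
    let ?l = "l0 + J * d"
    have "v (Suc J) (Suc j) i = F * v J j i" for j i
      by (simp add: v_def mult.assoc)
    then have "(\<Sum>j<Suc J. \<Sum>i\<in>I. \<iota> (c j i) * v (Suc J) j i) = (\<Sum>i\<in>I. \<iota> (c 0 i) * H ?l i) + F * R"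
      unfolding R_def sum.lessThan_Suc_shift by (simp add: v_def[of _ 0] sum_distrib_left mult.left_commute)
    then have eq: "(\<Sum>i\<in>I. \<iota> (c 0 i) * H ?l i) = - (F * R)"
      using Suc.prems by (simp add: eq_neg_iff_add_eq_0)
    have c0: "c 0 i = 0" if "i \<in> I" for i
    proof (rule leading_coefficients_zero[OF S(1,2) I_def, where k = "\<lambda>P. int ?l * twist P" and H = "H ?l"])
      show "i \<in> I" by fact
      show "H ?l (P, a) \<noteq> 0 \<and> ord P (H ?l (P, a)) = int a + int ?l * twist P \<and>
        (\<forall>Q\<in>S - {P}. H ?l (P, a) \<in> ord_ge Q (int (z Q) + int ?l * twist Q))" if "(P, a) \<in> I" for P a
        using H[OF _ that, of ?l] by simp
      fix P assume "P \<in> S"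
      then have P: "P \<in> C" using S by blast
      have "F * R \<in> ord_ge P (int (z P) + int ?l * twist P)"
      proof (cases J)
        case 0
        then show ?thesis by (simp add: R_def)
      next
        case (Suc J')
        have "R \<in> forms (l0 + (J - 1) * d)"
          unfolding R_def by (intro forms_sum forms_scale v_forms) auto
        from ord_ge_mult[OF P ord_ge_ord[of F P] forms_order[OF P this]]
        have "F * R \<in> ord_ge P (ord P F + int (l0 + (J - 1) * d) * twist P)" .
        also have "ord P F + int (l0 + (J - 1) * d) * twist P = int (z P) + int ?l * twist P"
          using int_form_zeros[OF P F] by (simp add: z_def Suc algebra_simps)
        finally show ?thesis .
      qed
      then show "(\<Sum>i\<in>I. \<iota> (c 0 i) * H ?l i) \<in> ord_ge P (int (z P) + int ?l * twist P)"
        unfolding eq by (rule ord_ge_uminus[OF P])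
    qed
    then have "R = 0" using eq F(2) by simp
    from Suc.IH[OF this[unfolded R_def]] c0 show ?case
      by (auto simp: less_Suc_eq_0_disj)
  qed simp
  obtain P0 where P0: "P0 \<in> C" using nonempty by blast
  define M where "M = x (chart P0) ^ l0"
  have M: "M \<in> forms l0" "M \<noteq> 0"
    using form_nonzero_at[OF P0] forms_power[of "x (chart P0)" 1 l0] by (simp_all add: M_def)
  define zM where "zM = form_zeros l0 M"
  define S' where "S' = S \<union> {P \<in> C. zM P \<noteq> 0}"
  have S': "finite S'" "S' \<subseteq> C" using S finite_form_zeros[OF M(2)] by (auto simp: S'_def zM_def)
  have bound: "Suc J * sum z S \<le> J * sum zG S + sum zM S' + 1" for J
  proof -
    define D where "D P = J * zG P + zM P" for P
    have D0: "D P = 0" if "P \<in> C" "P \<notin> S'" for P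
      using that S(3)[of P] by (auto simp: D_def S'_def zG_def)
    obtain T where T: "finite T" "card T \<le> sum D S' + 1" "pole_bounded D \<subseteq> kvs.span T"
      using pole_bounded_dimension[OF S', of D] D0 by blast
    have "sum zG S' = sum zG S"
      using S S' by (intro sum.mono_neutral_right) (auto simp: S'_def zG_def)
    then have sumD: "sum D S' = J * sum zG S + sum zM S'"
      by (simp add: D_def sum.distrib sum_distrib_left[symmetric])
    define w where "w = (\<lambda>(j, i). v (Suc J) j i / (M * G ^ J))"
    have GM: "M * G ^ J \<in> forms (l0 + J * d)" "M * G ^ J \<noteq> 0"
      using M G by (auto intro!: forms_mult forms_power)
    have "w ji \<in> pole_bounded D" if ji: "ji \<in> {..<Suc J} \<times> I" for ji
    proof -
      obtain j i where e: "ji = (j, i)" "j < Suc J" "i \<in> I" using ji by auto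
      have vf: "v (Suc J) j i \<in> forms (l0 + J * d)" using v_forms[OF e(2,3)] by simp
      have "w ji \<in> ord_ge P (- int (D P))" if P: "P \<in> C" for P
      proof (cases "v (Suc J) j i = 0")
        case True
        then show ?thesis by (simp add: w_def e)
      next
        case False
        have "ord P (M * G ^ J) = ord P M + int J * ord P G"
          using ord_mult[OF P M(2), of "G ^ J"] ord_power[OF P G(2)] G by simp
        also have "\<dots> = int (D P) + int (l0 + J * d) * twist P"
        proof -
          have "ord P M = int (zM P) + int l0 * twist P" "ord P G = int (zG P) + int d * twist P"
            using int_form_zeros[OF P M] int_form_zeros[OF P G] by (simp_all add: zM_def zG_def)
          then show ?thesis by (simp add: D_def algebra_simps)
        qed
        finally have "ord P (w ji) = ord P (v (Suc J) j i) - int (l0 + J * d) * twist P - int (D P)"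
          using ord_divide[OF P False GM(2)] by (simp add: w_def e)
        moreover have "int (l0 + J * d) * twist P \<le> ord P (v (Suc J) j i)"
          using forms_order[OF P vf] False by (simp add: ord_ge_def)
        ultimately show ?thesis by (simp add: ord_ge_def)
      qed
      then show ?thesis by (simp add: pole_bounded_def)
    qed
    then have "w ` ({..<Suc J} \<times> I) \<subseteq> kvs.span T" using T(3) by blast
    show ?thesis
    proof (rule ccontr)
      assume "\<not> ?thesis"
      then have "card T < card ({..<Suc J} \<times> I)"
        using T(2) by (simp add: card_cartesian_product cardI sumD)
      from kvs.exists_linear_relation[OF _ T(1) \<open>w ` _ \<subseteq> _\<close> this] finI
      obtain c where c: "\<exists>ji\<in>{..<Suc J} \<times> I. c ji \<noteq> 0" "(\<Sum>ji\<in>{..<Suc J} \<times> I. \<iota> (c ji) * w ji) = 0"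
        by blast
      have "0 = (M * G ^ J) * (\<Sum>ji\<in>{..<Suc J} \<times> I. \<iota> (c ji) * w ji)" using c(2) by simp
      also have "\<dots> = (\<Sum>(j, i)\<in>{..<Suc J} \<times> I. \<iota> (c (j, i)) * v (Suc J) j i)"
        unfolding sum_distrib_left using GM(2) by (intro sum.cong) (auto simp: w_def)
      also have "\<dots> = (\<Sum>j<Suc J. \<Sum>i\<in>I. \<iota> (c (j, i)) * v (Suc J) j i)"
        by (rule sum.cartesian_product[symmetric])
      finally have "\<forall>j<Suc J. \<forall>i\<in>I. c (j, i) = 0" by (intro indep) simp
      then show False using c(1) by auto
    qed
  qed
  have "sum z S \<le> sum zG S"
  proof (rule ccontr)
    assume less: "\<not> sum z S \<le> sum zG S"
    \<comment> \<open>For this value of \<open>J\<close> the bound fails if \<open>F\<close> has more zeros than \<open>G\<close>.\<close>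
    define K where "K = sum zM S' + 1"
    have "Suc K * (sum zG S + 1) \<le> Suc K * sum z S"
      using less by (intro mult_le_mono2) simp
    also have "\<dots> \<le> K * sum zG S + K" using bound[of K] by (simp add: K_def)
    finally show False by simp
  qed
  then show ?thesis by (simp add: z_def zG_def)
qed

lemma principal_divisor_degree_le:
  assumes y: "y \<noteq> 0" and S: "finite S" "S \<subseteq> C" "{P \<in> C. ord P y \<noteq> 0} \<subseteq> S"
  shows "(\<Sum>P\<in>S. ord P y) \<le> 0"
proof -
  obtain d F' G' where FG': "form N d F'" "form N d G'" "eval_mpoly \<iota> x G' \<noteq> 0"
    "y = eval_mpoly \<iota> x F' / eval_mpoly \<iota> x G'"
    by (rule quotient_of_forms)
  define F G where "F = eval_mpoly \<iota> x F'" and "G = eval_mpoly \<iota> x G'"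
  have F: "F \<in> forms d" "F \<noteq> 0" and G: "G \<in> forms d" "G \<noteq> 0" and FG: "y = F / G"
    using FG' y by (auto simp: F_def G_def forms_def)
  define S' where "S' = S \<union> {P \<in> C. form_zeros d G P \<noteq> 0} \<union> {P \<in> C. twist P \<noteq> 0}"
  have S': "finite S'" "S' \<subseteq> C" using S finite_form_zeros[OF G(2)] finite_twist_nonzero by (auto simp: S'_def)
  have "(\<Sum>P\<in>S. ord P y) = (\<Sum>P\<in>S'. ord P y)"
    using S S' by (intro sum.mono_neutral_left) (auto simp: S'_def)
  also have "\<dots> = (\<Sum>P\<in>S'. int (form_zeros d F P) - int (form_zeros d G P))"
  proof (rule sum.cong)
    fix P assume "P \<in> S'"
    then have P: "P \<in> C" using S' by blast
    show "ord P y = int (form_zeros d F P) - int (form_zeros d G P)"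
      using int_form_zeros[OF P F] int_form_zeros[OF P G] ord_divide[OF P F(2) G(2)] by (simp add: FG)
  qed simp
  also have "\<dots> = int (\<Sum>P\<in>S'. form_zeros d F P) - int (\<Sum>P\<in>S'. form_zeros d G P)"
    by (simp add: sum_subtractf)
  also have "\<dots> \<le> 0"
  proof -
    have "(\<Sum>P\<in>S'. form_zeros d F P) \<le> (\<Sum>P\<in>S'. form_zeros d G P)"
      by (rule sum_form_zeros_le[OF F G S']) (simp add: S'_def)
    then have "int (\<Sum>P\<in>S'. form_zeros d F P) \<le> int (\<Sum>P\<in>S'. form_zeros d G P)" by (rule of_nat_mono)
    then show ?thesis by linarith
  qed
  finally show ?thesis .
qed

end

section \<open>Derivations of the function field\<close>

context constant_field
begin

definition derivation :: "('b \<Rightarrow> 'b) \<Rightarrow> bool" where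
  "derivation \<delta> \<longleftrightarrow> (\<forall>y z. \<delta> (y + z) = \<delta> y + \<delta> z) \<and> (\<forall>c y. \<delta> (\<iota> c * y) = \<iota> c * \<delta> y) \<and>
     (\<forall>y z. \<delta> (y * z) = \<delta> y * z + y * \<delta> z)"

context
  fixes \<delta> assumes der: "derivation \<delta>"
begin

lemma der_add: "\<delta> (y + z) = \<delta> y + \<delta> z"
  and der_scale: "\<delta> (\<iota> c * y) = \<iota> c * \<delta> y"
  and der_mult: "\<delta> (y * z) = \<delta> y * z + y * \<delta> z"
  using der unfolding derivation_def by blast+

lemma der_zero: "\<delta> 0 = 0"
  using der_add[of 0 0] by (metis add_0 add_cancel_right_right)

lemma der_one: "\<delta> 1 = 0"
  using der_mult[of 1 1] by (metis mult_1 mult_1_right add_cancel_right_right)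

lemma der_const: "\<delta> (\<iota> c) = 0"
  using der_scale[of c 1] der_one by simp

lemma der_uminus: "\<delta> (- y) = - \<delta> y"
  using der_add[of "- y" y] der_zero by (simp add: eq_neg_iff_add_eq_0)

lemma der_diff: "\<delta> (y - z) = \<delta> y - \<delta> z"
  using der_add[of y "- z"] der_uminus by simp

lemma der_sum: "\<delta> (sum g I) = (\<Sum>i\<in>I. \<delta> (g i))"
  by (induction I rule: infinite_finite_induct) (simp_all add: der_zero der_add)

lemma der_power: "\<delta> (y ^ Suc n) = of_nat (Suc n) * y ^ n * \<delta> y"
  by (induction n) (simp_all add: der_mult algebra_simps)

lemma der_inverse: "y \<noteq> 0 \<Longrightarrow> \<delta> (1 / y) = - (1 / y * (1 / y)) * \<delta> y"
  using der_mult[of y "1 / y"] der_one by (simp add: field_simps eq_neg_iff_add_eq_0)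

lemma der_divide_eq_0: "\<delta> y = 0 \<Longrightarrow> \<delta> z = 0 \<Longrightarrow> \<delta> (y / z) = 0"
  using der_mult[of y "1 / z"] der_inverse[of z] by (cases "z = 0") (simp_all add: der_zero)

end

lemma subalgebra_eval:
  assumes R: "subalgebra R" and F: "form N d F" and y: "\<And>i. i \<le> N \<Longrightarrow> y i \<in> R"
  shows "eval_mpoly \<iota> y F \<in> R"
proof -
  have "monomial_value y m \<in> R" if "m \<in> Poly_Mapping.keys F" for m
  proof -
    have "i \<le> N" if "i \<in> Poly_Mapping.keys m" for i
      using F \<open>m \<in> _\<close> that by (auto simp: form_def)
    then show ?thesis
      unfolding monomial_value_def by (intro subalgebra_prod[OF R] subalgebra_power[OF R] y)
  qed
  then show ?thesis
    unfolding eval_mpoly_altdef by (intro subalgebra_sum[OF R] subalgebraD(1,3)[OF R])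
qed

end

context smooth_curve
begin

text \<open>
  The local ring consists of quotients of polynomials in the finitely many affine coordinates, with
  denominators that are units; by the product and quotient rules a derivation cannot create worse poles than on the
  coordinates.
\<close>

lemma derivation_bounded_poles:
  assumes P: "P \<in> C" and der: "derivation \<delta>"
  shows "\<exists>M. \<forall>y\<in>regular P. \<delta> y \<in> ord_ge P M"
proof -
  define y where "y i = x i / x (chart P)" for i
  define M where "M = Min ((\<lambda>i. ord P (\<delta> (y i))) ` {..N})"
  have M: "\<delta> (y i) \<in> ord_ge P M" if "i \<le> N" for i
    using that unfolding M_def by (intro ord_ge_mono[OF ord_ge_ord] Min_le) auto
  note R = regular_subalgebra[OF P]
  define W where "W = {y \<in> regular P. \<delta> y \<in> ord_ge P M}"
  have mul: "a * b \<in> ord_ge P M" if "a \<in> regular P" "b \<in> ord_ge P M" for a b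
    using ord_ge_mult[OF P that(1)[unfolded regular_eq_ord_ge[OF P]] that(2)] by simp
  have W: "subalgebra W"
    unfolding subalgebra_def
  proof (intro conjI ballI subsetI)
    show "c \<in> W" if "c \<in> range \<iota>" for c
      using that subalgebraD(1)[OF R] by (auto simp: W_def der_const[OF der])
    fix a b assume "a \<in> W" "b \<in> W"
    then have ab: "a \<in> regular P" "b \<in> regular P" "\<delta> a \<in> ord_ge P M" "\<delta> b \<in> ord_ge P M"
      by (auto simp: W_def)
    show "a + b \<in> W" using ab subalgebraD(2)[OF R] by (auto simp: W_def der_add[OF der] intro: ord_ge_add[OF P])
    have "b * \<delta> a + a * \<delta> b \<in> ord_ge P M" by (intro ord_ge_add[OF P] mul ab)
    then show "a * b \<in> W" using ab subalgebraD(3)[OF R] by (auto simp: W_def der_mult[OF der] mult.commute)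
  qed
  have yW: "y i \<in> W" if "i \<le> N" for i
    using form_quotient_regular(1)[OF P form_values_var[OF that]] M[OF that] by (simp add: W_def y_def)
  have "\<delta> e \<in> ord_ge P M" if "e \<in> regular P" for e
  proof -
    from that obtain d F G where FG: "form N d F" "form N d G" "\<not> vanishes_at G P"
      "e = eval_mpoly \<iota> x F / eval_mpoly \<iota> x G"
      by (auto simp: local_ring_def)
    have scale: "eval_mpoly \<iota> y F = eval_mpoly \<iota> x F / x (chart P) ^ d" if "form N d F" for F
      using eval_mpoly_homogeneous[OF that, of "1 / x (chart P)" x] by (simp add: power_divide y_def[abs_def])
    define a b where "a = eval_mpoly \<iota> y F" and "b = eval_mpoly \<iota> y G"
    have abW: "a \<in> W" "b \<in> W" unfolding a_def b_def by (rule subalgebra_eval[OF W _ yW], fact, assumption)+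
    have "(eval_mpoly \<iota> x G, eval_mpoly id (coords P) G) \<in> form_values P d"
      using FG(2) by (auto simp: form_values_def)
    note q = form_quotient_regular[OF P this]
    have "b \<notin> vanishing P"
      using q(2) FG(2,3) vanishes_at_iff[OF in_proj_space[OF P] FG(2)] by (simp add: b_def scale)
    then have b: "b \<noteq> 0" "1 / b \<in> regular P" using inverse_regular[OF P] abW by (auto simp: W_def)
    have "\<delta> (1 / b) = - ((1 / b * (1 / b)) * \<delta> b)" using der_inverse[OF der b(1)] by simp
    also have "\<dots> \<in> ord_ge P M"
      using abW b by (intro ord_ge_uminus[OF P] mul subalgebraD(3)[OF R]) (auto simp: W_def)
    finally have "1 / b \<in> W" using b by (simp add: W_def)
    then have "a * (1 / b) \<in> W" using subalgebraD(3)[OF W] abW by blast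
    also have "a * (1 / b) = e" using q(3) FG(1,2) by (simp add: a_def b_def scale FG(4))
    finally show ?thesis by (simp add: W_def)
  qed
  then show ?thesis by blast
qed

text \<open>
  Differentiate the power series expansion of \<open>y\<close> in \<open>s\<close>, cut off after \<open>r\<close> terms.
\<close>

lemma derivation_expansion:
  assumes P: "P \<in> C" and s: "local_parameter N \<iota> x P s" and der: "derivation \<delta>" and y: "y \<in> regular P"
  shows "\<exists>a\<in>regular P. \<exists>z\<in>regular P. \<delta> y = \<delta> s * a + s ^ r * \<delta> z"
  using y
proof (induction r arbitrary: y)
  case 0
  then show ?case
    using subalgebraD(4)[OF regular_subalgebra[OF P]] by (intro bexI[of _ 0] bexI[of _ y]) auto
next
  case (Suc r)
  note R = regular_subalgebra[OF P]
  have sR: "s \<in> regular P" using local_parameterD(1)[OF P s] vanishing_subset_regular[OF P] by blast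
  obtain c where "y - \<iota> c \<in> vanishing P" using regular_value[OF P Suc.prems] by blast
  then obtain y' where y': "y' \<in> regular P" "y - \<iota> c = s * y'" using local_parameterD(3)[OF P s] by blast
  obtain a z where az: "a \<in> regular P" "z \<in> regular P" "\<delta> y' = \<delta> s * a + s ^ r * \<delta> z"
    using Suc.IH[OF y'(1)] by blast
  have "\<delta> y = \<delta> (\<iota> c + s * y')" using y'(2) by (simp add: algebra_simps)
  also have "\<dots> = \<delta> s * (y' + s * a) + s ^ Suc r * \<delta> z"
    by (simp add: der_add[OF der] der_mult[OF der] der_const[OF der] az(3) algebra_simps)
  finally have "\<delta> y = \<delta> s * (y' + s * a) + s ^ Suc r * \<delta> z" .
  moreover have "y' + s * a \<in> regular P" using y' az sR subalgebraD(2,3)[OF R] by blast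
  ultimately show ?case using az(2) by blast
qed

lemma parameter_power_mult:
  "P \<in> C \<Longrightarrow> local_parameter N \<iota> x P s \<Longrightarrow> z \<in> ord_ge P M \<Longrightarrow> s ^ r * z \<in> ord_ge P (int r + M)"
  using ord_power[of P s r] ord_parameter[of P s] local_parameterD(2)[of P s]
  by (intro ord_ge_mult) (simp_all add: ord_ge_def)

text \<open>
  Here \<open>\<delta> y = s\<^sup>r \<delta> z\<close> for every \<open>r\<close>, and the poles of \<open>\<delta> z\<close> at \<open>P\<close> are bounded.
\<close>

lemma derivation_zero_if_parameter_zero:
  assumes P: "P \<in> C" and s: "local_parameter N \<iota> x P s" and der: "derivation \<delta>" and "\<delta> s = 0"
  shows "\<delta> y = 0"
proof -
  have reg: "\<delta> y = 0" if y: "y \<in> regular P" for y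
  proof (rule ccontr)
    assume ne: "\<delta> y \<noteq> 0"
    obtain M where M: "\<And>y. y \<in> regular P \<Longrightarrow> \<delta> y \<in> ord_ge P M"
      using derivation_bounded_poles[OF P der] by blast
    define r where "r = nat (ord P (\<delta> y) - M + 1)"
    obtain z where "z \<in> regular P" "\<delta> y = s ^ r * \<delta> z"
      using derivation_expansion[OF P s der y, of r] \<open>\<delta> s = 0\<close> by auto
    then have "\<delta> y \<in> ord_ge P (int r + M)" using parameter_power_mult[OF P s M] by metis
    then show False using ne by (auto simp: ord_ge_def r_def split: if_splits)
  qed
  obtain a b where ab: "a \<in> regular P" "b \<in> regular P" "b \<noteq> 0" "y = a / b" by (rule quotient_of_regular[OF P])
  then show ?thesis using der_divide_eq_0[OF der reg reg] by simp
qed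

text \<open>
  In other words, \<open>\<delta>\<close> divided by \<open>\<delta> s\<close> preserves the local ring, like \<open>d / ds\<close>: for large \<open>r\<close> the
  remainder \<open>s\<^sup>r \<delta> z\<close> is harmless.
\<close>

lemma derivation_order_ge:
  assumes P: "P \<in> C" and s: "local_parameter N \<iota> x P s" and der: "derivation \<delta>" and y: "y \<in> regular P"
  shows "\<delta> y \<in> ord_ge P (ord P (\<delta> s))"
proof -
  obtain M where M: "\<And>y. y \<in> regular P \<Longrightarrow> \<delta> y \<in> ord_ge P M"
    using derivation_bounded_poles[OF P der] by blast
  define r where "r = nat (ord P (\<delta> s) - M)"
  obtain a z where az: "a \<in> regular P" "z \<in> regular P" "\<delta> y = \<delta> s * a + s ^ r * \<delta> z"
    using derivation_expansion[OF P s der y, of r] by blast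
  have "\<delta> s * a \<in> ord_ge P (ord P (\<delta> s) + 0)"
    using az(1) regular_eq_ord_ge[OF P] by (intro ord_ge_mult[OF P] ord_ge_ord) auto
  moreover have "s ^ r * \<delta> z \<in> ord_ge P (ord P (\<delta> s))"
    by (rule ord_ge_mono[OF parameter_power_mult[OF P s M[OF az(2)]]]) (simp add: r_def)
  ultimately show ?thesis unfolding az(3) by (intro ord_ge_add[OF P]) simp_all
qed

text \<open>
  Derivations of \<open>L\<close> over \<open>k\<close> form a space of dimension one, since \<open>\<epsilon> s \<cdot> \<delta> - \<delta> s \<cdot> \<epsilon>\<close> kills \<open>s\<close>.
\<close>

lemma derivation_unique:
  assumes \<delta>: "derivation \<delta>" and \<epsilon>: "derivation \<epsilon>" and t: "\<delta> t = 0" "\<epsilon> t \<noteq> 0"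
  shows "\<delta> y = 0"
proof -
  obtain P where P: "P \<in> C" using nonempty by blast
  obtain s where s: "local_parameter N \<iota> x P s" using smooth P by blast
  define \<eta> where "\<eta> y = \<epsilon> s * \<delta> y - \<delta> s * \<epsilon> y" for y
  have "derivation \<eta>"
    using \<delta> \<epsilon> by (auto simp: derivation_def \<eta>_def algebra_simps)
  moreover have "\<eta> s = 0" by (simp add: \<eta>_def)
  ultimately have "\<eta> t = 0" using derivation_zero_if_parameter_zero[OF P s] by blast
  then have "\<delta> s = 0" using t by (simp add: \<eta>_def)
  then show ?thesis by (rule derivation_zero_if_parameter_zero[OF P s \<delta>])
qed

text \<open>
  If \<open>w = s\<^sup>k u\<close> with a unit \<open>u\<close> and \<open>0 < k < p\<close>, then \<open>\<delta> w = 0\<close> amounts to \<open>k u \<delta> s = - s \<delta> u\<close>. The left side has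
  the order of \<open>\<delta> s\<close>, and the right side a larger one.
\<close>

lemma derivation_kernel_expansion:
  assumes P: "P \<in> C" and der: "derivation \<delta>" and nz: "\<delta> t \<noteq> 0"
    and y: "y \<in> regular P" "\<delta> y = 0"
    and p: "\<And>k. 0 < k \<Longrightarrow> k < p \<Longrightarrow> of_nat k \<noteq> (0 :: 'k)"
  shows "\<exists>c. y - \<iota> c \<in> ord_ge P (int p)"
proof -
  obtain s where s: "local_parameter N \<iota> x P s" using smooth P by blast
  have ds: "\<delta> s \<noteq> 0" using derivation_zero_if_parameter_zero[OF P s der] nz by blast
  obtain c where c: "y - \<iota> c \<in> vanishing P" using regular_value[OF P y(1)] by blast
  define w where "w = y - \<iota> c"
  have dw: "\<delta> w = 0" using y(2) by (simp add: w_def der_diff[OF der] der_const[OF der])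
  have "w \<in> ord_ge P (int p)"
  proof (rule ccontr)
    assume "w \<notin> ord_ge P (int p)"
    then have w: "w \<noteq> 0" "ord P w < int p" by (auto simp: ord_ge_def)
    have "ord P w \<ge> 1" using c w(1) vanishing_eq_ord_ge[OF P] by (simp add: w_def ord_ge_def)
    define k where "k = nat (ord P w) - 1"
    have k: "ord P w = int (Suc k)" using \<open>ord P w \<ge> 1\<close> by (simp add: k_def)
    obtain u where u: "u \<in> unit_at P" "w = s powi ord P w * u" by (rule ex_ord_decomposition[OF P s w(1)])
    have wu: "w = s ^ Suc k * u" using u(2) unfolding k power_int_of_nat .
    have s0: "s \<noteq> 0" using local_parameterD(2)[OF P s] .
    have u0: "u \<noteq> 0" using unit_at_nonzero[OF P u(1)] .
    have "0 = of_nat (Suc k) * s ^ k * \<delta> s * u + s ^ Suc k * \<delta> u"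
      using dw by (simp only: wu der_mult[OF der] der_power[OF der])
    also have "\<dots> = s ^ k * (of_nat (Suc k) * u * \<delta> s + s * \<delta> u)" by (simp add: algebra_simps)
    finally have "of_nat (Suc k) * u * \<delta> s = - (s * \<delta> u)" using s0 by (simp add: eq_neg_iff_add_eq_0)
    moreover have "s * \<delta> u \<in> ord_ge P (1 + ord P (\<delta> s))"
      using parameter_power_mult[OF P s derivation_order_ge[OF P s der unit_atD(1)[OF u(1)]], of 1] by simp
    ultimately have "\<iota> (of_nat (Suc k)) * u * \<delta> s \<in> ord_ge P (1 + ord P (\<delta> s))"
      using ord_ge_uminus[OF P] by (simp add: hom_distribs)
    moreover have ck: "of_nat (Suc k) \<noteq> (0 :: 'k)" using p[of "Suc k"] w(2) k by simp
    then have e: "\<iota> (of_nat (Suc k)) * u \<in> unit_at P" by (intro unit_at_mult[OF P] unit_at_const[OF P] u)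
    have "ord P (\<iota> (of_nat (Suc k)) * u * \<delta> s) = ord P (\<delta> s)"
      unfolding ord_mult[OF P unit_at_nonzero[OF P e] ds] ord_unit[OF P e] by simp
    moreover have "\<iota> (of_nat (Suc k)) * u * \<delta> s \<noteq> 0"
      using unit_at_nonzero[OF P e] ds by (rule no_zero_divisors)
    ultimately show False by (simp add: ord_ge_def)
  qed
  then show ?thesis by (auto simp: w_def)
qed

section \<open>Composition of Hasse derivatives\<close>

lemma hasse_derivation:
  assumes "hasse_derivatives \<iota> t D"
  shows "derivation (D 1)" "D 1 t = 1"
proof -
  note D = assms[unfolded hasse_derivatives_def]
  have "D 1 (y * z) = D 1 y * z + y * D 1 z" for y z
  proof -
    have "D 1 (y * z) = (\<Sum>i\<le>1. D i y * D (1 - i) z)" using D by blast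
    also have "\<dots> = D 1 y * z + y * D 1 z" using D by (simp add: add.commute)
    finally show ?thesis .
  qed
  moreover have "D 1 (y + z) = D 1 y + D 1 z" "D 1 (\<iota> c * y) = \<iota> c * D 1 y" for c y z
    using D by blast+
  ultimately show "derivation (D 1)" unfolding derivation_def by blast
  have "D 1 (t ^ 1) = of_nat (1 choose 1) * t ^ (1 - 1)" using D by blast
  then show "D 1 t = 1" by simp
qed

text \<open>
  Once the formula holds for smaller \<open>i\<close>, the difference of the two sides satisfies the product rule, so it is
  a derivation. It kills \<open>t\<close>, while \<open>D 1 t = 1\<close>; hence it is zero.
\<close>

lemma hasse_composition:
  assumes hd: "hasse_derivatives \<iota> t D"
  shows "D 1 (D i y) = of_nat (Suc i) * D (Suc i) y"
proof (induction i arbitrary: y rule: less_induct)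
  case (less i)
  note D = hd[unfolded hasse_derivatives_def]
  note d1 = hasse_derivation(1)[OF hd]
  have D0: "D 0 y = y" for y using D by simp
  have add: "D r (y + z) = D r y + D r z" for r y z using D by blast
  have scale: "D r (\<iota> c * y) = \<iota> c * D r y" for r c y using D by blast
  have mult: "D r (y * z) = (\<Sum>j\<le>r. D j y * D (r - j) z)" for r y z using D by blast
  show ?case
  proof (cases "i = 0")
    case True
    then show ?thesis by (simp add: D0)
  next
    case False
    define \<delta> where "\<delta> y = D 1 (D i y) - of_nat (Suc i) * D (Suc i) y" for y
    have E: "D 1 (D j y) = of_nat (Suc j) * D (Suc j) y + (if j = i then \<delta> y else 0)" if "j \<le> i" for j y
      using less.IH[of j y] that by (auto simp: \<delta>_def)
    have leibniz: "\<delta> (y * z) = \<delta> y * z + y * \<delta> z" for y z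
    proof -
      \<comment> \<open>Shifting \<open>j\<close> by one in the first sum gives the weights \<open>j\<close> and \<open>i + 1 - j\<close>, which add up to \<open>i + 1\<close>.\<close>
      have S1: "(\<Sum>j\<le>i. D 1 (D j y) * D (i - j) z) =
          (\<Sum>j\<le>Suc i. of_nat j * (D j y * D (Suc i - j) z)) + \<delta> y * z"
      proof -
        have "(\<Sum>j\<le>i. D 1 (D j y) * D (i - j) z) =
            (\<Sum>j\<le>i. of_nat (Suc j) * (D (Suc j) y * D (i - j) z) + (if j = i then \<delta> y * z else 0))"
          by (intro sum.cong) (simp_all add: E D0 algebra_simps del: of_nat_Suc One_nat_def)
        then show ?thesis
          by (simp add: sum.distrib sum.atMost_Suc_shift del: sum.atMost_Suc of_nat_Suc)
      qed
      have S2: "(\<Sum>j\<le>i. D j y * D 1 (D (i - j) z)) =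
          (\<Sum>j\<le>Suc i. of_nat (Suc i - j) * (D j y * D (Suc i - j) z)) + y * \<delta> z"
      proof -
        have "(\<Sum>j\<le>i. D j y * D 1 (D (i - j) z)) =
            (\<Sum>j\<le>i. of_nat (Suc i - j) * (D j y * D (Suc i - j) z) + (if j = 0 then y * \<delta> z else 0))"
        proof (rule sum.cong)
          fix j assume "j \<in> {..i}"
          then have j: "j \<le> i" by simp
          have "i - j = i \<longleftrightarrow> j = 0" using j False by auto
          then show "D j y * D 1 (D (i - j) z) =
              of_nat (Suc i - j) * (D j y * D (Suc i - j) z) + (if j = 0 then y * \<delta> z else 0)"
            using E[of "i - j" z] j by (auto simp: Suc_diff_le D0 algebra_simps simp del: of_nat_Suc)
        qed simp
        then show ?thesis by (simp add: sum.distrib)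
      qed
      have "D 1 (D i (y * z)) = (\<Sum>j\<le>i. D 1 (D j y) * D (i - j) z) + (\<Sum>j\<le>i. D j y * D 1 (D (i - j) z))"
        by (simp add: mult[of i] der_sum[OF d1] der_mult[OF d1] sum.distrib del: One_nat_def)
      also have "\<dots> = (\<Sum>j\<le>Suc i. of_nat j * (D j y * D (Suc i - j) z) +
          of_nat (Suc i - j) * (D j y * D (Suc i - j) z)) + (\<delta> y * z + y * \<delta> z)"
        unfolding S1 S2 sum.distrib by (simp only: ac_simps)
      also have "(\<Sum>j\<le>Suc i. of_nat j * (D j y * D (Suc i - j) z) +
          of_nat (Suc i - j) * (D j y * D (Suc i - j) z)) = (\<Sum>j\<le>Suc i. of_nat (Suc i) * (D j y * D (Suc i - j) z))"
        by (intro sum.cong refl)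
          (simp only: distrib_right[symmetric] of_nat_add[symmetric] atMost_iff le_add_diff_inverse)
      also have "\<dots> = of_nat (Suc i) * D (Suc i) (y * z)"
        unfolding mult[of "Suc i"] sum_distrib_left ..
      finally show ?thesis by (simp add: \<delta>_def)
    qed
    have "derivation \<delta>"
      unfolding derivation_def using leibniz
      by (auto simp: \<delta>_def add scale right_diff_distrib distrib_left mult.left_commute)
    moreover have "\<delta> t = 0"
    proof -
      have pow: "D r (t ^ 1) = of_nat (1 choose r) * t ^ (1 - r)" for r using D by blast
      have "D (Suc i) t = 0" using pow[of "Suc i"] False by (simp add: binomial_eq_0)
      moreover have "D 1 (D i t) = 0"
        using pow[of i] False der_one[OF d1] der_zero[OF d1] by (cases "i = 1") (simp_all add: binomial_eq_0)
      ultimately show ?thesis by (simp add: \<delta>_def)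
    qed
    moreover have "D 1 t \<noteq> 0" using hasse_derivation(2)[OF hd] by simp
    ultimately have "\<delta> y = 0" by (rule derivation_unique[OF _ d1])
    then show ?thesis by (simp add: \<delta>_def)
  qed
qed

end

section \<open>The degree of the linear series\<close>

lemma ex_minimizer:
  fixes h :: "'c \<Rightarrow> 'd::linorder"
  assumes "finite A" "A \<noteq> {}"
  shows "\<exists>j\<in>A. \<forall>i\<in>A. h j \<le> h i"
proof -
  have "Min (h ` A) \<in> h ` A" using assms by (intro Min_in) auto
  then obtain j where "j \<in> A" "h j = Min (h ` A)" by auto
  then show ?thesis using assms by (intro bexI[of _ j]) auto
qed

context smooth_curve
begin

text \<open>
  A relation \<open>\<Sum> a\<^sub>i f\<^sub>i = 0\<close> would put the whole image into the hyperplane with coefficients \<open>a\<close>. The work lies in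
  showing that the value of the morphism at \<open>P\<close> is a point: dividing by an \<open>f\<^sub>j\<close> of least order gives coordinates, and
  all others are proportional to them.
\<close>

lemma nondegenerate_independent:
  assumes nd: "nondegenerate N C \<iota> x n f" and rel: "(\<Sum>i\<le>n. \<iota> (a i) * f i) = 0" and i: "i0 \<le> n"
  shows "a i0 = 0"
proof (rule ccontr)
  assume a0: "a i0 \<noteq> 0"
  define a' where "a' i = (if i \<le> n then a i else 0)" for i
  have "a' i0 \<noteq> 0" using a0 i by (simp add: a'_def)
  moreover have "a' i = 0" if "i > n" for i using that by (simp add: a'_def)
  ultimately have a': "a' \<in> coord_vectors n" unfolding coord_vectors_def by blast
  have rel': "(\<Sum>i\<le>n. \<iota> (a' i) * f i) = 0"
    unfolding rel[symmetric] by (intro sum.cong) (auto simp: a'_def)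
  obtain i1 where i1: "i1 \<le> n" "f i1 \<noteq> 0" using nd by (auto simp: nondegenerate_def)
  have "morphism_value N \<iota> x n f P \<in> hyperplane n a'" if P: "P \<in> C" for P
  proof -
    note R = regular_subalgebra[OF P] and I = vanishing_ideal[OF P]
    have const: "c = 0" if "\<iota> c \<in> vanishing P" for c
      using unit_at_const[OF P, of c] that by (auto simp: unit_at_def)
    define A where "A = {i. i \<le> n \<and> f i \<noteq> 0}"
    have "finite A" "A \<noteq> {}" using i1 by (auto simp: A_def)
    then obtain j where j: "j \<in> A" "\<And>i. i \<in> A \<Longrightarrow> ord P (f j) \<le> ord P (f i)"
      using ex_minimizer[of A "\<lambda>i. ord P (f i)"] by blast
    have fj: "j \<le> n" "f j \<noteq> 0" using j by (auto simp: A_def)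
    define h where "h = 1 / f j"
    have hf: "h * f i \<in> regular P" if "i \<le> n" for i
    proof (cases "f i = 0")
      case True
      then show ?thesis using subalgebraD(4)[OF R] by simp
    next
      case False
      then have "ord P (f j) \<le> ord P (f i)" using j that by (simp add: A_def)
      then have "f i / f j \<in> ord_ge P 0" using ord_divide[OF P False fj(2)] by (simp add: ord_ge_def)
      then show ?thesis unfolding regular_eq_ord_ge[OF P] by (simp add: h_def)
    qed
    have "\<exists>c. h * f i - \<iota> c \<in> vanishing P" if "i \<le> n" for i
      by (rule regular_value[OF P hf[OF that]])
    then obtain v0 where v0: "\<And>i. i \<le> n \<Longrightarrow> h * f i - \<iota> (v0 i) \<in> vanishing P" by metis
    define v where "v i = (if i \<le> n then v0 i else 0)" for i
    have v: "h * f i - \<iota> (v i) \<in> vanishing P" if "i \<le> n" for i using v0 that by (simp add: v_def)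
    have "v j \<noteq> 0"
    proof
      assume "v j = 0"
      then show False using v[OF fj(1)] fj(2) one_not_vanishing[OF P] by (simp add: h_def)
    qed
    moreover have "v i = 0" if "i > n" for i using that by (simp add: v_def)
    ultimately have vc: "v \<in> coord_vectors n" unfolding coord_vectors_def by blast
    have "morphism_value N \<iota> x n f P = {w. \<exists>c. c \<noteq> 0 \<and> w = (\<lambda>i. c * v i)}"
    proof (intro subset_antisym subsetI CollectI)
      fix w assume "w \<in> {w. \<exists>c. c \<noteq> 0 \<and> w = (\<lambda>i. c * v i)}"
      then obtain c where c: "c \<noteq> 0" "w = (\<lambda>i. c * v i)" by blast
      have "\<iota> c * (h * f i - \<iota> (v i)) \<in> vanishing P" if "i \<le> n" for i
        by (intro vanishing_mult[OF P] subalgebraD(1)[OF R] v that)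
      then have "(\<iota> c * h) * f i - \<iota> (w i) \<in> vanishing P" if "i \<le> n" for i
        using that by (simp add: c(2) hom_distribs right_diff_distrib mult.assoc)
      moreover have "w \<in> coord_vectors n"
        using vc c by (auto simp: coord_vectors_def)
      ultimately show "w \<in> morphism_value N \<iota> x n f P" unfolding morphism_value_def by blast
    next
      fix w assume "w \<in> morphism_value N \<iota> x n f P"
      then obtain h' where w: "w \<in> coord_vectors n" "\<And>i. i \<le> n \<Longrightarrow> h' * f i - \<iota> (w i) \<in> vanishing P"
        by (auto simp: morphism_value_def)
      define q where "q = h' * f j"
      have q: "q - \<iota> (w j) \<in> vanishing P" using w(2)[OF fj(1)] by (simp add: q_def)
      have qR: "q \<in> regular P"
        using subalgebraD(2)[OF R ideal_ofD(1)[OF I q] subalgebraD(1)[OF R, of "w j"]] by simp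
      have wi: "w i = w j * v i" if "i \<le> n" for i
      proof -
        have "q * (h * f i) - \<iota> (w j) * \<iota> (v i) \<in> vanishing P"
          by (intro ideal_cong_mult[OF R I] qR hf v q subalgebraD(1)[OF R] that)
        moreover have "q * (h * f i) = h' * f i" using fj(2) by (simp add: q_def h_def)
        ultimately have "h' * f i - \<iota> (w j) * \<iota> (v i) \<in> vanishing P" by metis
        from ideal_of_diff[OF R I this w(2)[OF that]]
        have "(h' * f i - \<iota> (w j) * \<iota> (v i)) - (h' * f i - \<iota> (w i)) \<in> vanishing P" .
        then have "\<iota> (w i - w j * v i) \<in> vanishing P" by (simp add: hom_distribs)
        from const[OF this] show ?thesis by simp
      qed
      have eq: "w = (\<lambda>i. w j * v i)"
      proof
        fix i
        show "w i = w j * v i"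
          using wi[of i] w(1) by (cases "i \<le> n") (auto simp: coord_vectors_def v_def)
      qed
      moreover have "w j \<noteq> 0"
      proof
        assume "w j = 0"
        then have "w i = 0" for i using fun_cong[OF eq, of i] by simp
        then show False using w(1) by (simp add: coord_vectors_def)
      qed
      ultimately show "\<exists>c. c \<noteq> 0 \<and> w = (\<lambda>i. c * v i)" by blast
    qed
    then have "morphism_value N \<iota> x n f P \<in> proj_space n" using proj_spaceI[OF vc] by simp
    moreover have "(\<Sum>i\<le>n. a' i * w i) = 0" if "w \<in> morphism_value N \<iota> x n f P" for w
    proof -
      from that obtain h' where w: "\<And>i. i \<le> n \<Longrightarrow> h' * f i - \<iota> (w i) \<in> vanishing P"
        by (auto simp: morphism_value_def)
      have "(\<Sum>i\<le>n. \<iota> (a' i) * (h' * f i)) - (\<Sum>i\<le>n. \<iota> (a' i) * \<iota> (w i)) \<in> vanishing P"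
      proof (rule ideal_cong_sum[OF I])
        fix i assume "i \<in> {..n}"
        then have "\<iota> (a' i) * (h' * f i - \<iota> (w i)) \<in> vanishing P"
          by (intro vanishing_mult[OF P] subalgebraD(1)[OF R] w) simp
        then show "\<iota> (a' i) * (h' * f i) - \<iota> (a' i) * \<iota> (w i) \<in> vanishing P" by (simp add: right_diff_distrib)
      qed
      moreover have "(\<Sum>i\<le>n. \<iota> (a' i) * (h' * f i)) = h' * (\<Sum>i\<le>n. \<iota> (a' i) * f i)"
        by (simp add: sum_distrib_left mult.left_commute)
      ultimately have "\<iota> (- (\<Sum>i\<le>n. a' i * w i)) \<in> vanishing P"
        using rel' by (simp add: hom_distribs)
      from const[OF this] show ?thesis by simp
    qed
    ultimately show ?thesis by (simp add: hyperplane_def)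
  qed
  then have "morphism_value N \<iota> x n f ` C \<subseteq> hyperplane n a'" by blast
  then show False using nd a' by (auto simp: nondegenerate_def)
qed

text \<open>
  The divisor of \<open>g\<close> plus \<open>E\<close> is effective with multiplicity at least \<open>p\<close> at \<open>P\<close>, and the divisor of \<open>g\<close> has
  degree at most \<open>0\<close>.
\<close>

lemma linear_series_degree_ge:
  assumes nz: "i1 \<le> n" "f i1 \<noteq> 0"
    and P: "P \<in> C" and g: "g \<noteq> 0" "g \<in> ord_ge P (int p - base_divisor N \<iota> x n f P)"
    and gQ: "\<And>Q. Q \<in> C \<Longrightarrow> g \<in> ord_ge Q (- base_divisor N \<iota> x n f Q)"
  shows "int p \<le> linear_series_degree N C \<iota> x n f"
proof -
  define E where "E = base_divisor N \<iota> x n f"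
  have EP: "\<exists>i\<le>n. f i \<noteq> 0 \<and> E Q = - ord Q (f i)" for Q
  proof -
    define A where "A = {ord Q (f i) | i. i \<le> n \<and> f i \<noteq> 0}"
    have "finite A" "A \<noteq> {}" using nz by (auto simp: A_def)
    from Min_in[OF this] obtain i where i: "i \<le> n" "f i \<noteq> 0" "Min A = ord Q (f i)" unfolding A_def by blast
    then show ?thesis by (intro exI[of _ i]) (simp add: E_def base_divisor_def A_def)
  qed
  have "{Q \<in> C. E Q \<noteq> 0} \<subseteq> (\<Union>i\<in>{i. i \<le> n \<and> f i \<noteq> 0}. {Q \<in> C. ord Q (f i) \<noteq> 0})"
  proof
    fix Q assume Q: "Q \<in> {Q \<in> C. E Q \<noteq> 0}"
    obtain i where "i \<le> n" "f i \<noteq> 0" "E Q = - ord Q (f i)" using EP[of Q] by blast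
    with Q show "Q \<in> (\<Union>i\<in>{i. i \<le> n \<and> f i \<noteq> 0}. {Q \<in> C. ord Q (f i) \<noteq> 0})" by auto
  qed
  moreover have "finite \<dots>" by (auto intro!: finite_ord_nonzero)
  ultimately have finE: "finite {Q \<in> C. E Q \<noteq> 0}" by (rule finite_subset)
  define S where "S = insert P ({Q \<in> C. E Q \<noteq> 0} \<union> {Q \<in> C. ord Q g \<noteq> 0})"
  have S: "finite S" "S \<subseteq> C" "{Q \<in> C. ord Q g \<noteq> 0} \<subseteq> S" "P \<in> S"
    using finE finite_ord_nonzero[OF g(1)] P by (auto simp: S_def)
  have "int p = (\<Sum>Q\<in>{P}. int p)" by simp
  also have "\<dots> \<le> (\<Sum>Q\<in>{P}. ord Q g + E Q)" using g by (simp add: ord_ge_def E_def)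
  also have "\<dots> \<le> (\<Sum>Q\<in>S. ord Q g + E Q)"
  proof (rule sum_mono2)
    fix Q assume "Q \<in> S - {P}"
    then have "Q \<in> C" using S by blast
    then show "0 \<le> ord Q g + E Q" using gQ[of Q] g(1) by (simp add: ord_ge_def E_def)
  qed (use S in auto)
  also have "\<dots> = (\<Sum>Q\<in>S. ord Q g) + (\<Sum>Q\<in>S. E Q)" by (rule sum.distrib)
  also have "\<dots> \<le> (\<Sum>Q\<in>S. E Q)" using principal_divisor_degree_le[OF g(1) S(1-3)] by simp
  also have "\<dots> = linear_series_degree N C \<iota> x n f"
    unfolding linear_series_degree_def divisor_degree_def E_def[symmetric]
    using S by (intro sum.mono_neutral_right) (auto simp: S_def)
  finally show ?thesis .
qed

lemma ord_ge_base_divisor: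
  assumes "i \<le> n"
  shows "f i \<in> ord_ge Q (- base_divisor N \<iota> x n f Q)"
proof (cases "f i = 0")
  case False
  have "Min {ord Q (f i) | i. i \<le> n \<and> f i \<noteq> 0} \<le> ord Q (f i)"
    using assms False by (intro Min_le) auto
  then show ?thesis by (simp add: ord_ge_def base_divisor_def)
qed simp

text \<open>
  Divide the \<open>w\<^sub>i\<close> by one of least order at \<open>P\<close>. The quotients still lie in the kernel and are regular at \<open>P\<close>, so
  they are congruent to constants \<open>c\<^sub>i\<close> to order \<open>p\<close>; then so is the combination of the \<open>f\<^sub>i\<close> with coefficients \<open>c\<^sub>i\<close> to
  the zero combination.
\<close>

lemma degree_ge_if_dependent_over_kernel:
  assumes nd: "nondegenerate N C \<iota> x n f"
    and der: "derivation \<delta>" and t: "\<delta> t \<noteq> 0"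
    and p: "0 < p" "\<And>k. 0 < k \<Longrightarrow> k < p \<Longrightarrow> of_nat k \<noteq> (0 :: 'k)"
    and w: "\<And>i. i \<le> n \<Longrightarrow> \<delta> (w i) = 0" "\<exists>i\<le>n. w i \<noteq> 0" "(\<Sum>i\<le>n. w i * f i) = 0"
  shows "int p \<le> linear_series_degree N C \<iota> x n f"
proof -
  obtain P where P: "P \<in> C" using nonempty by blast
  define A where "A = {i. i \<le> n \<and> w i \<noteq> 0}"
  have "finite A" "A \<noteq> {}" using w(2) by (auto simp: A_def)
  then obtain j where j: "j \<in> A" "\<And>i. i \<in> A \<Longrightarrow> ord P (w j) \<le> ord P (w i)"
    using ex_minimizer[of A "\<lambda>i. ord P (w i)"] by blast
  have wj: "j \<le> n" "w j \<noteq> 0" using j by (auto simp: A_def)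
  define y where "y i = w i / w j" for i
  have yR: "y i \<in> regular P" if "i \<le> n" for i
  proof (cases "w i = 0")
    case False
    then have "ord P (w j) \<le> ord P (w i)" using j(2)[of i] that by (simp add: A_def)
    then show ?thesis
      unfolding regular_eq_ord_ge[OF P] using ord_divide[OF P False wj(2)] by (simp add: y_def ord_ge_def)
  qed (simp add: y_def regular_eq_ord_ge[OF P])
  have dy: "\<delta> (y i) = 0" if "i \<le> n" for i
    unfolding y_def by (intro der_divide_eq_0[OF der] w(1) that wj)
  have "\<exists>c. y i - \<iota> c \<in> ord_ge P (int p)" if "i \<le> n" for i
    by (rule derivation_kernel_expansion[OF P der t yR[OF that] dy[OF that] p(2)])
  then obtain c where c: "\<And>i. i \<le> n \<Longrightarrow> y i - \<iota> (c i) \<in> ord_ge P (int p)" by metis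
  have "c j \<noteq> 0"
  proof
    assume "c j = 0"
    then have "1 \<in> ord_ge P (int p)" using c[OF wj(1)] wj(2) by (simp add: y_def)
    then show False using ord_one[OF P] p(1) by (simp add: ord_ge_def)
  qed
  define g where "g = (\<Sum>i\<le>n. \<iota> (c i) * f i)"
  have g0: "g \<noteq> 0" using nondegenerate_independent[OF nd _ wj(1), of c] \<open>c j \<noteq> 0\<close> by (auto simp: g_def)
  have "(\<Sum>i\<le>n. y i * f i) = (\<Sum>i\<le>n. w i * f i) / w j" by (simp add: y_def sum_divide_distrib)
  then have "(\<Sum>i\<le>n. y i * f i) = 0" using w(3) by simp
  then have "g = - (\<Sum>i\<le>n. (y i - \<iota> (c i)) * f i)"
    by (simp add: g_def left_diff_distrib sum_subtractf)
  moreover have "(\<Sum>i\<le>n. (y i - \<iota> (c i)) * f i) \<in> ord_ge P (int p - base_divisor N \<iota> x n f P)"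
  proof (rule ord_ge_sum[OF P])
    fix i assume "i \<in> {..n}"
    then show "(y i - \<iota> (c i)) * f i \<in> ord_ge P (int p - base_divisor N \<iota> x n f P)"
      using ord_ge_mult[OF P c ord_ge_base_divisor, of i i n f] by simp
  qed
  ultimately have gP: "g \<in> ord_ge P (int p - base_divisor N \<iota> x n f P)" using ord_ge_uminus[OF P] by simp
  have gQ: "g \<in> ord_ge Q (- base_divisor N \<iota> x n f Q)" if "Q \<in> C" for Q
    unfolding g_def using that by (intro ord_ge_sum ord_ge_scale ord_ge_base_divisor) auto
  obtain i1 where "i1 \<le> n" "f i1 \<noteq> 0" using nd by (auto simp: nondegenerate_def)
  from linear_series_degree_ge[OF this P g0 gP gQ] show ?thesis .
qed

text \<open>
  The orthogonal vectors are stable under the derivation applied to each entry; the range \<open>r < p\<close> is closed because \<open>p\<close>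
  vanishes in the field. In a vector with fewest non-zero entries, scaled to contain an entry \<open>1\<close>, derivation would produce more
  zeros, so its entries lie in the kernel.
\<close>

lemma degree_ge_if_orthogonal:
  assumes nd: "nondegenerate N C \<iota> x n f" and hd: "hasse_derivatives \<iota> t D"
    and p: "0 < p" "\<And>k. 0 < k \<Longrightarrow> k < p \<Longrightarrow> of_nat k \<noteq> (0 :: 'k)" "of_nat p = (0 :: 'b)"
    and z: "\<exists>i\<le>n. z i \<noteq> 0" "\<And>r. r < p \<Longrightarrow> (\<Sum>i\<le>n. z i * D r (f i)) = 0"
  shows "int p \<le> linear_series_degree N C \<iota> x n f"
proof -
  define good where "good w \<longleftrightarrow> (\<exists>i\<le>n. w i \<noteq> 0) \<and> (\<forall>r<p. (\<Sum>i\<le>n. w i * D r (f i)) = 0)" for w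
  define size where "size w = card {i. i \<le> n \<and> w i \<noteq> 0}" for w :: "nat \<Rightarrow> 'b"
  have "good z" using z by (auto simp: good_def)
  then obtain w where w: "good w" "\<And>w'. good w' \<Longrightarrow> size w \<le> size w'"
    using ex_has_least_nat[of good z size] by blast
  obtain j where j: "j \<le> n" "w j \<noteq> 0" using w(1) by (auto simp: good_def)
  note d1 = hasse_derivation[OF hd]
  define y where "y i = w i / w j" for i
  have y0: "(\<Sum>i\<le>n. y i * D r (f i)) = 0" if "r < p" for r
  proof -
    have "(\<Sum>i\<le>n. y i * D r (f i)) = (\<Sum>i\<le>n. w i * D r (f i)) / w j"
      by (simp add: y_def sum_divide_distrib)
    then show ?thesis using w(1) that by (simp add: good_def)
  qed
  define u where "u i = D 1 (y i)" for i
  have u0: "(\<Sum>i\<le>n. u i * D r (f i)) = 0" if r: "r < p" for r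
  proof -
    have "0 = D 1 (\<Sum>i\<le>n. y i * D r (f i))" using y0[OF r] der_zero[OF d1(1)] by simp
    also have "\<dots> = (\<Sum>i\<le>n. u i * D r (f i)) + (\<Sum>i\<le>n. y i * D 1 (D r (f i)))"
      by (simp add: der_sum[OF d1(1)] der_mult[OF d1(1)] u_def sum.distrib del: One_nat_def)
    also have "(\<Sum>i\<le>n. y i * D 1 (D r (f i))) = of_nat (Suc r) * (\<Sum>i\<le>n. y i * D (Suc r) (f i))"
      unfolding hasse_composition[OF hd] by (simp add: sum_distrib_left mult.left_commute del: of_nat_Suc)
    also have "\<dots> = 0"
    proof (cases "Suc r = p")
      case True
      then show ?thesis using p(3) by (simp only: mult_zero_left)
    next
      case False
      then show ?thesis using y0[of "Suc r"] r by simp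
    qed
    finally show ?thesis by simp
  qed
  have "u i = 0" if i: "i \<le> n" for i
  proof (rule ccontr)
    assume "u i \<noteq> 0"
    then have "good u" using u0 i by (auto simp: good_def)
    then have "size w \<le> size u" by (rule w(2))
    moreover have "{i. i \<le> n \<and> u i \<noteq> 0} \<subset> {i. i \<le> n \<and> w i \<noteq> 0}"
    proof
      show "{i. i \<le> n \<and> u i \<noteq> 0} \<subseteq> {i. i \<le> n \<and> w i \<noteq> 0}"
        using der_zero[OF d1(1)] by (auto simp: u_def y_def)
      have "u j = 0" using j der_one[OF d1(1)] by (simp add: u_def y_def)
      then show "{i. i \<le> n \<and> u i \<noteq> 0} \<noteq> {i. i \<le> n \<and> w i \<noteq> 0}" using j by blast
    qed
    then have "size u < size w" unfolding size_def by (intro psubset_card_mono) auto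
    ultimately show False by simp
  qed
  then have "D 1 (y i) = 0" if "i \<le> n" for i using that by (simp add: u_def)
  moreover have "\<exists>i\<le>n. y i \<noteq> 0" using j by (auto simp: y_def)
  moreover have "(\<Sum>i\<le>n. y i * f i) = 0"
    using y0[of 0] p(1) hd by (simp add: hasse_derivatives_def)
  moreover have "D 1 t \<noteq> 0" using d1(2) by simp
  ultimately show ?thesis
    using degree_ge_if_dependent_over_kernel[OF nd d1(1) _ p(1,2)] by blast
qed

end

section \<open>Determinants and row relations\<close>

lemma det_eq_0_iff_row_relation:
  fixes g :: "nat \<Rightarrow> nat \<Rightarrow> 'b::field"
  shows "det (mat (n + 1) (n + 1) (\<lambda>(r, i). g r i)) = 0 \<longleftrightarrow>
    (\<exists>c. (\<exists>r\<le>n. c r \<noteq> 0) \<and> (\<forall>i\<le>n. (\<Sum>r\<le>n. c r * g r i) = 0))"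
proof -
  let ?M = "mat (n + 1) (n + 1) (\<lambda>(r, i). g r i)"
  have entry: "(transpose_mat ?M *\<^sub>v v) $ i = (\<Sum>r\<le>n. v $ r * g r i)"
    if "i \<le> n" "v \<in> carrier_vec (n + 1)" for i v
    using that by (auto simp: scalar_prod_def mult.commute atLeast0LessThan lessThan_Suc_atMost intro!: sum.cong)
  have "det ?M = 0 \<longleftrightarrow> det (transpose_mat ?M) = 0" by (subst det_transpose) auto
  also have "\<dots> \<longleftrightarrow> (\<exists>v. v \<in> carrier_vec (n + 1) \<and> v \<noteq> 0\<^sub>v (n + 1) \<and> transpose_mat ?M *\<^sub>v v = 0\<^sub>v (n + 1))"
    by (rule det_0_iff_vec_prod_zero_field) simp
  also have "\<dots> \<longleftrightarrow> (\<exists>c. (\<exists>r\<le>n. c r \<noteq> 0) \<and> (\<forall>i\<le>n. (\<Sum>r\<le>n. c r * g r i) = 0))"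
  proof safe
    fix v assume v: "v \<in> carrier_vec (n + 1)" "v \<noteq> 0\<^sub>v (n + 1)" "transpose_mat ?M *\<^sub>v v = 0\<^sub>v (n + 1)"
    have "\<exists>r\<le>n. v $ r \<noteq> 0"
    proof (rule ccontr)
      assume "\<not> ?thesis"
      then have "v = 0\<^sub>v (n + 1)" using v(1) by (intro eq_vecI) auto
      then show False using v(2) by simp
    qed
    moreover have "\<forall>i\<le>n. (\<Sum>r\<le>n. v $ r * g r i) = 0"
    proof (intro allI impI)
      fix i assume i: "i \<le> n"
      have "(\<Sum>r\<le>n. v $ r * g r i) = (transpose_mat ?M *\<^sub>v v) $ i" by (rule entry[OF i v(1), symmetric])
      also have "\<dots> = 0" unfolding v(3) using i by simp
      finally show "(\<Sum>r\<le>n. v $ r * g r i) = 0" .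
    qed
    ultimately show "\<exists>c. (\<exists>r\<le>n. c r \<noteq> 0) \<and> (\<forall>i\<le>n. (\<Sum>r\<le>n. c r * g r i) = 0)"
      by (intro exI[of _ "\<lambda>r. v $ r"] conjI)
  next
    fix c r assume c: "r \<le> n" "c r \<noteq> 0" "\<forall>i\<le>n. (\<Sum>r\<le>n. c r * g r i) = 0"
    define v where "v = vec (n + 1) c"
    have vr: "v $ r = c r" if "r \<le> n" for r using that by (simp add: v_def)
    have v: "v \<in> carrier_vec (n + 1)" by (simp add: v_def)
    moreover have "v \<noteq> 0\<^sub>v (n + 1)" using c(1,2) vr[of r] by auto
    moreover have "transpose_mat ?M *\<^sub>v v = 0\<^sub>v (n + 1)"
    proof (rule eq_vecI)
      fix i assume "i < dim_vec (0\<^sub>v (n + 1) :: 'b vec)"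
      then have i: "i \<le> n" by simp
      have "(transpose_mat ?M *\<^sub>v v) $ i = (\<Sum>r\<le>n. c r * g r i)" unfolding entry[OF i v] by (simp add: vr)
      then show "(transpose_mat ?M *\<^sub>v v) $ i = 0\<^sub>v (n + 1) $ i" using c(3) i by simp
    qed simp
    ultimately show "\<exists>v. v \<in> carrier_vec (n + 1) \<and> v \<noteq> 0\<^sub>v (n + 1) \<and> transpose_mat ?M *\<^sub>v v = 0\<^sub>v (n + 1)"
      by blast
  qed
  finally show ?thesis .
qed

lemma ex_orthogonal_vector:
  fixes g :: "nat \<Rightarrow> nat \<Rightarrow> 'b::field"
  assumes "K \<le> n"
  shows "\<exists>z. (\<exists>i\<le>n. z i \<noteq> 0) \<and> (\<forall>r<K. (\<Sum>i\<le>n. z i * g r i) = 0)"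
proof -
  define g' where "g' r i = (if r < K then g r i else 0)" for r i
  have "det (mat (n + 1) (n + 1) (\<lambda>(r, i). g' r i)) = 0"
    unfolding det_eq_0_iff_row_relation using assms
    by (intro exI[of _ "\<lambda>r. if r = n then 1 else 0"]) (auto simp: g'_def if_distrib[of "\<lambda>c. c * _"] cong: if_cong)
  moreover have "mat (n + 1) (n + 1) (\<lambda>(r, i). g' i r) = transpose_mat (mat (n + 1) (n + 1) (\<lambda>(r, i). g' r i))"
    by (rule eq_matI) auto
  ultimately have "det (mat (n + 1) (n + 1) (\<lambda>(r, i). g' i r)) = 0"
    by (simp add: det_transpose[of _ "n + 1"])
  then obtain z where z: "\<exists>i\<le>n. z i \<noteq> 0" "\<forall>r\<le>n. (\<Sum>i\<le>n. z i * g' r i) = 0"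
    unfolding det_eq_0_iff_row_relation[of n "\<lambda>r i. g' i r"] by blast
  have "(\<Sum>i\<le>n. z i * g r i) = 0" if "r < K" for r
    using z(2)[rule_format, of r] that assms by (simp add: g'_def)
  then show ?thesis using z(1) by blast
qed

text \<open>
  A strictly increasing list satisfies \<open>i \<le> \<rho> ! i\<close>, so at the first deviation from \<open>0, 1, \<dots>\<close> it is larger.
\<close>

lemma upt_lex_minimal:
  assumes "sorted_wrt (<) \<rho>" "length \<rho> = k"
  shows "\<rho> = [0..<k] \<or> ([0..<k], \<rho>) \<in> lex less_than"
proof (cases "\<rho> = [0..<k]")
  case False
  have ge: "i \<le> \<rho> ! i" if "i < k" for i
    using that
  proof (induction i)
    case (Suc i)
    then have "\<rho> ! i < \<rho> ! Suc i" using assms by (intro sorted_wrt_nth_less[of "(<)"]) auto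
    then show ?case using Suc by simp
  qed simp
  define i where "i = (LEAST i. i < k \<and> \<rho> ! i \<noteq> i)"
  have "\<exists>i. i < k \<and> \<rho> ! i \<noteq> i" using False assms(2) by (auto simp: list_eq_iff_nth_eq)
  from LeastI_ex[OF this] have i: "i < k" "\<rho> ! i \<noteq> i" unfolding i_def by blast+
  have eq: "\<rho> ! j = j" if "j < i" for j
    using not_less_Least[of j "\<lambda>i. i < k \<and> \<rho> ! i \<noteq> i"] that i(1) unfolding i_def by auto
  have "take i \<rho> = take i [0..<k]" using i(1) assms(2) eq by (intro nth_equalityI) auto
  then have "[0..<k] = take i \<rho> @ i # drop (Suc i) [0..<k]"
    using id_take_nth_drop[of i "[0..<k]"] i(1) by simp
  moreover have "\<rho> = take i \<rho> @ \<rho> ! i # drop (Suc i) \<rho>" using i(1) assms(2) by (simp add: id_take_nth_drop)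
  moreover have "(i, \<rho> ! i) \<in> less_than" using ge[OF i(1)] i(2) by simp
  ultimately have "\<exists>xys x y xs' ys'. [0..<k] = xys @ x # xs' \<and> \<rho> = xys @ y # ys' \<and> (x, y) \<in> less_than"
    by blast
  then show ?thesis using assms(2) by (simp add: lex_conv)
qed simp

section \<open>Frobenius classicality\<close>

context smooth_curve
begin

text \<open>
  Let \<open>K\<close> be the last row that occurs in a relation between the rows. The rows before it span a space \<open>V\<close> that is
  stable under the derivation, since row \<open>K\<close> is in \<open>V\<close>; so \<open>V\<close> contains the first \<open>p\<close> Hasse derivatives of \<open>f\<close>. Its dimension
  is at most \<open>K \<le> n\<close>, hence some non-zero vector is orthogonal to it.
\<close>

lemma frobenius_det_classical_nonzero:
  fixes q u m :: nat
  assumes nd: "nondegenerate N C \<iota> x n f" and hd: "hasse_derivatives \<iota> t D" and n: "n \<ge> 2"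
    and p: "0 < p" "\<And>k. 0 < k \<Longrightarrow> k < p \<Longrightarrow> of_nat k \<noteq> (0 :: 'k)" "of_nat p = (0 :: 'b)"
    and q: "of_nat (q ^ m) = (0 :: 'b)" "of_nat (q ^ u) = (0 :: 'b)"
    and deg: "linear_series_degree N C \<iota> x n f < int p"
    and \<kappa>: "frobenius_det q u m n D f \<kappa> \<noteq> 0" "\<kappa> ! 0 = 0"
  shows "frobenius_det q u m n D f [0..<n - 1] \<noteq> 0"
proof
  assume det0: "frobenius_det q u m n D f [0..<n - 1] = 0"
  define row where "row r i = (if r = 0 then f i ^ (q ^ m) else if r = 1 then f i ^ (q ^ u) else D (r - 2) (f i))"
    for r i
  note d1 = hasse_derivation[OF hd]
  have "frobenius_det q u m n D f [0..<n - 1] = det (mat (n + 1) (n + 1) (\<lambda>(r, i). row r i))"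
    unfolding frobenius_det_def by (intro arg_cong[where f = det] eq_matI) (auto simp: row_def)
  with det0 obtain c where c: "\<exists>r\<le>n. c r \<noteq> 0" "\<And>i. i \<le> n \<Longrightarrow> (\<Sum>r\<le>n. c r * row r i) = 0"
    unfolding det_eq_0_iff_row_relation[of n row, symmetric] using det_eq_0_iff_row_relation[of n row] by auto
  define K where "K = Max {r. r \<le> n \<and> c r \<noteq> 0}"
  have "K \<in> {r. r \<le> n \<and> c r \<noteq> 0}" unfolding K_def using c(1) by (intro Max_in) auto
  then have K: "K \<le> n" "c K \<noteq> 0" by auto
  have gt: "c r = 0" if "K < r" "r \<le> n" for r
  proof (rule ccontr)
    assume "c r \<noteq> 0"
    then have "r \<le> K" unfolding K_def using that by (intro Max_ge) auto
    then show False using that by simp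
  qed
  \<comment> \<open>The first three rows are also rows of the matrix for \<open>\<kappa>\<close>, whose determinant is not zero.\<close>
  have "3 \<le> K"
  proof (rule ccontr)
    assume K3: "\<not> 3 \<le> K"
    have "frobenius_det q u m n D f \<kappa> =
      det (mat (n + 1) (n + 1) (\<lambda>(r, i). if r = 0 then f i ^ (q ^ m) else if r = 1 then f i ^ (q ^ u)
        else D (\<kappa> ! (r - 2)) (f i)))"
      by (simp add: frobenius_det_def)
    also have "\<dots> = 0"
      unfolding det_eq_0_iff_row_relation
    proof (intro exI[of _ c] conjI allI impI)
      fix i assume "i \<le> n"
      have "(\<Sum>r\<le>n. c r * (if r = 0 then f i ^ (q ^ m) else if r = 1 then f i ^ (q ^ u)
        else D (\<kappa> ! (r - 2)) (f i))) = (\<Sum>r\<le>n. c r * row r i)"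
      proof (rule sum.cong)
        fix r assume "r \<in> {..n}"
        then have r: "r \<le> n" by simp
        show "c r * (if r = 0 then f i ^ (q ^ m) else if r = 1 then f i ^ (q ^ u)
          else D (\<kappa> ! (r - 2)) (f i)) = c r * row r i"
        proof (cases "r \<le> 2")
          case True
          then have "r = 0 \<or> r = 1 \<or> r = 2" by auto
          then show ?thesis using \<kappa>(2) by (auto simp: row_def)
        next
          case False
          then show ?thesis using gt[OF _ r] K3 by simp
        qed
      qed simp
      then show "(\<Sum>r\<le>n. c r * (if r = 0 then f i ^ (q ^ m) else if r = 1 then f i ^ (q ^ u)
        else D (\<kappa> ! (r - 2)) (f i))) = 0" using c(2)[OF \<open>i \<le> n\<close>] by simp
    qed (fact c(1))
    finally show False using \<kappa>(1) by contradiction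
  qed
  define V where "V v \<longleftrightarrow> (\<exists>b. \<forall>i\<le>n. v i = (\<Sum>r<K. b r * row r i))" for v
  have V_add: "V (\<lambda>i. v i + w i)" if vw: "V v" "V w" for v w
  proof -
    from vw obtain a b where "\<forall>i\<le>n. v i = (\<Sum>r<K. a r * row r i)" "\<forall>i\<le>n. w i = (\<Sum>r<K. b r * row r i)"
      unfolding V_def by blast
    then show ?thesis
      unfolding V_def by (intro exI[of _ "\<lambda>r. a r + b r"]) (simp add: distrib_right sum.distrib)
  qed
  have V_scale: "V (\<lambda>i. e * v i)" if v: "V v" for v e
  proof -
    from v obtain a where "\<forall>i\<le>n. v i = (\<Sum>r<K. a r * row r i)" unfolding V_def by blast
    then show ?thesis
      unfolding V_def by (intro exI[of _ "\<lambda>r. e * a r"]) (simp add: sum_distrib_left mult.assoc)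
  qed
  have V_sum: "V (\<lambda>i. \<Sum>r\<in>R. g r i)" if "finite R" "\<And>r. r \<in> R \<Longrightarrow> V (g r)" for R :: "nat set" and g
    using that
  proof (induction R rule: finite_induct)
    case empty
    show ?case unfolding V_def by (intro exI[of _ "\<lambda>r. 0"]) simp
  next
    case (insert r R)
    then show ?case using V_add[of "g r" "\<lambda>i. \<Sum>r\<in>R. g r i"] by simp
  qed
  have V_cong: "V w" if "V v" "\<And>i. i \<le> n \<Longrightarrow> v i = w i" for v w
    using that unfolding V_def by auto
  have V_row: "V (row r)" if r: "r < K" for r
    unfolding V_def
  proof (intro exI[of _ "\<lambda>r'. if r' = r then 1 else 0"] allI impI)
    fix i
    have "(\<Sum>r'<K. (if r' = r then 1 else 0) * row r' i) = (\<Sum>r'<K. if r' = r then row r' i else 0)"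
      by (intro sum.cong) auto
    then show "row r i = (\<Sum>r'<K. (if r' = r then 1 else 0) * row r' i)" using r by simp
  qed
  have V_rowK: "V (row K)"
  proof (rule V_cong)
    show "V (\<lambda>i. \<Sum>r\<in>{..<K}. - (c r / c K) * row r i)"
      by (intro V_sum V_scale V_row) auto
    fix i assume i: "i \<le> n"
    have "0 = (\<Sum>r\<le>K. c r * row r i)"
      unfolding c(2)[OF i, symmetric] using K(1) gt by (intro sum.mono_neutral_right) auto
    also have "\<dots> = (\<Sum>r<K. c r * row r i) + c K * row K i" by (simp add: lessThan_Suc_atMost[symmetric])
    finally have "c K * row K i = - (\<Sum>r<K. c r * row r i)" by (simp add: eq_neg_iff_add_eq_0 add.commute)
    then have "row K i = - (\<Sum>r<K. c r * row r i) / c K" using K(2) by (simp add: field_simps)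
    then show "(\<Sum>r\<in>{..<K}. - (c r / c K) * row r i) = row K i"
      by (simp add: sum_negf sum_divide_distrib)
  qed
  have power0: "D 1 (y ^ Q) = 0" if "of_nat Q = (0 :: 'b)" for y Q
  proof (cases Q)
    case 0
    then show ?thesis using der_one[OF d1(1)] by simp
  next
    case (Suc k)
    have "D 1 (y ^ Suc k) = of_nat (Suc k) * y ^ k * D 1 y" by (rule der_power[OF d1(1)])
    then show ?thesis using that unfolding Suc by (simp only: mult_zero_left)
  qed
  have d_row: "D 1 (row r i) = (if r < 2 then 0 else of_nat (r - 1) * row (Suc r) i)" for r i
  proof (cases "r < 2")
    case True
    then have "r = 0 \<or> r = 1" by auto
    then show ?thesis using power0 q by (auto simp: row_def simp del: One_nat_def)
  next
    case False
    then obtain k where k: "r = k + 2" by (metis add.commute le_Suc_ex not_less)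
    have "D 1 (D k (f i)) = of_nat (Suc k) * D (Suc k) (f i)" by (rule hasse_composition[OF hd])
    then show ?thesis by (simp add: row_def k del: of_nat_Suc One_nat_def)
  qed
  have V_drow: "V (\<lambda>i. D 1 (row r i))" if r: "r < K" for r
  proof (cases "r < 2")
    case True
    then show ?thesis unfolding d_row V_def by (intro exI[of _ "\<lambda>r. 0"]) simp
  next
    case False
    have "V (row (Suc r))" using V_row[of "Suc r"] V_rowK r by (cases "Suc r = K") auto
    from V_scale[OF this, of "of_nat (r - 1)"] show ?thesis unfolding d_row using False by simp
  qed
  have V_der: "V (\<lambda>i. D 1 (v i))" if v: "V v" for v
  proof -
    from v obtain b where b: "\<And>i. i \<le> n \<Longrightarrow> v i = (\<Sum>r<K. b r * row r i)" unfolding V_def by blast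
    show ?thesis
    proof (rule V_cong)
      show "V (\<lambda>i. \<Sum>r\<in>{..<K}. D 1 (b r) * row r i + b r * D 1 (row r i))"
        by (intro V_sum V_add V_scale V_row V_drow) auto
      show "(\<Sum>r\<in>{..<K}. D 1 (b r) * row r i + b r * D 1 (row r i)) = D 1 (v i)" if "i \<le> n" for i
        unfolding b[OF that] by (simp add: der_sum[OF d1(1)] der_mult[OF d1(1)] del: One_nat_def)
    qed
  qed
  have V_D: "V (\<lambda>i. D j (f i))" if "j < p" for j
    using that
  proof (induction j)
    case 0
    have "V (row 2)" using V_row \<open>3 \<le> K\<close> by simp
    then show ?case by (simp add: row_def[abs_def])
  next
    case (Suc j)
    then have "V (\<lambda>i. of_nat (Suc j) * D (Suc j) (f i))"
      using V_der[of "\<lambda>i. D j (f i)"] unfolding hasse_composition[OF hd] by simp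
    from V_scale[OF this, of "1 / of_nat (Suc j)"]
    have V: "V (\<lambda>i. 1 / of_nat (Suc j) * (of_nat (Suc j) * D (Suc j) (f i)))" .
    have "of_nat (Suc j) = \<iota> (of_nat (Suc j))" by (simp only: hom_of_nat)
    then have "of_nat (Suc j) \<noteq> (0 :: 'b)" using p(2)[of "Suc j"] Suc.prems by (metis hom_0 zero_less_Suc)
    then show ?case using V by (simp del: of_nat_Suc)
  qed
  obtain z where z: "\<exists>i\<le>n. z i \<noteq> 0" "\<And>r. r < K \<Longrightarrow> (\<Sum>i\<le>n. z i * row r i) = 0"
    using ex_orthogonal_vector[OF K(1), of row] by blast
  have "(\<Sum>i\<le>n. z i * v i) = 0" if v: "V v" for v
  proof -
    from v obtain b where b: "\<And>i. i \<le> n \<Longrightarrow> v i = (\<Sum>r<K. b r * row r i)" unfolding V_def by blast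
    have "(\<Sum>i\<le>n. z i * v i) = (\<Sum>i\<le>n. \<Sum>r<K. b r * (z i * row r i))"
      by (intro sum.cong) (simp_all add: b sum_distrib_left mult.left_commute)
    also have "\<dots> = (\<Sum>r<K. b r * (\<Sum>i\<le>n. z i * row r i))"
      unfolding sum_distrib_left by (rule sum.swap)
    also have "\<dots> = 0" using z(2) by simp
    finally show ?thesis .
  qed
  then have "(\<Sum>i\<le>n. z i * D r (f i)) = 0" if "r < p" for r using V_D[OF that] by blast
  from degree_ge_if_orthogonal[OF nd hd p z(1) this] deg show False by simp
qed

end

lemma (in nonsingular_projective_curve) smooth_curve: "smooth_curve \<iota> N C x"
proof -
  interpret field_hom \<iota> using function_field by (simp add: function_field_def)
  show ?thesis
  proof
    show "transcendence_degree_one \<iota>" by (rule dimension_one)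
    show "zariski_closed N C"
      using defined_over unfolding defined_over_def zariski_closed_def by blast
    show "C \<noteq> {}" using geometrically_irreducible by (simp add: irreducible_set_def)
    show "function_field N C \<iota> x" by (rule function_field)
    show "\<forall>P\<in>C. \<exists>s. local_parameter N \<iota> x P s" by (rule nonsingular)
  qed
qed

theorem corollary3p8:
  fixes N n u m :: nat
    and C :: "'a::finite_field alg_closure point set"
    and \<iota> :: "'a alg_closure \<Rightarrow> 'b::field"
    and x f :: "nat \<Rightarrow> 'b"
    and t :: 'b
    and D :: "nat \<Rightarrow> 'b \<Rightarrow> 'b"
    and \<kappa> :: "nat list"
  assumes curve: "nonsingular_projective_curve N C \<iota> x"
    and n: "n \<ge> 2"
    and um: "coprime u m" "m > u" "u \<ge> 1"
    and f: "\<forall>i\<le>n. f i \<in> rational_functions N \<iota> x (range to_ac)"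
    and nondeg: "nondegenerate N C \<iota> x n f"
    and t: "separating_variable (\<iota> \<circ> to_ac) (rational_functions N \<iota> x (range to_ac)) t"
    and D: "hasse_derivatives \<iota> t D"
    and kappa: "frobenius_order_sequence CARD('a) u m n D f \<kappa>"
    and kappa0: "\<kappa> ! 0 = 0"
    and p: "int CHAR('a) > linear_series_degree N C \<iota> x n f"
  shows "frobenius_classical CARD('a) u m n D f"
proof -
  interpret smooth_curve \<iota> N C x by (rule nonsingular_projective_curve.smooth_curve[OF curve])
  let ?q = "CARD('a)" and ?p = "CHAR('a)"
  have zero: "of_nat k = (0 :: 'b)" if "?p dvd k" for k
  proof -
    have "of_nat k = (0 :: 'a alg_closure)" using that by (simp add: of_nat_eq_0_iff_char_dvd)
    then have "\<iota> (of_nat k) = 0" by simp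
    then show ?thesis by (simp only: hom_of_nat)
  qed
  have nonzero: "of_nat k \<noteq> (0 :: 'a alg_closure)" if "0 < k" "k < ?p" for k
    using that by (simp add: of_nat_eq_0_iff_char_dvd nat_dvd_not_less)
  have p0: "0 < ?p" using finite_imp_CHAR_pos[where 'a = 'a] by simp
  have p_dvd_q: "?p dvd ?q" by (rule CHAR_dvd_CARD)
  have pq: "?p dvd ?q ^ k" if "k \<ge> 1" for k 
    using that by (intro dvd_trans[OF p_dvd_q dvd_power]) simp
  have admissible: "frobenius_det ?q u m n D f \<kappa> \<noteq> 0"
    using kappa by (auto simp: frobenius_order_sequence_def Let_def)
  have det: "frobenius_det ?q u m n D f [0..<n - 1] \<noteq> 0"
    by (rule frobenius_det_classical_nonzero[OF nondeg D n p0 nonzero zero zero zero p admissible kappa0])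
      (use um pq in auto)
  have "frobenius_order_sequence ?q u m n D f [0..<n - 1]"
    unfolding frobenius_order_sequence_def Let_def using det upt_lex_minimal[of _ "n - 1"]
    by (auto simp: sorted_wrt_upt)
  then show ?thesis unfolding frobenius_classical_def by (intro exI[of _ "[0..<n - 1]"]) auto
qed

end
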